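(* Let $0<\alpha,\beta<\infty$, let $\varphi:D\to D$ be an analytic self-map of $D$, let $g\in H(D)$, and suppose that the operator $C_\varphi V_g:\mathcal{Z}^\alpha\to\mathcal{Z}^\beta$, $(C_\varphi V_g f)(z)=\int_0^{\varphi(z)} f'(\xi)g(\xi)\,d\xi$, is bounded. (i) If $0<\alpha<1$, then $$\|C_\varphi V_g\|_{e,\mathcal{Z}^\alpha\to\mathcal{Z}^\beta}\asymp\limsup_{n\to\infty}(n+1)^\alpha\|(g\circ\varphi)(\varphi')^2\varphi^n\|_{v_\beta}.$$ (ii) If $\alpha=1$, then $$\|C_\varphi V_g\|_{e,\mathcal{Z}^1\to\mathcal{Z}^\beta}\asymp\max\Big\{\limsup_{n\to\infty}(n+1)\|(g\circ\varphi)(\varphi')^2\varphi^n\|_{v_\beta},\ \limsup_{n\to\infty}(\log n)\|((g'\circ\varphi)(\varphi')^2+(g\circ\varphi)\varphi'')\varphi^n\|_{v_\beta}\Big\}.$$ (iii) If $\alpha>1$, then $$\|C_\varphi V_g\|_{e,\mathcal{Z}^\alpha\to\mathcal{Z}^\beta}\asymp\max\Big\{\limsup_{n\to\infty}(n+1)^\alpha\|(g\circ\varphi)(\varphi')^2\varphi^n\|_{v_\beta},\ \limsup_{n\to\infty}(n+1)^{\alpha-1}\|((g'\circ\varphi)(\varphi')^2+(g\circ\varphi)\varphi'')\varphi^n\|_{v_\beta}\Big\}.$$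
   Context: $D=\{z\in\mathbb{C}:|z|<1\}$ and $H(D)$ is the set of analytic functions on $D$. For $0<\alpha<\infty$, the Zygmund type space $\mathcal{Z}^\alpha$ is the Banach space of $f\in H(D)$ with $\sup_{z\in D}(1-|z|^2)^\alpha|f''(z)|<\infty$, normed by $\|f\|_{\mathcal{Z}^\alpha}=|f(0)|+|f'(0)|+\sup_{z\in D}(1-|z|^2)^\alpha|f''(z)|$. For $0<\beta<\infty$, $v_\beta(z)=(1-|z|^2)^\beta$ and $\|h\|_{v_\beta}=\sup_{z\in D}v_\beta(z)|h(z)|$ for $h\in H(D)$. $\varphi^n$ denotes the $n$-th power (pointwise product) of $\varphi$. The essential norm of a bounded linear operator $T:X\to Y$ is $\|T\|_{e,X\to Y}=\inf\{\|T+K\|_{X\to Y}: K:X\to Y\text{ compact}\}$. $A\asymp B$ means that there are positive constants $C_1,C_2$ with $C_1A\le B\le C_2A$ (constants not depending on $g$ or $\varphi$). *)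

theory Defs
  imports "HOL-Complex_Analysis.Complex_Analysis"
begin

abbreviation unit_disc :: "complex set"
  where "unit_disc \<equiv> ball 0 1"

text \<open>The weighted supremum norm for the weight \<open>(1 - |z|\<^sup>2)\<^sup>\<beta>\<close>; the value \<open>\<infinity>\<close> is allowed.\<close>

definition weighted_norm :: "real \<Rightarrow> (complex \<Rightarrow> complex) \<Rightarrow> ennreal"
  where "weighted_norm \<beta> h =
    (SUP z\<in>unit_disc. ennreal ((1 - (norm z)\<^sup>2) powr \<beta> * norm (h z)))"

text \<open>
  A function on the disc is represented by its extension by zero to the whole plane. With this
  choice of representatives equality on the disc is equality, and the Zygmund norm is a norm.
\<close>

definition zygmund_space :: "real \<Rightarrow> (complex \<Rightarrow> complex) set"
  where "zygmund_space \<alpha> = {f. f holomorphic_on unit_disc \<and> (\<forall>z. z \<notin> unit_disc \<longrightarrow> f z = 0) \<and>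
    weighted_norm \<alpha> (deriv (deriv f)) < \<infinity>}"

definition zygmund_norm :: "real \<Rightarrow> (complex \<Rightarrow> complex) \<Rightarrow> real"
  where "zygmund_norm \<alpha> f =
    norm (f 0) + norm (deriv f 0) + enn2real (weighted_norm \<alpha> (deriv (deriv f)))"

text \<open>Only the values of an operator on its domain \<^term>\<open>zygmund_space \<alpha>\<close> matter below.\<close>

type_synonym oper = "(complex \<Rightarrow> complex) \<Rightarrow> complex \<Rightarrow> complex"

definition bounded_operator :: "real \<Rightarrow> real \<Rightarrow> oper \<Rightarrow> bool"
  where "bounded_operator \<alpha> \<beta> T \<longleftrightarrow>
    (\<forall>f\<in>zygmund_space \<alpha>. T f \<in> zygmund_space \<beta>) \<and>
    (\<forall>f\<in>zygmund_space \<alpha>. \<forall>h\<in>zygmund_space \<alpha>. T (\<lambda>z. f z + h z) = (\<lambda>z. T f z + T h z)) \<and>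
    (\<forall>c. \<forall>f\<in>zygmund_space \<alpha>. T (\<lambda>z. c * f z) = (\<lambda>z. c * T f z)) \<and>
    (\<exists>C. \<forall>f\<in>zygmund_space \<alpha>. zygmund_norm \<beta> (T f) \<le> C * zygmund_norm \<alpha> f)"

definition compact_operator :: "real \<Rightarrow> real \<Rightarrow> oper \<Rightarrow> bool"
  where "compact_operator \<alpha> \<beta> K \<longleftrightarrow> bounded_operator \<alpha> \<beta> K \<and>
    (\<forall>f :: nat \<Rightarrow> complex \<Rightarrow> complex.
      (\<forall>n. f n \<in> zygmund_space \<alpha>) \<and> (\<exists>M. \<forall>n. zygmund_norm \<alpha> (f n) \<le> M) \<longrightarrow>
      (\<exists>r. \<exists>h\<in>zygmund_space \<beta>. strict_mono (r :: nat \<Rightarrow> nat) \<and>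
        (\<lambda>n. zygmund_norm \<beta> (\<lambda>z. K (f (r n)) z - h z)) \<longlonglongrightarrow> 0))"

definition operator_norm :: "real \<Rightarrow> real \<Rightarrow> oper \<Rightarrow> ennreal"
  where "operator_norm \<alpha> \<beta> T =
    (SUP f\<in>{f\<in>zygmund_space \<alpha>. zygmund_norm \<alpha> f \<le> 1}. ennreal (zygmund_norm \<beta> (T f)))"

definition essential_norm :: "real \<Rightarrow> real \<Rightarrow> oper \<Rightarrow> ennreal"
  where "essential_norm \<alpha> \<beta> T =
    (INF K\<in>{K. compact_operator \<alpha> \<beta> K}. operator_norm \<alpha> \<beta> (\<lambda>f z. T f z + K f z))"

definition comp_volterra :: "(complex \<Rightarrow> complex) \<Rightarrow> (complex \<Rightarrow> complex) \<Rightarrow> oper"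
  where "comp_volterra \<phi> g f = (\<lambda>z. if z \<in> unit_disc
    then contour_integral (linepath 0 (\<phi> z)) (\<lambda>\<xi>. deriv f \<xi> * g \<xi>) else 0)"

text \<open>
  Comparability of two quantities depending on \<open>\<phi>\<close> and \<open>g\<close>, where \<open>\<phi>\<close> and \<open>g\<close> range over all
  symbols inducing a bounded operator. The constants may depend on \<open>\<alpha>\<close> and \<open>\<beta>\<close> only.
\<close>

definition comparable_on_bounded_symbols :: "real \<Rightarrow> real \<Rightarrow>
    ((complex \<Rightarrow> complex) \<Rightarrow> (complex \<Rightarrow> complex) \<Rightarrow> ennreal) \<Rightarrow>
    ((complex \<Rightarrow> complex) \<Rightarrow> (complex \<Rightarrow> complex) \<Rightarrow> ennreal) \<Rightarrow> bool"
  where "comparable_on_bounded_symbols \<alpha> \<beta> A B \<longleftrightarrow>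
    (\<exists>C\<^sub>1>0. \<exists>C\<^sub>2>0. \<forall>\<phi> g.
      \<phi> holomorphic_on unit_disc \<longrightarrow> \<phi> ` unit_disc \<subseteq> unit_disc \<longrightarrow>
      g holomorphic_on unit_disc \<longrightarrow> bounded_operator \<alpha> \<beta> (comp_volterra \<phi> g) \<longrightarrow>
      ennreal C\<^sub>1 * A \<phi> g \<le> B \<phi> g \<and> B \<phi> g \<le> ennreal C\<^sub>2 * A \<phi> g)"

definition symbol1 :: "(complex \<Rightarrow> complex) \<Rightarrow> (complex \<Rightarrow> complex) \<Rightarrow> complex \<Rightarrow> complex"
  where "symbol1 \<phi> g z = g (\<phi> z) * (deriv \<phi> z)\<^sup>2"

definition symbol2 :: "(complex \<Rightarrow> complex) \<Rightarrow> (complex \<Rightarrow> complex) \<Rightarrow> complex \<Rightarrow> complex"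
  where "symbol2 \<phi> g z =
    deriv g (\<phi> z) * (deriv \<phi> z)\<^sup>2 + g (\<phi> z) * deriv (deriv \<phi>) z"

end

theory Submission
  imports Defs
begin

text \<open>
  Write \<open>T\<close> for the operator, \<open>u\<close> and \<open>w\<close> for its two symbols and \<open>E\<close> for its essential norm. The
  starting point is \<open>(T f)'' = u f''(\<phi>) + w f'(\<phi>)\<close>: the size of \<open>T f\<close> is governed by \<open>u\<close> against
  the growth of \<open>f''\<close> and by \<open>w\<close> against the growth of \<open>f'\<close>, both near the boundary. The weighted
  norms of \<open>u \<phi>\<^sup>n\<close> and \<open>w \<phi>\<^sup>n\<close> measure the symbols essentially at the points where \<open>1 - |\<phi>|\<close> is at
  most of order \<open>1 / n\<close>.

  Upper estimate. Composing \<open>T\<close> with a dilation \<open>f(z) \<mapsto> f(r z)\<close> gives a compact operator, by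
  Montel's theorem, so \<open>E\<close> is at most the norm of \<open>T\<close> on the differences \<open>G(z) = f(z) - f(r z)\<close>. For
  \<open>r\<close> close to 1 the derivatives of \<open>G\<close> are small on any prescribed compact set, and
  \<open>|G''(z)| \<le> 2 (1 - |z|) powr - \<alpha>\<close> everywhere; integrating along a radius bounds \<open>G'\<close> by a constant
  (\<open>\<alpha> < 1\<close>), a logarithm (\<open>\<alpha> = 1\<close>) or a power (\<open>\<alpha> > 1\<close>). For a point with \<open>|\<phi>(z)| = \<rho>\<close> near 1, the
  exponent \<open>n = \<lfloor>1 / (1 - \<rho>)\<rfloor>\<close> has \<open>\<rho>\<^sup>n\<close> bounded below, which compares this growth with the norms
  of \<open>u \<phi>\<^sup>n\<close> and \<open>w \<phi>\<^sup>n\<close>.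

  Lower estimate. Compact operators send suitable bounded sequences, locally small but reaching
  the boundary, to sequences tending to 0 in norm. Instead of duality, the proof extracts a
  subsequence all of whose partial sums are bounded (a sliding hump): if the images converged to
  some \<open>h \<noteq> 0\<close>, the images of these sums would grow like \<open>N h\<close>. Hence \<open>E\<close> bounds the images under
  \<open>T\<close> of every such sequence. Normalized monomials bound \<open>n powr (\<alpha> - 1)\<close> times the norm of
  \<open>D\<^sub>n = (n + 1) u \<phi>\<^sup>n + w \<phi>\<^sup>n\<^sup>+\<^sup>1\<close>, and the identity \<open>D\<^sub>2\<^sub>n - \<phi>\<^sup>n D\<^sub>n = n u \<phi>\<^sup>2\<^sup>n\<close> isolates \<open>u\<close>, and then
  \<open>w\<close> if \<open>\<alpha> > 1\<close>. For \<open>\<alpha> = 1\<close> the factor of \<open>w\<close> is too small by a logarithm; it is gained with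
  rotated blocks \<open>\<Sum> (l z)\<^sup>k / k\<close> of the logarithmic series in the place of \<open>f'\<close>.
\<close>

section \<open>The Zygmund norm and bounded operators\<close>

abbreviation weight :: "real \<Rightarrow> complex \<Rightarrow> real"
  where "weight \<gamma> z \<equiv> (1 - (norm z)\<^sup>2) powr \<gamma>"

definition extend_by_zero :: "(complex \<Rightarrow> complex) \<Rightarrow> complex \<Rightarrow> complex"
  where "extend_by_zero h = (\<lambda>z. if z \<in> unit_disc then h z else 0)"

lemma weight_nonneg: "0 \<le> weight \<gamma> z"
  by simp

lemma one_minus_norm_sq_pos: "norm (z::complex) < 1 \<Longrightarrow> 0 < 1 - (norm z)\<^sup>2"
  by (simp add: abs_square_less_1)

lemma weight_le_1: "0 \<le> \<gamma> \<Longrightarrow> norm z < 1 \<Longrightarrow> weight \<gamma> z \<le> 1"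
  using one_minus_norm_sq_pos[of z] by (intro powr_le1) auto

lemma weight_pos: "norm z < 1 \<Longrightarrow> 0 < weight \<gamma> z"
  using one_minus_norm_sq_pos[of z] by simp

lemma weighted_norm_le_iff:
  "0 \<le> C \<Longrightarrow> weighted_norm \<gamma> h \<le> ennreal C \<longleftrightarrow> (\<forall>z\<in>unit_disc. weight \<gamma> z * norm (h z) \<le> C)"
  unfolding weighted_norm_def by (simp add: SUP_le_iff)

lemma weighted_norm_finite_bound:
  assumes "weighted_norm \<gamma> h < \<infinity>" "norm z < 1"
  shows "weight \<gamma> z * norm (h z) \<le> enn2real (weighted_norm \<gamma> h)"
proof -
  have "weighted_norm \<gamma> h \<le> ennreal (enn2real (weighted_norm \<gamma> h))"
    using assms(1) by (simp add: less_top)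
  then show ?thesis
    using weighted_norm_le_iff[of "enn2real (weighted_norm \<gamma> h)"] assms(2) by simp
qed

lemma zygmund_holomorphic: "f \<in> zygmund_space \<gamma> \<Longrightarrow> f holomorphic_on unit_disc"
  by (simp add: zygmund_space_def)

lemma zygmund_deriv_holomorphic:
  assumes "f \<in> zygmund_space \<gamma>"
  shows "deriv f holomorphic_on unit_disc" "deriv (deriv f) holomorphic_on unit_disc"
  using zygmund_holomorphic[OF assms] by (auto intro!: holomorphic_deriv)

lemma zygmund_DERIV:
  assumes "f \<in> zygmund_space \<gamma>" "norm z < 1"
  shows "(f has_field_derivative deriv f z) (at z)"
    "(deriv f has_field_derivative deriv (deriv f) z) (at z)"
  using zygmund_holomorphic[OF assms(1)] zygmund_deriv_holomorphic(1)[OF assms(1)] assms(2)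
  by (auto intro!: holomorphic_derivI[of _ unit_disc])

lemma zygmund_norm_nonneg: "0 \<le> zygmund_norm \<gamma> f"
  by (simp add: zygmund_norm_def)

lemma zygmund_second_deriv_bound:
  assumes "f \<in> zygmund_space \<gamma>" "norm z < 1"
  shows "weight \<gamma> z * norm (deriv (deriv f) z) + norm (f 0) + norm (deriv f 0) \<le> zygmund_norm \<gamma> f"
  using weighted_norm_finite_bound[of \<gamma> "deriv (deriv f)" z] assms
  by (auto simp: zygmund_space_def zygmund_norm_def)

lemma zygmund_second_deriv_le:
  assumes "f \<in> zygmund_space \<gamma>" "norm z < 1"
  shows "weight \<gamma> z * norm (deriv (deriv f) z) \<le> zygmund_norm \<gamma> f"
  using zygmund_second_deriv_bound[OF assms] by (smt (verit) norm_ge_zero)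

lemma zygmund_norm_at_0:
  assumes "f \<in> zygmund_space \<gamma>"
  shows "norm (f 0) \<le> zygmund_norm \<gamma> f" "norm (deriv f 0) \<le> zygmund_norm \<gamma> f"
  by (simp_all add: zygmund_norm_def)

lemma second_deriv_eqI:
  fixes f :: "complex \<Rightarrow> complex"
  assumes f1: "\<And>z. norm z < 1 \<Longrightarrow> (f has_field_derivative f1 z) (at z)"
    and f2: "\<And>z. norm z < 1 \<Longrightarrow> (f1 has_field_derivative f2 z) (at z)"
    and z: "norm z < 1"
  shows "deriv (deriv f) z = f2 z"
proof (rule DERIV_imp_deriv)
  show "(deriv f has_field_derivative f2 z) (at z)"
    by (rule has_field_derivative_transform_within_open[OF f2[OF z], of unit_disc])
      (use z DERIV_imp_deriv[OF f1] in auto)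
qed

text \<open>
  Membership and norm bounds below come from this rule. It asks for the two derivatives on the
  disc only, where explicit formulas for them are available.
\<close>
lemma zygmundI:
  assumes f1: "\<And>z. norm z < 1 \<Longrightarrow> (f has_field_derivative f1 z) (at z)"
    and f2: "\<And>z. norm z < 1 \<Longrightarrow> (f1 has_field_derivative f2 z) (at z)"
    and ext: "\<And>z. norm z \<ge> 1 \<Longrightarrow> f z = 0"
    and bd: "\<And>z. norm z < 1 \<Longrightarrow> weight \<gamma> z * norm (f2 z) \<le> C"
  shows "f \<in> zygmund_space \<gamma>"
    and "zygmund_norm \<gamma> f \<le> norm (f 0) + norm (f1 0) + C"
    and "norm z < 1 \<Longrightarrow> deriv f z = f1 z"
    and "norm z < 1 \<Longrightarrow> deriv (deriv f) z = f2 z"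
proof -
  have d1: "deriv f z = f1 z" if "norm z < 1" for z
    using f1[OF that] by (rule DERIV_imp_deriv)
  note d2 = second_deriv_eqI[OF f1 f2]
  have C: "0 \<le> C"
    using bd[of 0] by (smt (verit) mult_nonneg_nonneg norm_ge_zero norm_zero weight_nonneg)
  have le: "weighted_norm \<gamma> (deriv (deriv f)) \<le> ennreal C"
    using bd d2 by (subst weighted_norm_le_iff[OF C]) auto
  have hol: "f holomorphic_on unit_disc"
    using f1 by (subst holomorphic_on_open) (auto, metis)
  from le have "weighted_norm \<gamma> (deriv (deriv f)) < \<infinity>"
    by (simp add: le_less_trans)
  with hol ext show "f \<in> zygmund_space \<gamma>"
    by (auto simp: zygmund_space_def)
  have "enn2real (weighted_norm \<gamma> (deriv (deriv f))) \<le> C"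
    using le C by (metis enn2real_leI)
  then show "zygmund_norm \<gamma> f \<le> norm (f 0) + norm (f1 0) + C"
    using d1[of 0] by (simp add: zygmund_norm_def)
  show "norm z < 1 \<Longrightarrow> deriv f z = f1 z" "norm z < 1 \<Longrightarrow> deriv (deriv f) z = f2 z"
    using d1 d2 by auto
qed

lemma zygmund_outside: "f \<in> zygmund_space \<gamma> \<Longrightarrow> norm z \<ge> 1 \<Longrightarrow> f z = 0"
  by (auto simp: zygmund_space_def)

lemma extend_by_zero_DERIV:
  assumes "norm z < 1" "(h has_field_derivative d) (at z)"
  shows "(extend_by_zero h has_field_derivative d) (at z)"
  by (rule has_field_derivative_transform_within_open[OF assms(2), of unit_disc])
    (use assms(1) in \<open>auto simp: extend_by_zero_def\<close>)

lemma zygmund_norm_le: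
  assumes "f \<in> zygmund_space \<gamma>" "norm (f 0) \<le> A" "norm (deriv f 0) \<le> B"
    and "\<And>z. norm z < 1 \<Longrightarrow> weight \<gamma> z * norm (deriv (deriv f) z) \<le> C"
  shows "zygmund_norm \<gamma> f \<le> A + B + C"
  using zygmundI(2)[of f "deriv f" "deriv (deriv f)" \<gamma> C] zygmund_DERIV[OF assms(1)]
    zygmund_outside[OF assms(1)] assms(2-4) by fastforce

lemma zygmund_lincomb:
  fixes a b :: complex
  assumes f: "f \<in> zygmund_space \<gamma>" and h: "h \<in> zygmund_space \<gamma>"
  defines "k \<equiv> (\<lambda>z. a * f z + b * h z)"
  shows "k \<in> zygmund_space \<gamma>"
    and "zygmund_norm \<gamma> k \<le> norm a * zygmund_norm \<gamma> f + norm b * zygmund_norm \<gamma> h"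
    and "norm z < 1 \<Longrightarrow> deriv k z = a * deriv f z + b * deriv h z"
    and "norm z < 1 \<Longrightarrow> deriv (deriv k) z = a * deriv (deriv f) z + b * deriv (deriv h) z"
proof -
  let ?S = "\<lambda>f. enn2real (weighted_norm \<gamma> (deriv (deriv f)))"
  have bd: "weight \<gamma> z * norm (a * deriv (deriv f) z + b * deriv (deriv h) z)
      \<le> norm a * ?S f + norm b * ?S h" if "norm z < 1" for z
  proof -
    have "weight \<gamma> z * norm (a * deriv (deriv f) z + b * deriv (deriv h) z)
        \<le> weight \<gamma> z * (norm a * norm (deriv (deriv f) z) + norm b * norm (deriv (deriv h) z))"
      by (intro mult_left_mono order_trans[OF norm_triangle_ineq]) (auto simp: norm_mult)
    also have "\<dots> = norm a * (weight \<gamma> z * norm (deriv (deriv f) z))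
        + norm b * (weight \<gamma> z * norm (deriv (deriv h) z))"
      by (simp add: algebra_simps)
    also have "\<dots> \<le> norm a * ?S f + norm b * ?S h"
      using weighted_norm_finite_bound[of \<gamma> _ z] f h that
      by (intro add_mono mult_left_mono) (auto simp: zygmund_space_def)
    finally show ?thesis .
  qed
  have d: "(k has_field_derivative a * deriv f z + b * deriv h z) (at z)"
    "((\<lambda>z. a * deriv f z + b * deriv h z) has_field_derivative
      a * deriv (deriv f) z + b * deriv (deriv h) z) (at z)" if "norm z < 1" for z
    unfolding k_def using zygmund_DERIV[OF f that] zygmund_DERIV[OF h that]
    by (auto intro!: derivative_eq_intros)
  have o: "k z = 0" if "norm z \<ge> 1" for z
    using zygmund_outside[OF f that] zygmund_outside[OF h that] by (simp add: k_def)
  note I = zygmundI[OF d o bd]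
  from I show "k \<in> zygmund_space \<gamma>" "norm z < 1 \<Longrightarrow> deriv k z = a * deriv f z + b * deriv h z"
    "norm z < 1 \<Longrightarrow> deriv (deriv k) z = a * deriv (deriv f) z + b * deriv (deriv h) z"
    by auto
  have "norm (k 0) \<le> norm a * norm (f 0) + norm b * norm (h 0)"
    "norm (a * deriv f 0 + b * deriv h 0) \<le> norm a * norm (deriv f 0) + norm b * norm (deriv h 0)"
    unfolding k_def by (auto intro!: order_trans[OF norm_triangle_ineq] simp: norm_mult)
  then show "zygmund_norm \<gamma> k \<le> norm a * zygmund_norm \<gamma> f + norm b * zygmund_norm \<gamma> h"
    using I(2) by (simp add: zygmund_norm_def algebra_simps)
qed

lemma zygmund_add:
  assumes "f \<in> zygmund_space \<gamma>" "h \<in> zygmund_space \<gamma>"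
  shows "(\<lambda>z. f z + h z) \<in> zygmund_space \<gamma>"
    "zygmund_norm \<gamma> (\<lambda>z. f z + h z) \<le> zygmund_norm \<gamma> f + zygmund_norm \<gamma> h"
  using zygmund_lincomb[OF assms, of 1 1] by simp_all

lemma zygmund_diff:
  assumes "f \<in> zygmund_space \<gamma>" "h \<in> zygmund_space \<gamma>"
  shows "(\<lambda>z. f z - h z) \<in> zygmund_space \<gamma>"
    "zygmund_norm \<gamma> (\<lambda>z. f z - h z) \<le> zygmund_norm \<gamma> f + zygmund_norm \<gamma> h"
  using zygmund_lincomb[OF assms, of 1 "-1"] by simp_all

lemma zygmund_scale:
  assumes "f \<in> zygmund_space \<gamma>"
  shows "(\<lambda>z. c * f z) \<in> zygmund_space \<gamma>"
    "zygmund_norm \<gamma> (\<lambda>z. c * f z) = norm c * zygmund_norm \<gamma> f"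
proof -
  have le: "(\<lambda>z. c * f z) \<in> zygmund_space \<gamma> \<and>
      zygmund_norm \<gamma> (\<lambda>z. c * f z) \<le> norm c * zygmund_norm \<gamma> f"
    if "f \<in> zygmund_space \<gamma>" for c f
    using zygmund_lincomb[OF that that, of c 0] by simp
  then show "(\<lambda>z. c * f z) \<in> zygmund_space \<gamma>"
    using assms by blast
  show "zygmund_norm \<gamma> (\<lambda>z. c * f z) = norm c * zygmund_norm \<gamma> f"
  proof (cases "c = 0")
    case True
    then show ?thesis
      using le[OF assms, of 0] zygmund_norm_nonneg[of \<gamma> "\<lambda>z. 0"] by simp
  next
    case False
    have "zygmund_norm \<gamma> f \<le> norm (inverse c) * zygmund_norm \<gamma> (\<lambda>z. c * f z)"
      using le[of "\<lambda>z. c * f z" "inverse c"] le[OF assms, of c] False by (simp add: mult.assoc[symmetric])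
    then show ?thesis
      using le[OF assms, of c] False by (simp add: norm_divide field_simps)
  qed
qed

lemma zygmund_zero: "(\<lambda>z. 0) \<in> zygmund_space \<gamma>"
  using zygmundI(1)[of "\<lambda>z. 0" "\<lambda>z. 0" "\<lambda>z. 0" \<gamma> 0] by simp

lemma zygmund_norm_zero: "zygmund_norm \<gamma> (\<lambda>z. 0) = 0"
  using zygmund_scale(2)[OF zygmund_zero, of \<gamma> 0] by simp

lemma bounded_operatorD:
  assumes "bounded_operator \<alpha> \<beta> T"
  shows "f \<in> zygmund_space \<alpha> \<Longrightarrow> T f \<in> zygmund_space \<beta>"
    "f \<in> zygmund_space \<alpha> \<Longrightarrow> h \<in> zygmund_space \<alpha> \<Longrightarrow> T (\<lambda>z. f z + h z) = (\<lambda>z. T f z + T h z)"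
    "f \<in> zygmund_space \<alpha> \<Longrightarrow> T (\<lambda>z. c * f z) = (\<lambda>z. c * T f z)"
  using assms by (auto simp: bounded_operator_def)

lemma bounded_operator_bound:
  assumes "bounded_operator \<alpha> \<beta> T"
  obtains C where "0 < C" "\<And>f. f \<in> zygmund_space \<alpha> \<Longrightarrow> zygmund_norm \<beta> (T f) \<le> C * zygmund_norm \<alpha> f"
proof -
  obtain C where C: "\<forall>f\<in>zygmund_space \<alpha>. zygmund_norm \<beta> (T f) \<le> C * zygmund_norm \<alpha> f"
    using assms by (auto simp: bounded_operator_def)
  have "zygmund_norm \<beta> (T f) \<le> max C 1 * zygmund_norm \<alpha> f" if "f \<in> zygmund_space \<alpha>" for f
    using bspec[OF C that] mult_right_mono[OF max.cobounded1[of C 1] zygmund_norm_nonneg[of \<alpha> f]] by linarith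
  then show ?thesis
    by (intro that[of "max C 1"]) auto
qed

lemma bounded_operator_diff:
  assumes "bounded_operator \<alpha> \<beta> T" "f \<in> zygmund_space \<alpha>" "h \<in> zygmund_space \<alpha>"
  shows "T (\<lambda>z. f z - h z) = (\<lambda>z. T f z - T h z)"
  using bounded_operatorD(2)[OF assms(1,2) zygmund_scale(1)[OF assms(3), of "-1"]]
    bounded_operatorD(3)[OF assms(1,3), of "-1"] by simp

lemma bounded_operator_zero:
  assumes "bounded_operator \<alpha> \<beta> T"
  shows "T (\<lambda>z. 0) = (\<lambda>z. 0)"
  using bounded_operatorD(3)[OF assms zygmund_zero, of 0] by simp

lemma bounded_operator_add:
  assumes T: "bounded_operator \<alpha> \<beta> T" and K: "bounded_operator \<alpha> \<beta> K"
  shows "bounded_operator \<alpha> \<beta> (\<lambda>f z. T f z + K f z)"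
proof -
  obtain C D where C: "\<And>f. f \<in> zygmund_space \<alpha> \<Longrightarrow> zygmund_norm \<beta> (T f) \<le> C * zygmund_norm \<alpha> f"
    and D: "\<And>f. f \<in> zygmund_space \<alpha> \<Longrightarrow> zygmund_norm \<beta> (K f) \<le> D * zygmund_norm \<alpha> f"
    using bounded_operator_bound[OF T] bounded_operator_bound[OF K] by metis
  have "zygmund_norm \<beta> (\<lambda>z. T f z + K f z) \<le> (C + D) * zygmund_norm \<alpha> f"
    if "f \<in> zygmund_space \<alpha>" for f
    using zygmund_add(2)[OF bounded_operatorD(1)[OF T that] bounded_operatorD(1)[OF K that]]
      C[OF that] D[OF that] by (simp add: algebra_simps)
  then show ?thesis
    using zygmund_add(1)[OF bounded_operatorD(1)[OF T] bounded_operatorD(1)[OF K]]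
    by (auto simp: bounded_operator_def bounded_operatorD(2,3)[OF T] bounded_operatorD(2,3)[OF K]
      algebra_simps intro!: exI[of _ "C + D"])
qed

lemma operator_norm_le_imp:
  assumes T: "bounded_operator \<alpha> \<beta> T" and e: "0 \<le> e" "operator_norm \<alpha> \<beta> T \<le> ennreal e"
    and f: "f \<in> zygmund_space \<alpha>" "zygmund_norm \<alpha> f \<le> M" "0 < M"
  shows "zygmund_norm \<beta> (T f) \<le> e * M"
proof -
  let ?f = "\<lambda>z. of_real (inverse M) * f z"
  have "?f \<in> zygmund_space \<alpha>" "zygmund_norm \<alpha> ?f \<le> 1"
    using zygmund_scale[OF f(1), of "of_real (inverse M)"] f
    by (simp_all add: inverse_eq_divide norm_divide divide_le_eq)
  then have "ennreal (zygmund_norm \<beta> (T ?f)) \<le> operator_norm \<alpha> \<beta> T"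
    unfolding operator_norm_def by (intro SUP_upper) auto
  then have "zygmund_norm \<beta> (T ?f) \<le> e"
    using e ennreal_le_iff order_trans by blast
  then have "inverse M * zygmund_norm \<beta> (T f) \<le> e"
    using bounded_operatorD(3)[OF T f(1), of "of_real (inverse M)"] f(3)
      zygmund_scale(2)[OF bounded_operatorD(1)[OF T f(1)], of "of_real (inverse M)"]
    by (simp only: norm_of_real) simp
  then show ?thesis
    using f(3) by (simp add: field_simps)
qed

section \<open>The second derivative of the operator\<close>

locale bounded_comp_volterra =
  fixes \<alpha> \<beta> :: real and \<phi> g :: "complex \<Rightarrow> complex"
  assumes \<alpha>: "0 < \<alpha>" and \<beta>: "0 < \<beta>"
    and hol_\<phi>: "\<phi> holomorphic_on unit_disc" and self_map: "\<phi> ` unit_disc \<subseteq> unit_disc"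
    and hol_g: "g holomorphic_on unit_disc"
    and bounded: "bounded_operator \<alpha> \<beta> (comp_volterra \<phi> g)"
begin

abbreviation T :: oper where "T \<equiv> comp_volterra \<phi> g"
abbreviation u :: "complex \<Rightarrow> complex" where "u \<equiv> symbol1 \<phi> g"
abbreviation w :: "complex \<Rightarrow> complex" where "w \<equiv> symbol2 \<phi> g"

lemma norm_phi: "norm z < 1 \<Longrightarrow> norm (\<phi> z) < 1"
  using self_map by (force simp: image_subset_iff)

lemma phi_DERIV:
  assumes "norm z < 1"
  shows "(\<phi> has_field_derivative deriv \<phi> z) (at z)"
    "(deriv \<phi> has_field_derivative deriv (deriv \<phi>) z) (at z)"
  using hol_\<phi> assms by (auto intro!: holomorphic_derivI[of _ unit_disc] holomorphic_deriv)

lemma compose_phi_DERIV: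
  assumes "h holomorphic_on unit_disc" "norm z < 1"
  shows "((\<lambda>z. h (\<phi> z)) has_field_derivative deriv h (\<phi> z) * deriv \<phi> z) (at z)"
proof -
  have "(h has_field_derivative deriv h (\<phi> z)) (at (\<phi> z))"
    using assms norm_phi[of z] by (intro holomorphic_derivI[of _ unit_disc]) auto
  from DERIV_chain2[OF this phi_DERIV(1)[OF assms(2)]] show ?thesis .
qed

text \<open>
  The disc is convex, so \<open>f' g\<close> has a primitive \<open>P\<close> there and \<open>T f = P \<circ> \<phi> - P 0\<close>.
\<close>
lemma T_DERIV:
  assumes f: "f holomorphic_on unit_disc" and z: "norm z < 1"
  shows "(T f has_field_derivative deriv f (\<phi> z) * g (\<phi> z) * deriv \<phi> z) (at z)"
    and "((\<lambda>z. deriv f (\<phi> z) * g (\<phi> z) * deriv \<phi> z) has_field_derivative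
      u z * deriv (deriv f) (\<phi> z) + w z * deriv f (\<phi> z)) (at z)"
proof -
  have f': "deriv f holomorphic_on unit_disc"
    using f by (intro holomorphic_deriv) auto
  then have fg: "(\<lambda>\<xi>. deriv f \<xi> * g \<xi>) holomorphic_on unit_disc"
    using hol_g by (rule holomorphic_on_mult)
  obtain P where P: "\<And>x. x \<in> unit_disc \<Longrightarrow>
      (P has_field_derivative deriv f x * g x) (at x within unit_disc)"
    by (rule holomorphic_convex_primitive'[OF convex_ball open_ball fg]) (rule that, blast)
  have PD: "(P has_field_derivative deriv f x * g x) (at x)" if "norm x < 1" for x
    using P[of x] that at_within_open[OF _ open_ball, of x 0 1] by simp
  have eq: "T f z = P (\<phi> z) - P 0" if "norm z < 1" for z
  proof -
    have "path_image (linepath 0 (\<phi> z)) \<subseteq> unit_disc"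
      using norm_phi[OF that] by (simp add: closed_segment_subset)
    from contour_integral_primitive[OF P _ this]
    have "((\<lambda>\<xi>. deriv f \<xi> * g \<xi>) has_contour_integral P (\<phi> z) - P 0) (linepath 0 (\<phi> z))"
      by simp
    then show ?thesis
      using that by (simp add: comp_volterra_def contour_integral_unique)
  qed
  have "((\<lambda>z. P (\<phi> z) - P 0) has_field_derivative deriv f (\<phi> z) * g (\<phi> z) * deriv \<phi> z) (at z)"
    using DERIV_chain2[OF PD[OF norm_phi[OF z]] phi_DERIV(1)[OF z]]
    by (auto intro!: derivative_eq_intros)
  then show "(T f has_field_derivative deriv f (\<phi> z) * g (\<phi> z) * deriv \<phi> z) (at z)"
    by (rule has_field_derivative_transform_within_open[of _ _ _ unit_disc]) (use eq z in auto)
  show "((\<lambda>z. deriv f (\<phi> z) * g (\<phi> z) * deriv \<phi> z) has_field_derivative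
      u z * deriv (deriv f) (\<phi> z) + w z * deriv f (\<phi> z)) (at z)"
    using compose_phi_DERIV[OF f' z] compose_phi_DERIV[OF hol_g z] phi_DERIV(2)[OF z]
    by (auto intro!: derivative_eq_intros
      simp: symbol1_def symbol2_def algebra_simps power2_eq_square)
qed

lemma T_second_deriv_bound:
  assumes f: "f \<in> zygmund_space \<alpha>" and z: "norm z < 1"
  shows "weight \<beta> z * norm (u z * deriv (deriv f) (\<phi> z) + w z * deriv f (\<phi> z)) \<le> zygmund_norm \<beta> (T f)"
proof -
  have Tf: "T f \<in> zygmund_space \<beta>"
    using bounded_operatorD(1)[OF bounded f] .
  note D = T_DERIV[OF zygmund_holomorphic[OF f]]
  have "deriv (deriv (T f)) z = u z * deriv (deriv f) (\<phi> z) + w z * deriv f (\<phi> z)"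
    using second_deriv_eqI[OF D z] by assumption
  then show ?thesis
    using zygmund_second_deriv_le[OF Tf z] by metis
qed

text \<open>
  The two terms of the norm at the origin involve only values on a disc that contains \<open>\<phi> 0\<close>.
\<close>
lemma T_norm_le:
  assumes f: "f \<in> zygmund_space \<alpha>" and s: "norm (\<phi> 0) \<le> s" "s < 1"
    and g: "\<And>\<xi>. norm \<xi> \<le> s \<Longrightarrow> norm (g \<xi>) \<le> \<Gamma>"
    and \<epsilon>: "\<And>\<xi>. norm \<xi> \<le> s \<Longrightarrow> norm (deriv f \<xi>) \<le> \<epsilon>"
    and Q: "\<And>z. norm z < 1 \<Longrightarrow>
      weight \<beta> z * norm (u z * deriv (deriv f) (\<phi> z) + w z * deriv f (\<phi> z)) \<le> Q"
  shows "zygmund_norm \<beta> (T f) \<le> \<epsilon> * \<Gamma> * (1 + norm (deriv \<phi> 0)) + Q"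
proof -
  have s0: "0 \<le> s"
    using s(1) norm_ge_zero order_trans by blast
  have \<epsilon>0: "0 \<le> \<epsilon>" and \<Gamma>0: "0 \<le> \<Gamma>"
    using order_trans[OF norm_ge_zero \<epsilon>[of 0]] order_trans[OF norm_ge_zero g[of 0]] s0 by simp_all
  note D = T_DERIV[OF zygmund_holomorphic[OF f]]
  have fg: "norm (deriv f \<xi> * g \<xi>) \<le> \<epsilon> * \<Gamma>" if "norm \<xi> \<le> s" for \<xi>
    using \<epsilon>[OF that] g[OF that] \<epsilon>0 by (simp add: norm_mult mult_mono)
  have "norm (contour_integral (linepath 0 (\<phi> 0)) (\<lambda>\<xi>. deriv f \<xi> * g \<xi>)) \<le> \<epsilon> * \<Gamma> * norm (\<phi> 0 - 0)"
  proof (rule contour_integral_bound_linepath)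
    have "continuous_on (ball 0 1) (\<lambda>\<xi>. deriv f \<xi> * g \<xi>)"
      using zygmund_deriv_holomorphic(1)[OF f] hol_g
      by (intro continuous_on_mult holomorphic_on_imp_continuous_on)
    moreover have "closed_segment 0 (\<phi> 0) \<subseteq> ball 0 1"
      using s by (intro closed_segment_subset) auto
    ultimately show "(\<lambda>\<xi>. deriv f \<xi> * g \<xi>) contour_integrable_on linepath 0 (\<phi> 0)"
      by (intro contour_integrable_continuous_linepath) (rule continuous_on_subset)
    fix x assume "x \<in> closed_segment 0 (\<phi> 0)"
    then have "x \<in> cball 0 s"
      using closed_segment_subset[of 0 "cball 0 s" "\<phi> 0"] s s0 by auto
    then show "norm (deriv f x * g x) \<le> \<epsilon> * \<Gamma>"
      using fg by simp
  qed (use \<epsilon>0 \<Gamma>0 in simp)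
  also have "\<dots> \<le> \<epsilon> * \<Gamma> * 1"
    using s \<epsilon>0 \<Gamma>0 by (intro mult_left_mono) auto
  finally have 0: "norm (T f 0) \<le> \<epsilon> * \<Gamma>"
    by (simp add: comp_volterra_def)
  have 1: "norm (deriv f (\<phi> 0) * g (\<phi> 0) * deriv \<phi> 0) \<le> \<epsilon> * \<Gamma> * norm (deriv \<phi> 0)"
    using fg[OF s(1)] by (simp only: norm_mult mult_right_mono norm_ge_zero)
  have "zygmund_norm \<beta> (T f) \<le> norm (T f 0) + norm (deriv f (\<phi> 0) * g (\<phi> 0) * deriv \<phi> 0) + Q"
    by (rule zygmundI(2)[OF D _ Q])
       (auto simp: zygmund_outside[OF bounded_operatorD(1)[OF bounded f]])
  with 0 1 show ?thesis
    by (simp add: algebra_simps)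
qed

text \<open>
  The symbols lie in the weighted space because \<^term>\<open>T\<close> is bounded: \<^term>\<open>w\<close> is the second
  derivative of the image of the identity, and the image of \<open>z\<^sup>2\<close> then gives \<^term>\<open>u\<close>.
\<close>
lemma symbols_bounded:
  obtains U W where "0 \<le> U" "0 \<le> W" "\<And>z. norm z < 1 \<Longrightarrow> weight \<beta> z * norm (u z) \<le> U"
    "\<And>z. norm z < 1 \<Longrightarrow> weight \<beta> z * norm (w z) \<le> W"
proof -
  define e1 where "e1 = extend_by_zero (\<lambda>z. z)"
  define e2 where "e2 = extend_by_zero (\<lambda>z. z\<^sup>2)"
  have D: "(e1 has_field_derivative 1) (at z)" "((\<lambda>z. 1) has_field_derivative 0) (at z)"
    "(e2 has_field_derivative 2 * z) (at z)" "((\<lambda>z. 2 * z) has_field_derivative 2) (at z)"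
    if "norm z < 1" for z :: complex
    unfolding e1_def e2_def using that
    by (auto intro!: extend_by_zero_DERIV derivative_eq_intros)
  have bd: "weight \<alpha> z * norm (0::complex) \<le> 0" "weight \<alpha> z * norm (2::complex) \<le> 2"
    if "norm z < 1" for z
    using weight_le_1[of \<alpha> z] \<alpha> that by auto
  have o: "e1 z = 0" "e2 z = 0" if "norm z \<ge> 1" for z
    using that by (auto simp: e1_def e2_def extend_by_zero_def)
  note I1 = zygmundI[OF D(1,2) o(1) bd(1)] and I2 = zygmundI[OF D(3,4) o(2) bd(2)]
  define W where "W = zygmund_norm \<beta> (T e1)"
  define V where "V = zygmund_norm \<beta> (T e2)"
  have W: "weight \<beta> z * norm (w z) \<le> W" if "norm z < 1" for z
    using T_second_deriv_bound[OF I1(1) that] I1(3,4) norm_phi[OF that] by (simp add: W_def)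
  have U: "weight \<beta> z * norm (u z) \<le> V + 2 * W" if z: "norm z < 1" for z
  proof -
    have V: "weight \<beta> z * norm (u z * 2 + w z * (2 * \<phi> z)) \<le> V"
      using T_second_deriv_bound[OF I2(1) z] I2(3,4) norm_phi[OF z] by (simp add: V_def)
    have "norm (2 * u z) \<le> norm (u z * 2 + w z * (2 * \<phi> z)) + norm (w z * (2 * \<phi> z))"
      by (metis add_diff_cancel_right' mult.commute norm_triangle_ineq4)
    also have "norm (w z * (2 * \<phi> z)) \<le> norm (w z) * 2"
      unfolding norm_mult[of "w z"] using norm_phi[OF z] by (intro mult_left_mono) (auto simp: norm_mult)
    finally have "2 * norm (u z) \<le> norm (u z * 2 + w z * (2 * \<phi> z)) + norm (w z) * 2"
      by (simp add: norm_mult)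
    then have "weight \<beta> z * (2 * norm (u z)) \<le>
        weight \<beta> z * (norm (u z * 2 + w z * (2 * \<phi> z)) + norm (w z) * 2)"
      by (intro mult_left_mono) auto
    also have "\<dots> \<le> V + 2 * W"
      using V W[OF z] by (simp add: algebra_simps)
    finally show ?thesis
      using mult_nonneg_nonneg[OF weight_nonneg[of z \<beta>] norm_ge_zero[of "u z"]] by linarith
  qed
  show ?thesis
    by (rule that[OF _ _ U W]) (auto simp: V_def W_def zygmund_norm_nonneg)
qed

end

section \<open>Local estimates\<close>

lemma cauchy_estimate_disc:
  assumes h: "h holomorphic_on unit_disc" and s: "0 \<le> s" "s < 1"
    and B: "\<And>x. norm x \<le> (1 + s) / 2 \<Longrightarrow> norm (h x) \<le> B" and z: "norm z \<le> s"
  shows "norm (deriv h z) \<le> 2 / (1 - s) * B" "norm (deriv (deriv h) z) \<le> 8 / (1 - s)\<^sup>2 * B"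
proof -
  define t where "t = (1 - s) / 2"
  have t: "0 < t"
    using s by (simp add: t_def)
  have sub: "norm x \<le> (1 + s) / 2" if "x \<in> cball z t" for x
    using that z norm_triangle_ineq2[of x z] by (simp add: dist_norm norm_minus_commute t_def field_simps)
  have cb: "cball z t \<subseteq> unit_disc"
    using sub s by fastforce
  have "norm ((deriv ^^ n) h z) \<le> fact n * B / t ^ n" for n
  proof (rule Cauchy_inequality)
    show "h holomorphic_on ball z t"
      using h cb ball_subset_cball holomorphic_on_subset by blast
    show "continuous_on (cball z t) h"
      using h cb holomorphic_on_imp_continuous_on holomorphic_on_subset by blast
    show "norm (h x) \<le> B" if "norm (z - x) = t" for x
      using that sub[of x] by (intro B) (simp add: dist_norm)
  qed (rule t)
  from this[of 1] this[of 2] show "norm (deriv h z) \<le> 2 / (1 - s) * B"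
    "norm (deriv (deriv h) z) \<le> 8 / (1 - s)\<^sup>2 * B"
    by (simp_all add: t_def numeral_2_eq_2 power2_eq_square mult_ac)
qed

lemma weight_antimono:
  assumes "0 \<le> \<alpha>" "norm x \<le> norm z" "norm z < 1"
  shows "weight \<alpha> z \<le> weight \<alpha> x"
  using assms one_minus_norm_sq_pos[of z] by (intro powr_mono2) (auto intro: power_mono)

text \<open>
  These bounds make bounded sets of the space normal families, and they make the error of a
  dilation on a compact set small uniformly over the unit ball.
\<close>
lemma zygmund_local_bound:
  assumes "0 \<le> s" "s < 1" "0 \<le> \<alpha>"
  obtains C where "0 < C"
    "\<And>f z. f \<in> zygmund_space \<alpha> \<Longrightarrow> norm z \<le> s \<Longrightarrow> norm (f z) \<le> C * zygmund_norm \<alpha> f"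
    "\<And>f z. f \<in> zygmund_space \<alpha> \<Longrightarrow> norm z \<le> s \<Longrightarrow> norm (deriv f z) \<le> C * zygmund_norm \<alpha> f"
    "\<And>f z. f \<in> zygmund_space \<alpha> \<Longrightarrow> norm z \<le> s \<Longrightarrow> norm (deriv (deriv f) z) \<le> C * zygmund_norm \<alpha> f"
proof -
  define D where "D = inverse (weight \<alpha> (of_real s))"
  have D: "inverse (weight \<alpha> z) \<le> D" if "norm z \<le> s" for z
    unfolding D_def using that assms weight_antimono[of \<alpha> z "of_real s"]
    by (intro le_imp_inverse_le weight_pos) auto
  have D0: "0 \<le> D"
    by (simp add: D_def)
  have 2: "norm (deriv (deriv f) z) \<le> D * zygmund_norm \<alpha> f"
    if "f \<in> zygmund_space \<alpha>" "norm z \<le> s" for f z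
  proof -
    have w: "0 < weight \<alpha> z"
      using that assms by (intro weight_pos) auto
    have "norm (deriv (deriv f) z) \<le> inverse (weight \<alpha> z) * zygmund_norm \<alpha> f"
      using zygmund_second_deriv_le[OF that(1), of z] that w assms by (simp add: field_simps)
    also have "\<dots> \<le> D * zygmund_norm \<alpha> f"
      using D[OF that(2)] zygmund_norm_nonneg by (intro mult_right_mono)
    finally show ?thesis .
  qed
  have step: "norm (h z) \<le> norm (h 0) + B"
    if "\<And>z. norm z \<le> s \<Longrightarrow> (h has_field_derivative h' z) (at z)"
      "\<And>z. norm z \<le> s \<Longrightarrow> norm (h' z) \<le> B" "norm z \<le> s" for h h' :: "complex \<Rightarrow> complex" and B z
  proof -
    have "norm (h z - h 0) \<le> B * norm (z - 0)"
      by (rule field_differentiable_bound[of "cball 0 s" h h'])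
        (use that assms in \<open>auto intro: has_field_derivative_at_within\<close>)
    also have "\<dots> \<le> B * 1"
      using that order_trans[OF norm_ge_zero that(2)] assms by (intro mult_left_mono) auto
    finally show ?thesis
      using norm_triangle_ineq2[of "h z" "h 0"] by simp
  qed
  have 1: "norm (deriv f z) \<le> (1 + D) * zygmund_norm \<alpha> f"
    if "f \<in> zygmund_space \<alpha>" "norm z \<le> s" for f z
    using step[of "deriv f" "deriv (deriv f)" "D * zygmund_norm \<alpha> f" z] that
      zygmund_DERIV(2)[OF that(1)] 2[OF that(1)] zygmund_norm_at_0(2)[OF that(1)] assms
    by (fastforce simp: algebra_simps)
  have 0: "norm (f z) \<le> (2 + D) * zygmund_norm \<alpha> f"
    if "f \<in> zygmund_space \<alpha>" "norm z \<le> s" for f z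
    using step[of f "deriv f" "(1 + D) * zygmund_norm \<alpha> f" z] that
      zygmund_DERIV(1)[OF that(1)] 1[OF that(1)] zygmund_norm_at_0(1)[OF that(1)] assms
    by (fastforce simp: algebra_simps)
  have le: "a * zygmund_norm \<alpha> f \<le> (2 + D) * zygmund_norm \<alpha> f" if "a \<le> 2 + D" for a f
    using that zygmund_norm_nonneg by (intro mult_right_mono)
  show ?thesis
    by (rule that[of "2 + D"])
      (use D0 0 order_trans[OF 1 le] order_trans[OF 2 le] in auto)
qed

section \<open>Dilations\<close>

definition dilation :: "real \<Rightarrow> oper"
  where "dilation r h = extend_by_zero (\<lambda>z. h (of_real r * z))"

lemma norm_dilated: "0 < r \<Longrightarrow> r < 1 \<Longrightarrow> norm z \<le> 1 \<Longrightarrow> norm (of_real r * z :: complex) \<le> r"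
  by (simp add: norm_mult)

lemma norm_dilated_le: "0 < r \<Longrightarrow> r < 1 \<Longrightarrow> norm (of_real r * z :: complex) \<le> norm z"
  by (simp add: norm_mult mult_left_le_one_le)

lemma dilation_DERIV:
  assumes h: "h holomorphic_on unit_disc" and r: "0 < r" "r < 1" and z: "norm z < 1"
  shows "(dilation r h has_field_derivative of_real r * deriv h (of_real r * z)) (at z)"
    "((\<lambda>z. of_real r * deriv h (of_real r * z)) has_field_derivative
      (of_real r)\<^sup>2 * deriv (deriv h) (of_real r * z)) (at z)"
proof -
  have "of_real r * z \<in> unit_disc"
    using norm_dilated[OF r, of z] z r by simp
  then have D: "(h has_field_derivative deriv h (of_real r * z)) (at (of_real r * z))"
    "(deriv h has_field_derivative deriv (deriv h) (of_real r * z)) (at (of_real r * z))"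
    using h by (auto intro!: holomorphic_derivI[of _ unit_disc] holomorphic_deriv)
  have l: "((*) (of_real r) has_field_derivative (of_real r)) (at z)"
    by (auto intro!: derivative_eq_intros)
  show "(dilation r h has_field_derivative of_real r * deriv h (of_real r * z)) (at z)"
    unfolding dilation_def using DERIV_chain2[OF D(1) l]
    by (intro extend_by_zero_DERIV[OF z]) (simp add: mult.commute)
  show "((\<lambda>z. of_real r * deriv h (of_real r * z)) has_field_derivative
      (of_real r)\<^sup>2 * deriv (deriv h) (of_real r * z)) (at z)"
    using DERIV_cmult[OF DERIV_chain2[OF D(2) l], of "of_real r"]
    by (simp add: power2_eq_square mult_ac)
qed

lemma dilation_outside: "norm z \<ge> 1 \<Longrightarrow> dilation r h z = 0"
  by (simp add: dilation_def extend_by_zero_def)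

text \<open>
  A dilated function depends only on values in a compact subdisc, where Cauchy's estimates control
  two derivatives by the function itself.
\<close>
lemma dilation_smoothing:
  assumes h: "h holomorphic_on unit_disc" and r: "0 < r" "r < 1" and \<alpha>: "0 \<le> \<alpha>"
    and B: "\<And>x. norm x \<le> (1 + r) / 2 \<Longrightarrow> norm (h x) \<le> B"
  shows "dilation r h \<in> zygmund_space \<alpha>"
    "zygmund_norm \<alpha> (dilation r h) \<le> (1 + 2 / (1 - r) + 8 / (1 - r)\<^sup>2) * B"
proof -
  have B0: "0 \<le> B"
    using order_trans[OF norm_ge_zero B[of 0]] r by simp
  note c = cauchy_estimate_disc[OF h less_imp_le[OF r(1)] r(2) B]
  have bd: "weight \<alpha> z * norm ((of_real r)\<^sup>2 * deriv (deriv h) (of_real r * z)) \<le> 8 / (1 - r)\<^sup>2 * B"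
    if z: "norm z < 1" for z
  proof -
    have "weight \<alpha> z * norm ((of_real r)\<^sup>2 * deriv (deriv h) (of_real r * z))
        \<le> 1 * (1 * norm (deriv (deriv h) (of_real r * z)))"
      unfolding norm_mult using weight_le_1[OF \<alpha> z] r
      by (intro mult_mono) (auto simp: norm_power power_le_one)
    also have "\<dots> \<le> 8 / (1 - r)\<^sup>2 * B"
      using c(2)[of "of_real r * z"] norm_dilated[OF r, of z] z by simp
    finally show ?thesis .
  qed
  note I = zygmundI[OF dilation_DERIV[OF h r] dilation_outside bd]
  show "dilation r h \<in> zygmund_space \<alpha>"
    by (rule I(1))
  have "norm (dilation r h 0) \<le> B"
    using B[of 0] r by (simp add: dilation_def extend_by_zero_def)
  moreover have "norm (of_real r * deriv h (of_real r * 0)) \<le> 1 * (2 / (1 - r) * B)"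
    unfolding norm_mult using c(1)[of 0] r by (intro mult_mono) auto
  ultimately show "zygmund_norm \<alpha> (dilation r h) \<le> (1 + 2 / (1 - r) + 8 / (1 - r)\<^sup>2) * B"
    using I(2) by (simp add: algebra_simps)
qed

lemma dilation_holomorphic_in_zygmund:
  assumes h: "h holomorphic_on unit_disc" and r: "0 < r" "r < 1" and \<alpha>: "0 \<le> \<alpha>"
  shows "dilation r h \<in> zygmund_space \<alpha>"
proof -
  have "compact (h ` cball 0 ((1 + r) / 2))"
    using r by (intro compact_continuous_image holomorphic_on_imp_continuous_on
      holomorphic_on_subset[OF h] compact_cball) auto
  then obtain B where "\<And>x. norm x \<le> (1 + r) / 2 \<Longrightarrow> norm (h x) \<le> B"
    using compact_imp_bounded[THEN bounded_iff[THEN iffD1]] by fastforce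
  then show ?thesis
    by (rule dilation_smoothing(1)[OF h r \<alpha>])
qed

lemma dilation_second_deriv_bound:
  assumes f: "f \<in> zygmund_space \<alpha>" and r: "0 < r" "r < 1" and \<alpha>: "0 \<le> \<alpha>" and z: "norm z < 1"
  shows "weight \<alpha> z * norm (deriv (deriv f) (of_real r * z)) \<le> zygmund_norm \<alpha> f"
proof -
  have rz: "norm (of_real r * z) < 1"
    using norm_dilated_le[OF r, of z] z by linarith
  have "weight \<alpha> z * norm (deriv (deriv f) (of_real r * z))
      \<le> weight \<alpha> (of_real r * z) * norm (deriv (deriv f) (of_real r * z))"
    using norm_dilated_le[OF r, of z] z \<alpha> by (intro mult_right_mono weight_antimono) auto
  also have "\<dots> \<le> zygmund_norm \<alpha> f"
    by (rule zygmund_second_deriv_le[OF f rz])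
  finally show ?thesis .
qed

lemma dilation_bounded_operator:
  assumes r: "0 < r" "r < 1" and \<alpha>: "0 \<le> \<alpha>"
  shows "bounded_operator \<alpha> \<alpha> (dilation r)"
proof -
  have t: "0 \<le> (1 + r) / 2" "(1 + r) / 2 < 1"
    using r by auto
  obtain C where C: "\<And>f z. f \<in> zygmund_space \<alpha> \<Longrightarrow> norm z \<le> (1 + r) / 2 \<Longrightarrow> norm (f z) \<le> C * zygmund_norm \<alpha> f"
    using zygmund_local_bound[OF t \<alpha>] by metis
  show ?thesis
    unfolding bounded_operator_def
  proof (intro conjI ballI allI exI)
    fix f assume f: "f \<in> zygmund_space \<alpha>"
    show "dilation r f \<in> zygmund_space \<alpha>"
      by (rule dilation_holomorphic_in_zygmund[OF zygmund_holomorphic[OF f] r \<alpha>])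
    show "zygmund_norm \<alpha> (dilation r f) \<le> (1 + 2 / (1 - r) + 8 / (1 - r)\<^sup>2) * C * zygmund_norm \<alpha> f"
      using dilation_smoothing(2)[OF zygmund_holomorphic[OF f] r \<alpha> C[OF f]] by (simp only: mult.assoc)
  qed (auto simp: dilation_def extend_by_zero_def)
qed

text \<open>
  Normal families make the dilation compact: a subsequence of a bounded sequence converges
  locally uniformly, and the dilation turns this into convergence in norm.
\<close>
lemma dilation_compact:
  assumes r: "0 < r" "r < 1" and \<alpha>: "0 \<le> \<alpha>"
    and T: "bounded_operator \<alpha> \<beta> T"
  shows "compact_operator \<alpha> \<beta> (\<lambda>f z. - T (dilation r f) z)"
  unfolding compact_operator_def
proof (intro conjI allI impI)
  let ?K = "\<lambda>f z. - T (dilation r f) z"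
  note D = dilation_bounded_operator[OF r \<alpha>]
  obtain C where C: "0 < C" "\<And>f. f \<in> zygmund_space \<alpha> \<Longrightarrow> zygmund_norm \<beta> (T f) \<le> C * zygmund_norm \<alpha> f"
    using bounded_operator_bound[OF T] by blast
  obtain C' where C': "0 < C'" "\<And>f. f \<in> zygmund_space \<alpha> \<Longrightarrow> zygmund_norm \<alpha> (dilation r f) \<le> C' * zygmund_norm \<alpha> f"
    using bounded_operator_bound[OF D] by blast
  have neg: "(\<lambda>z. - f z) \<in> zygmund_space \<beta>" "zygmund_norm \<beta> (\<lambda>z. - f z) = zygmund_norm \<beta> f"
    if "f \<in> zygmund_space \<beta>" for f
    using zygmund_scale[OF that, of "-1"] by simp_all
  show "bounded_operator \<alpha> \<beta> ?K"
    unfolding bounded_operator_def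
  proof (intro conjI ballI allI exI[of _ "C * C'"])
    fix f assume f: "f \<in> zygmund_space \<alpha>"
    note Df = bounded_operatorD(1)[OF D f]
    show "?K f \<in> zygmund_space \<beta>"
      using neg(1)[OF bounded_operatorD(1)[OF T Df]] .
    show "?K (\<lambda>z. c * f z) = (\<lambda>z. c * ?K f z)" for c
      by (simp add: bounded_operatorD(3)[OF D f] bounded_operatorD(3)[OF T Df])
    show "?K (\<lambda>z. f z + h z) = (\<lambda>z. ?K f z + ?K h z)" if "h \<in> zygmund_space \<alpha>" for h
      by (simp add: bounded_operatorD(2)[OF D f that]
          bounded_operatorD(2)[OF T Df bounded_operatorD(1)[OF D that]])
    have "zygmund_norm \<beta> (T (dilation r f)) \<le> C * (C' * zygmund_norm \<alpha> f)"
      using C(2)[OF Df] C'(2)[OF f] C(1) by (meson mult_left_mono less_imp_le order_trans)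
    then show "zygmund_norm \<beta> (?K f) \<le> C * C' * zygmund_norm \<alpha> f"
      using neg(2)[OF bounded_operatorD(1)[OF T Df]] by simp
  qed
  fix f :: "nat \<Rightarrow> complex \<Rightarrow> complex"
  assume "(\<forall>n. f n \<in> zygmund_space \<alpha>) \<and> (\<exists>M. \<forall>n. zygmund_norm \<alpha> (f n) \<le> M)"
  then obtain M where f: "\<And>n. f n \<in> zygmund_space \<alpha>" and M: "\<And>n. zygmund_norm \<alpha> (f n) \<le> M"
    by blast
  obtain h k where h: "h holomorphic_on unit_disc" and k: "strict_mono (k :: nat \<Rightarrow> nat)"
    and lim: "\<And>S. compact S \<Longrightarrow> S \<subseteq> unit_disc \<Longrightarrow> uniform_limit S (f \<circ> k) h sequentially"
  proof (rule Montel[of unit_disc "range f" f])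
    show "p holomorphic_on unit_disc" if "p \<in> range f" for p
      using that zygmund_holomorphic[OF f] by auto
    show "\<exists>B. \<forall>p\<in>range f. \<forall>z\<in>S. norm (p z) \<le> B" if S: "compact S" "S \<subseteq> unit_disc" for S
    proof -
      have "\<exists>s\<ge>0. s < 1 \<and> (\<forall>z\<in>S. norm z \<le> s)"
      proof (cases "S = {}")
        case True
        then show ?thesis by (auto intro: exI[of _ 0])
      next
        case False
        then obtain x where "x \<in> S" "\<forall>z\<in>S. norm z \<le> norm x"
          using continuous_attains_sup[OF S(1) False continuous_on_norm_id] by auto
        then show ?thesis
          using S(2) by (intro exI[of _ "norm x"]) auto
      qed
      then obtain s where s: "0 \<le> s" "s < 1" "\<And>z. z \<in> S \<Longrightarrow> norm z \<le> s"
        by blast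
      obtain B where B: "0 < B" "\<And>f z. f \<in> zygmund_space \<alpha> \<Longrightarrow> norm z \<le> s \<Longrightarrow> norm (f z) \<le> B * zygmund_norm \<alpha> f"
        using zygmund_local_bound[OF s(1,2) \<alpha>] by metis
      have "norm (f n z) \<le> B * M" if "z \<in> S" for n z
        using B(2)[OF f s(3)[OF that]] M[of n] B(1) by (meson mult_left_mono less_imp_le order_trans)
      then show ?thesis by blast
    qed
  qed auto
  have Dh: "dilation r h \<in> zygmund_space \<alpha>"
    by (rule dilation_holomorphic_in_zygmund[OF h r \<alpha>])
  show "\<exists>k. \<exists>h\<in>zygmund_space \<beta>. strict_mono (k :: nat \<Rightarrow> nat) \<and>
      (\<lambda>n. zygmund_norm \<beta> (\<lambda>z. ?K (f (k n)) z - h z)) \<longlonglongrightarrow> 0"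
  proof (intro exI[of _ k] bexI[of _ "\<lambda>z. - T (dilation r h) z"] conjI k)
    show "(\<lambda>z. - T (dilation r h) z) \<in> zygmund_space \<beta>"
      using neg(1)[OF bounded_operatorD(1)[OF T Dh]] .
    define A where "A = 1 + 2 / (1 - r) + 8 / (1 - r)\<^sup>2"
    have A: "0 < A"
      using r by (simp add: A_def add_pos_nonneg)
    have "uniform_limit (cball 0 ((1 + r) / 2)) (f \<circ> k) h sequentially"
      using r by (intro lim) auto
    note ul = uniform_limitD[OF this]
    show "(\<lambda>n. zygmund_norm \<beta> (\<lambda>z. ?K (f (k n)) z - - T (dilation r h) z)) \<longlonglongrightarrow> 0"
    proof (rule LIMSEQ_I)
      fix \<epsilon> :: real assume \<epsilon>: "0 < \<epsilon>"
      define \<delta> where "\<delta> = \<epsilon> / (2 * C * A)"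
      have \<delta>: "0 < \<delta>"
        using \<epsilon> C A by (simp add: \<delta>_def)
      obtain N where N: "\<And>n x. n \<ge> N \<Longrightarrow> norm x \<le> (1 + r) / 2 \<Longrightarrow> dist (f (k n) x) (h x) < \<delta>"
        using ul[OF \<delta>] by (force simp: eventually_sequentially)
      have "zygmund_norm \<beta> (\<lambda>z. ?K (f (k n)) z - - T (dilation r h) z) < \<epsilon>" if "n \<ge> N" for n
      proof -
        let ?q = "\<lambda>z. h z - f (k n) z"
        have q: "norm (?q x) \<le> \<delta>" if "norm x \<le> (1 + r) / 2" for x
          using N[OF \<open>n \<ge> N\<close> that] by (simp add: dist_norm norm_minus_commute)
        have "?q holomorphic_on unit_disc"
          using h zygmund_holomorphic[OF f] by (intro holomorphic_intros)
        note sm = dilation_smoothing[OF this r \<alpha> q]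
        have eq: "dilation r ?q = (\<lambda>z. dilation r h z - dilation r (f (k n)) z)"
          by (auto simp: dilation_def extend_by_zero_def)
        have "(\<lambda>z. ?K (f (k n)) z - - T (dilation r h) z) = T (dilation r ?q)"
          unfolding eq by (subst bounded_operator_diff[OF T Dh bounded_operatorD(1)[OF D f]]) simp
        then have "zygmund_norm \<beta> (\<lambda>z. ?K (f (k n)) z - - T (dilation r h) z)
            \<le> C * zygmund_norm \<alpha> (dilation r ?q)"
          using C(2)[OF sm(1)] by simp
        also have "\<dots> \<le> C * (A * \<delta>)"
          using sm(2) C(1) by (intro mult_left_mono) (auto simp: A_def)
        also have "\<dots> < \<epsilon>"
          using C A \<epsilon> by (simp add: \<delta>_def)
        finally show ?thesis .
      qed
      then show "\<exists>N. \<forall>n\<ge>N. norm (zygmund_norm \<beta> (\<lambda>z. ?K (f (k n)) z - - T (dilation r h) z) - 0) < \<epsilon>"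
        by (auto simp: zygmund_norm_nonneg)
    qed
  qed
qed

lemma norm_lt_1_powr_minus:
  assumes "0 \<le> \<alpha>" "norm z < 1"
  shows "(1 - norm z) powr \<alpha> \<le> weight \<alpha> z"
  using assms power_le_one[of "norm z" 1] mult_left_le[of "norm z" "norm z"]
  by (intro powr_mono2) (auto simp: power2_eq_square)

text \<open>
  What remains after subtracting a dilation: functions whose first two derivatives are small on a
  large disc, while the second has the growth permitted by the norm everywhere.
\<close>
definition residual :: "real \<Rightarrow> real \<Rightarrow> real \<Rightarrow> (complex \<Rightarrow> complex) set"
  where "residual \<alpha> s \<epsilon> = {G \<in> zygmund_space \<alpha>.
    (\<forall>\<xi>. norm \<xi> \<le> s \<longrightarrow> norm (deriv G \<xi>) \<le> \<epsilon> \<and> norm (deriv (deriv G) \<xi>) \<le> \<epsilon>) \<and>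
    (\<forall>\<xi>. norm \<xi> < 1 \<longrightarrow> norm (deriv (deriv G) \<xi>) \<le> 2 * (1 - norm \<xi>) powr (- \<alpha>))}"

lemma dilation_residual:
  assumes \<alpha>: "0 \<le> \<alpha>" and s: "0 \<le> s" "s < 1" and \<epsilon>: "0 < \<epsilon>"
  obtains r where "0 < r" "r < 1"
    "\<And>f. f \<in> zygmund_space \<alpha> \<Longrightarrow> zygmund_norm \<alpha> f \<le> 1 \<Longrightarrow> (\<lambda>z. f z - dilation r f z) \<in> residual \<alpha> s \<epsilon>"
proof -
  define t where "t = (1 + s) / 2"
  have t: "0 \<le> t" "t < 1" "s \<le> t"
    using s by (auto simp: t_def)
  obtain C where C: "0 < C"
    "\<And>f z. f \<in> zygmund_space \<alpha> \<Longrightarrow> norm z \<le> t \<Longrightarrow> norm (deriv f z) \<le> C * zygmund_norm \<alpha> f"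
    "\<And>f z. f \<in> zygmund_space \<alpha> \<Longrightarrow> norm z \<le> t \<Longrightarrow> norm (deriv (deriv f) z) \<le> C * zygmund_norm \<alpha> f"
    using zygmund_local_bound[OF t(1,2) \<alpha>] by metis
  define L where "L = 2 / (1 - s) * C"
  have L: "0 < L"
    using s C by (simp add: L_def)
  define r where "r = max (1/2) (1 - \<epsilon> / (2 * C + L))"
  have r: "0 < r" "r < 1" "(1 - r) * (2 * C + L) \<le> \<epsilon>"
  proof -
    have "1 - r \<le> \<epsilon> / (2 * C + L)"
      by (auto simp: r_def)
    then show "(1 - r) * (2 * C + L) \<le> \<epsilon>"
      using C L by (simp add: field_simps)
  qed (use C L \<epsilon> in \<open>auto simp: r_def\<close>)
  show ?thesis
  proof (rule that[OF r(1,2)])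
    fix f assume f: "f \<in> zygmund_space \<alpha>" "zygmund_norm \<alpha> f \<le> 1"
    let ?G = "\<lambda>z. f z - dilation r f z"
    note Df = bounded_operatorD(1)[OF dilation_bounded_operator[OF r(1,2) \<alpha>] f(1)]
    have C1: "norm (deriv f z) \<le> C" "norm (deriv (deriv f) z) \<le> C" if "norm z \<le> t" for z
      using C(2,3)[OF f(1) that] f(2) C(1) mult_left_mono[of "zygmund_norm \<alpha> f" 1 C] by linarith+
    have C3: "norm (deriv (deriv (deriv f)) z) \<le> L" if "norm z \<le> s" for z
      using cauchy_estimate_disc(1)[OF zygmund_deriv_holomorphic(2)[OF f(1)] s C1(2) that]
      by (simp add: t_def L_def)
    have D: "deriv (dilation r f) z = of_real r * deriv f (of_real r * z)"
       "deriv (deriv (dilation r f)) z = (of_real r)\<^sup>2 * deriv (deriv f) (of_real r * z)"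
      if "norm z < 1" for z
      by (rule DERIV_imp_deriv[OF dilation_DERIV(1)[OF zygmund_holomorphic[OF f(1)] r(1,2) that]],
          rule second_deriv_eqI[OF dilation_DERIV[OF zygmund_holomorphic[OF f(1)] r(1,2)] that])
    have G: "deriv ?G z = deriv f z - of_real r * deriv f (of_real r * z)"
      "deriv (deriv ?G) z = deriv (deriv f) z - (of_real r)\<^sup>2 * deriv (deriv f) (of_real r * z)"
      if "norm z < 1" for z
      using zygmund_lincomb(3,4)[OF f(1) Df that, of 1 "-1"] unfolding D[OF that] by simp_all
    \<comment> \<open>One estimate serves both derivatives.\<close>
    have close: "norm (h z - of_real c * h (of_real r * z)) \<le> (1 - r) * (B + 2 * C)"
      if h: "h holomorphic_on unit_disc" and z: "norm z \<le> s" and c: "0 \<le> 1 - c" "1 - c \<le> 2 * (1 - r)"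
        and hC: "\<And>z. norm z \<le> s \<Longrightarrow> norm (h z) \<le> C"
        and B: "\<And>z. norm z \<le> s \<Longrightarrow> norm (deriv h z) \<le> B" for h z c B
    proof -
      have rz: "norm (of_real r * z) \<le> s"
        using norm_dilated_le[OF r(1,2), of z] z by linarith
      have "norm (h z - h (of_real r * z)) \<le> B * norm (z - of_real r * z)"
      proof (rule field_differentiable_bound[of "cball 0 s" h "deriv h"])
        show "(h has_field_derivative deriv h x) (at x within cball 0 s)" if "x \<in> cball 0 s" for x
          using that s by (intro holomorphic_derivI[OF h open_ball]) auto
      qed (use z rz B in auto)
      also have "norm (z - of_real r * z) = (1 - r) * norm z"
      proof -
        have "z - of_real r * z = of_real (1 - r) * z"
          by (simp add: algebra_simps)
        also have "norm \<dots> = (1 - r) * norm z"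
          using r by (simp only: norm_mult norm_of_real)
        finally show ?thesis .
      qed
      also have "B * ((1 - r) * norm z) \<le> B * ((1 - r) * 1)"
        using r z s order_trans[OF norm_ge_zero B[OF z]] by (intro mult_left_mono) auto
      finally have 1: "norm (h z - h (of_real r * z)) \<le> (1 - r) * B"
        by (simp add: mult.commute)
      have "norm (of_real (1 - c) * h (of_real r * z)) \<le> (2 * (1 - r)) * C"
        unfolding norm_mult norm_of_real using c hC[OF rz] C(1) r by (intro mult_mono) auto
      moreover have "h z - of_real c * h (of_real r * z) =
          (h z - h (of_real r * z)) + of_real (1 - c) * h (of_real r * z)"
        by (simp add: algebra_simps)
      ultimately show ?thesis
        using 1 norm_triangle_ineq[of "h z - h (of_real r * z)" "of_real (1 - c) * h (of_real r * z)"]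
        by (simp add: algebra_simps)
    qed
    have c2: "0 \<le> 1 - r\<^sup>2" "1 - r\<^sup>2 \<le> 2 * (1 - r)"
      using power_le_one[of r 2] zero_le_power2[of "1 - r"] r(1,2) by (auto simp: power2_diff)
    have "C \<le> L"
      using C s by (simp add: L_def field_simps)
    then have le: "(1 - r) * (C + 2 * C) \<le> (1 - r) * (L + 2 * C)"
      using r by (intro mult_left_mono) auto
    have r3: "(1 - r) * (L + 2 * C) \<le> \<epsilon>"
      using r(3) by (simp only: add.commute)
    show "?G \<in> residual \<alpha> s \<epsilon>"
      unfolding residual_def
    proof (intro CollectI conjI allI impI)
      show "?G \<in> zygmund_space \<alpha>"
        by (rule zygmund_diff(1)[OF f(1) Df])
      fix \<xi> :: complex
      {
        assume \<xi>: "norm \<xi> \<le> s"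
        then have \<xi>1: "norm \<xi> < 1"
          using s by linarith
        have "norm (deriv f \<xi> - of_real r * deriv f (of_real r * \<xi>)) \<le> (1 - r) * (C + 2 * C)"
          by (rule close[OF zygmund_deriv_holomorphic(1)[OF f(1)] \<xi>]) (use C1 t r in auto)
        then show "norm (deriv ?G \<xi>) \<le> \<epsilon>"
          unfolding G(1)[OF \<xi>1] using le r3 by linarith
        have "norm (deriv (deriv f) \<xi> - of_real (r\<^sup>2) * deriv (deriv f) (of_real r * \<xi>)) \<le> (1 - r) * (L + 2 * C)"
          by (rule close[OF zygmund_deriv_holomorphic(2)[OF f(1)] \<xi> c2]) (use C1 C3 t in auto)
        then show "norm (deriv (deriv ?G) \<xi>) \<le> \<epsilon>"
          unfolding G(2)[OF \<xi>1] of_real_power using r3 by (rule order_trans)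
      }
      assume \<xi>: "norm \<xi> < 1"
      have w: "0 < weight \<alpha> \<xi>"
        by (rule weight_pos[OF \<xi>])
      have "norm (deriv (deriv ?G) \<xi>) \<le> norm (deriv (deriv f) \<xi>) + 1 * norm (deriv (deriv f) (of_real r * \<xi>))"
        unfolding G(2)[OF \<xi>] using r
        by (intro order_trans[OF norm_triangle_ineq4] add_left_mono)
          (auto simp: norm_mult norm_power intro!: mult_left_le_one_le power_le_one)
      then have "weight \<alpha> \<xi> * norm (deriv (deriv ?G) \<xi>) \<le>
          weight \<alpha> \<xi> * (norm (deriv (deriv f) \<xi>) + norm (deriv (deriv f) (of_real r * \<xi>)))"
        by (intro mult_left_mono) auto
      also have "\<dots> \<le> 2"
        using zygmund_second_deriv_le[OF f(1) \<xi>] dilation_second_deriv_bound[OF f(1) r(1,2) \<alpha> \<xi>] f(2)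
        by (simp add: algebra_simps)
      finally have "norm (deriv (deriv ?G) \<xi>) \<le> 2 / weight \<alpha> \<xi>"
        using w by (simp add: field_simps)
      also have "\<dots> \<le> 2 / (1 - norm \<xi>) powr \<alpha>"
        using norm_lt_1_powr_minus[OF \<alpha> \<xi>] \<xi> w by (intro divide_left_mono mult_pos_pos) auto
      finally show "norm (deriv (deriv ?G) \<xi>) \<le> 2 * (1 - norm \<xi>) powr (- \<alpha>)"
        by (simp add: powr_minus field_simps)
    qed
  qed
qed

context bounded_comp_volterra
begin

text \<open>
  The bound \<open>Q\<close> is needed on the second derivatives only: for a larger radius and a smaller
  tolerance the residuals form a smaller class, and the terms of the norm at the origin become
  arbitrarily small.
\<close>
lemma essential_norm_le:
  assumes s: "0 \<le> s" "s < 1" and \<epsilon>: "0 < \<epsilon>" and Q0: "0 \<le> Q"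
    and Q: "\<And>G z. G \<in> residual \<alpha> s \<epsilon> \<Longrightarrow> norm z < 1 \<Longrightarrow>
      weight \<beta> z * norm (u z * deriv (deriv G) (\<phi> z) + w z * deriv G (\<phi> z)) \<le> Q"
  shows "essential_norm \<alpha> \<beta> T \<le> ennreal Q"
proof (rule ennreal_le_epsilon)
  fix \<delta> :: real assume \<delta>: "0 < \<delta>"
  define t where "t = max s (norm (\<phi> 0))"
  have t: "0 \<le> t" "t < 1" "s \<le> t" "norm (\<phi> 0) \<le> t"
    using s norm_phi[of 0] by (auto simp: t_def)
  have "compact (g ` cball 0 t)"
    using t by (intro compact_continuous_image holomorphic_on_imp_continuous_on
      holomorphic_on_subset[OF hol_g] compact_cball) auto
  then obtain \<Gamma>' where \<Gamma>': "\<And>x. norm x \<le> t \<Longrightarrow> norm (g x) \<le> \<Gamma>'"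
    using compact_imp_bounded[THEN bounded_iff[THEN iffD1]] by fastforce
  define \<Gamma> where "\<Gamma> = max 1 \<Gamma>'"
  have \<Gamma>: "0 < \<Gamma>" "\<And>x. norm x \<le> t \<Longrightarrow> norm (g x) \<le> \<Gamma>"
    using \<Gamma>' by (auto simp: \<Gamma>_def intro: le_max_iff_disj[THEN iffD2])
  define A where "A = \<Gamma> * (1 + norm (deriv \<phi> 0))"
  have A: "0 < A"
    using \<Gamma> by (simp add: A_def add_pos_nonneg)
  define \<eta> where "\<eta> = min \<epsilon> (\<delta> / A)"
  have \<eta>: "0 < \<eta>" "\<eta> \<le> \<epsilon>" "\<eta> * A \<le> \<delta>"
    using \<epsilon> \<delta> A by (auto simp: \<eta>_def min_def field_simps)
  obtain r where r: "0 < r" "r < 1"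
    "\<And>f. f \<in> zygmund_space \<alpha> \<Longrightarrow> zygmund_norm \<alpha> f \<le> 1 \<Longrightarrow> (\<lambda>z. f z - dilation r f z) \<in> residual \<alpha> t \<eta>"
    using dilation_residual[OF less_imp_le[OF \<alpha>] t(1,2) \<eta>(1)] by metis
  have \<alpha>0: "0 \<le> \<alpha>"
    using \<alpha> by simp
  let ?K = "\<lambda>f z. - T (dilation r f) z"
  have "essential_norm \<alpha> \<beta> T \<le> operator_norm \<alpha> \<beta> (\<lambda>f z. T f z + ?K f z)"
    unfolding essential_norm_def using dilation_compact[OF r(1,2) \<alpha>0 bounded]
    by (intro INF_lower) auto
  also have "\<dots> \<le> ennreal (Q + \<delta>)"
    unfolding operator_norm_def
  proof (intro SUP_least ennreal_leI)
    fix f assume "f \<in> {f \<in> zygmund_space \<alpha>. zygmund_norm \<alpha> f \<le> 1}"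
    then have f: "f \<in> zygmund_space \<alpha>" "zygmund_norm \<alpha> f \<le> 1"
      by auto
    let ?G = "\<lambda>z. f z - dilation r f z"
    have "(\<lambda>z. T f z + ?K f z) = T ?G"
      using bounded_operator_diff[OF bounded f(1)
        bounded_operatorD(1)[OF dilation_bounded_operator[OF r(1,2) \<alpha>0] f(1)]] by simp
    moreover have "zygmund_norm \<beta> (T ?G) \<le> \<eta> * \<Gamma> * (1 + norm (deriv \<phi> 0)) + Q"
    proof (rule T_norm_le[OF _ t(4,2) \<Gamma>(2)])
      have G: "?G \<in> residual \<alpha> t \<eta>"
        by (rule r(3)[OF f])
      then show "?G \<in> zygmund_space \<alpha>" "\<And>\<xi>. norm \<xi> \<le> t \<Longrightarrow> norm (deriv ?G \<xi>) \<le> \<eta>"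
        by (auto simp: residual_def)
      have "?G \<in> residual \<alpha> s \<epsilon>"
        using G t(3) \<eta>(2) unfolding residual_def by (blast intro: order_trans)
      then show "\<And>z. norm z < 1 \<Longrightarrow>
          weight \<beta> z * norm (u z * deriv (deriv ?G) (\<phi> z) + w z * deriv ?G (\<phi> z)) \<le> Q"
        by (rule Q)
    qed
    ultimately show "zygmund_norm \<beta> (\<lambda>z. T f z + ?K f z) \<le> Q + \<delta>"
      using \<eta>(3) by (simp add: A_def mult.assoc)
  qed
  finally show "essential_norm \<alpha> \<beta> T \<le> ennreal Q + ennreal \<delta>"
    using Q0 \<delta> by (simp add: ennreal_plus[symmetric] del: ennreal_plus)
qed

end

section \<open>Upper estimates\<close>

text \<open>
  Integrating the growth of the second derivative along a radius bounds the first derivative by a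
  primitive of the weight.
\<close>
lemma radial_growth:
  fixes P :: "real \<Rightarrow> real"
  assumes G: "G \<in> zygmund_space \<alpha>"
    and bd: "\<And>\<xi>. norm \<xi> < 1 \<Longrightarrow> norm (deriv (deriv G) \<xi>) \<le> A * (1 - norm \<xi>) powr (- \<alpha>)"
    and P: "\<And>t. t < 1 \<Longrightarrow> (P has_real_derivative (1 - t) powr (- \<alpha>)) (at t)"
    and s: "0 \<le> s" "s \<le> norm \<xi>" "norm \<xi> < 1"
  obtains \<eta> where "norm \<eta> = s" "norm (deriv G \<xi> - deriv G \<eta>) \<le> A * (P (norm \<xi>) - P s)"
proof (cases "s = norm \<xi>")
  case True
  then show ?thesis
    by (intro that[of \<xi>]) auto
next
  case False
  define \<rho> where "\<rho> = norm \<xi>"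
  define e where "e = \<xi> / of_real \<rho>"
  have \<rho>: "s < \<rho>" "\<rho> < 1" "0 < \<rho>"
    using False s by (auto simp: \<rho>_def)
  have e: "norm e = 1" "of_real \<rho> * e = \<xi>"
    using \<rho> by (auto simp: e_def norm_divide \<rho>_def)
  have ne: "norm (of_real t * e) = t" if "0 \<le> t" for t
    using that e by (simp add: norm_mult)
  let ?f = "\<lambda>t. deriv G (of_real t * e)"
  have fd: "(?f has_vector_derivative e * deriv (deriv G) (of_real t * e)) (at t)"
    if "0 \<le> t" "t < 1" for t
  proof -
    have "((\<lambda>t. of_real t * e) has_vector_derivative e) (at t)"
      by (auto intro!: derivative_eq_intros)
    from field_vector_diff_chain_at[OF this, of "deriv G" "deriv (deriv G) (of_real t * e)"]
    show ?thesis
      using zygmund_DERIV(2)[OF G, of "of_real t * e"] ne that by (simp add: o_def)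
  qed
  have Pd: "((\<lambda>t. A * P t) has_vector_derivative A * (1 - t) powr (- \<alpha>)) (at t)" if "t < 1" for t
    using P[OF that] by (auto simp: has_real_derivative_iff_has_vector_derivative[symmetric]
      intro!: derivative_eq_intros)
  have "norm (?f \<rho> - ?f s) \<le> A * P \<rho> - A * P s"
  proof (rule differentiable_bound_general[OF \<rho>(1), of ?f "\<lambda>t. A * P t"])
    show "continuous_on {s..\<rho>} ?f"
      using s \<rho> by (intro continuous_at_imp_continuous_on ballI has_vector_derivative_continuous[OF fd]) auto
    show "continuous_on {s..\<rho>} (\<lambda>t. A * P t)"
      using s \<rho> by (intro continuous_at_imp_continuous_on ballI has_vector_derivative_continuous[OF Pd]) auto
    show "(?f has_vector_derivative e * deriv (deriv G) (of_real t * e)) (at t)" if "s < t" "t < \<rho>" for t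
      using fd that s \<rho> by force
    show "((\<lambda>t. A * P t) has_vector_derivative A * (1 - t) powr (- \<alpha>)) (at t)" if "s < t" "t < \<rho>" for t
      using Pd that s \<rho> by force
    show "norm (e * deriv (deriv G) (of_real t * e)) \<le> A * (1 - t) powr (- \<alpha>)" if "s < t" "t < \<rho>" for t
      using bd[of "of_real t * e"] ne[of t] e that s \<rho> by (simp add: norm_mult)
  qed
  then show ?thesis
    using that[of "of_real s * e"] ne[of s] s(1) e(2) by (simp add: \<rho>_def algebra_simps)
qed

lemma power_primitive:
  assumes "\<alpha> \<noteq> 1" "t < 1"
  shows "((\<lambda>t. (1 - t) powr (1 - \<alpha>) / (\<alpha> - 1)) has_real_derivative (1 - t) powr (- \<alpha>)) (at t)"
proof -
  have "((\<lambda>t. 1 - t) has_real_derivative (- 1)) (at t)"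
    by (auto intro!: derivative_eq_intros)
  from DERIV_chain2[OF has_real_derivative_powr[of "1 - t" "1 - \<alpha>"] this]
  have "((\<lambda>t. (1 - t) powr (1 - \<alpha>)) has_real_derivative (1 - \<alpha>) * (1 - t) powr (- \<alpha>) * (- 1)) (at t)"
    using assms(2) by simp
  from DERIV_cdivide[OF this, of "\<alpha> - 1"] show ?thesis
  proof (rule DERIV_cong)
    show "(1 - \<alpha>) * (1 - t) powr (- \<alpha>) * (- 1) / (\<alpha> - 1) = (1 - t) powr (- \<alpha>)"
      using assms(1) by (simp add: divide_eq_eq algebra_simps)
  qed
qed

lemma log_primitive:
  assumes "t < 1"
  shows "((\<lambda>t. - ln (1 - t)) has_real_derivative (1 - t) powr (- 1)) (at t)"
  using assms by (auto intro!: derivative_eq_intros simp: powr_minus field_simps)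

text \<open>
  The exponent \<open>n = \<lfloor>1 / (1 - \<rho>)\<rfloor>\<close> is adapted to the radius \<open>\<rho>\<close>: it is as large as possible
  while \<open>\<rho>\<^sup>n\<close> stays bounded below.
\<close>
lemma adapted_exponent:
  fixes \<rho> :: real
  assumes N: "2 \<le> N" and \<rho>: "1 - 1 / real N \<le> \<rho>" "\<rho> < 1"
  obtains n where "N \<le> n" "1 / (1 - \<rho>) \<le> real (n + 1)" "1 \<le> exp 2 * \<rho> ^ n"
proof -
  define n where "n = nat \<lfloor>1 / (1 - \<rho>)\<rfloor>"
  have "real N \<le> 1 / (1 - \<rho>)"
    using N \<rho> by (simp add: field_simps)
  then have Nn: "N \<le> n" and le: "real n \<le> 1 / (1 - \<rho>)" "1 / (1 - \<rho>) \<le> real (n + 1)"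
    unfolding n_def by linarith+
  define x where "x = 1 - \<rho>"
  have x: "0 < x" "x * real n \<le> 1"
    using \<rho> le(1) by (auto simp: x_def field_simps)
  have "x * 2 \<le> x * real n"
    using x Nn N by (intro mult_left_mono) auto
  then have x2: "x \<le> 1 / 2"
    using x by linarith
  have "- 2 * x \<le> - x - 2 * x\<^sup>2"
    using x x2 mult_left_mono[of x "1/2" "2 * x"] by (simp add: power2_eq_square)
  also have "\<dots> \<le> ln (1 - x)"
    by (rule ln_one_minus_pos_lower_bound) (use x x2 in auto)
  finally have "real n * (- 2 * x) \<le> real n * ln \<rho>"
    by (intro mult_left_mono) (auto simp: x_def)
  moreover have "real n * (- 2 * x) = - 2 * (x * real n)"
    by simp
  ultimately have "- 2 \<le> real n * ln \<rho>"
    using x(2) by linarith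
  then have "exp (- 2) \<le> exp (real n * ln \<rho>)"
    by simp
  also have "\<dots> = \<rho> ^ n"
    using x x2 by (simp add: exp_of_nat_mult x_def)
  finally have "exp 2 * exp (- 2) \<le> exp 2 * \<rho> ^ n"
    by (intro mult_left_mono) auto
  then have "1 \<le> exp 2 * \<rho> ^ n"
    by (simp add: exp_minus)
  with Nn le(2) show ?thesis
    using that by blast
qed

lemma scaled_weighted_norm_le_iff:
  assumes "0 \<le> c" "0 \<le> b"
  shows "ennreal c * weighted_norm \<gamma> h \<le> ennreal b \<longleftrightarrow>
    (\<forall>z\<in>unit_disc. c * (weight \<gamma> z * norm (h z)) \<le> b)"
proof -
  have "ennreal c * weighted_norm \<gamma> h =
      (SUP z\<in>unit_disc. ennreal (c * (weight \<gamma> z * norm (h z))))"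
    unfolding weighted_norm_def using assms
    by (subst SUP_mult_left_ennreal) (simp add: ennreal_mult)
  then show ?thesis
    using assms by (simp add: SUP_le_iff)
qed

lemma eventually_on_disc_obtain:
  assumes "\<forall>\<^sub>F n in sequentially. \<forall>z\<in>unit_disc. P n z"
  obtains N where "2 \<le> N" "\<And>n z. N \<le> n \<Longrightarrow> norm z < 1 \<Longrightarrow> P n z"
proof -
  obtain N where "\<forall>n\<ge>N. \<forall>z\<in>unit_disc. P n z"
    using assms by (auto simp only: eventually_sequentially)
  then show ?thesis
    by (intro that[of "max 2 N"]) auto
qed

text \<open>The logarithmic factor \<open>ln n\<close> has a meaning from \<open>n = 1\<close> on, hence the form of the sign condition.\<close>
lemma limsup_less_imp_eventually:
  assumes c: "\<And>n. n \<ge> 1 \<Longrightarrow> 0 \<le> c n" and b: "0 \<le> b"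
    and less: "limsup (\<lambda>n. ennreal (c n) * weighted_norm \<gamma> (h n)) < ennreal b"
  shows "\<forall>\<^sub>F n in sequentially. \<forall>z\<in>unit_disc. c n * (weight \<gamma> z * norm (h n z)) \<le> b"
  using Limsup_lessD[OF less] eventually_ge_at_top[of 1]
proof eventually_elim
  case (elim n)
  then show ?case
    using scaled_weighted_norm_le_iff[OF c b, of n \<gamma> "h n"] by (simp add: less_imp_le)
qed

lemma eventually_imp_limsup_le:
  assumes c: "\<And>n. n \<ge> 1 \<Longrightarrow> 0 \<le> c n" and b: "0 \<le> b"
    and ev: "\<forall>\<^sub>F n in sequentially. \<forall>z\<in>unit_disc. c n * (weight \<gamma> z * norm (h n z)) \<le> b"
  shows "limsup (\<lambda>n. ennreal (c n) * weighted_norm \<gamma> (h n)) \<le> ennreal b"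
proof (rule Limsup_bounded)
  show "\<forall>\<^sub>F n in sequentially. ennreal (c n) * weighted_norm \<gamma> (h n) \<le> ennreal b"
    using ev eventually_ge_at_top[of 1]
    by eventually_elim (use scaled_weighted_norm_le_iff[OF c b] in blast)
qed

context bounded_comp_volterra
begin

lemma symbol_bound_from_powers:
  assumes N: "2 \<le> N" and z: "norm z < 1" "1 - 1 / real N \<le> norm (\<phi> z)"
    and B: "\<And>n. N \<le> n \<Longrightarrow> c n * (weight \<beta> z * norm (q z * \<phi> z ^ n)) \<le> B"
    and c: "\<And>n. N \<le> n \<Longrightarrow> 1 / (1 - norm (\<phi> z)) \<le> real (n + 1) \<Longrightarrow> 0 \<le> x \<and> x \<le> c n"
  shows "weight \<beta> z * (norm (q z) * x) \<le> exp 2 * B"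
proof -
  obtain n where n: "N \<le> n" "1 / (1 - norm (\<phi> z)) \<le> real (n + 1)" "1 \<le> exp 2 * norm (\<phi> z) ^ n"
    using adapted_exponent[OF N z(2) norm_phi[OF z(1)]] by blast
  note cn = c[OF n(1,2)]
  have "weight \<beta> z * norm (q z) * x \<le> weight \<beta> z * norm (q z) * c n"
    using cn by (intro mult_left_mono) auto
  also have "\<dots> * 1 \<le> weight \<beta> z * norm (q z) * c n * (exp 2 * norm (\<phi> z) ^ n)"
    using cn n(3) by (intro mult_left_mono) auto
  also have "\<dots> = exp 2 * (c n * (weight \<beta> z * norm (q z * \<phi> z ^ n)))"
    by (simp add: norm_mult norm_power mult_ac)
  also have "\<dots> \<le> exp 2 * B"
    using B[OF n(1)] by (intro mult_left_mono) auto
  finally show ?thesis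
    by (simp add: mult_ac)
qed

text \<open>
  Near the boundary the first symbol absorbs the growth of the second derivative of a residual.
\<close>
lemma first_term_bound:
  assumes N: "2 \<le> N" and z: "norm z < 1" "1 - 1 / real N \<le> norm (\<phi> z)"
    and B: "\<And>n. N \<le> n \<Longrightarrow> real (n + 1) powr \<alpha> * (weight \<beta> z * norm (u z * \<phi> z ^ n)) \<le> B"
    and G: "norm (deriv (deriv G) (\<phi> z)) \<le> 2 * (1 - norm (\<phi> z)) powr (- \<alpha>)"
  shows "weight \<beta> z * (norm (u z) * norm (deriv (deriv G) (\<phi> z))) \<le> 2 * exp 2 * B"
proof -
  have \<phi>z: "norm (\<phi> z) < 1"
    by (rule norm_phi[OF z(1)])
  have "weight \<beta> z * (norm (u z) * (1 - norm (\<phi> z)) powr (- \<alpha>)) \<le> exp 2 * B"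
  proof (rule symbol_bound_from_powers[OF N z, of "\<lambda>n. real (n + 1) powr \<alpha>" u B, OF B])
    fix n :: nat assume le: "1 / (1 - norm (\<phi> z)) \<le> real (n + 1)"
    have "(1 - norm (\<phi> z)) powr (- \<alpha>) = (1 / (1 - norm (\<phi> z))) powr \<alpha>"
      using \<phi>z by (simp add: powr_minus powr_divide field_simps)
    also have "\<dots> \<le> real (n + 1) powr \<alpha>"
      using le \<phi>z \<alpha> by (intro powr_mono2) auto
    finally show "0 \<le> (1 - norm (\<phi> z)) powr (- \<alpha>) \<and> (1 - norm (\<phi> z)) powr (- \<alpha>) \<le> real (n + 1) powr \<alpha>"
      by simp
  qed
  moreover have "weight \<beta> z * (norm (u z) * norm (deriv (deriv G) (\<phi> z)))
      \<le> weight \<beta> z * (norm (u z) * (2 * (1 - norm (\<phi> z)) powr (- \<alpha>)))"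
    using G by (intro mult_left_mono) auto
  ultimately show ?thesis
    by (simp add: algebra_simps)
qed

lemma residual_term_split:
  "weight \<beta> z * norm (u z * deriv (deriv G) (\<phi> z) + w z * deriv G (\<phi> z)) \<le>
    weight \<beta> z * (norm (u z) * norm (deriv (deriv G) (\<phi> z)))
    + weight \<beta> z * (norm (w z) * norm (deriv G (\<phi> z)))"
  using mult_left_mono[OF norm_triangle_ineq weight_nonneg[of z \<beta>],
      of "u z * deriv (deriv G) (\<phi> z)" "w z * deriv G (\<phi> z)"]
  by (simp only: norm_mult distrib_left)

lemma weighted_mult_le:
  assumes "weight \<beta> z * norm (q z) \<le> A" "x \<le> y" "0 \<le> x"
  shows "weight \<beta> z * (norm (q z) * x) \<le> A * y"
  using mult_mono[OF assms(1,2)] assms order_trans[OF _ assms(1), of 0] by (simp add: mult.assoc)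

text \<open>
  Here \<open>P\<close> is a primitive of the weight, so \<open>P \<rho> - P 0\<close> is the growth of the first derivative of a
  residual, and \<open>\<kappa> n\<close> is this growth at the radius to which the exponent \<open>n\<close> is adapted. A positive
  lower bound for \<open>\<kappa>\<close> absorbs the value of the derivative at the origin.
\<close>
lemma essential_norm_le_from_powers_ge_1:
  fixes P :: "real \<Rightarrow> real" and \<kappa> :: "nat \<Rightarrow> real"
  assumes P: "\<And>t. t < 1 \<Longrightarrow> (P has_real_derivative (1 - t) powr (- \<alpha>)) (at t)"
    and \<kappa>0: "0 < \<kappa>\<^sub>0" "\<And>n. 2 \<le> n \<Longrightarrow> \<kappa>\<^sub>0 \<le> \<kappa> n" and c: "0 \<le> c"
    and P\<kappa>: "\<And>n \<rho>. 2 \<le> n \<Longrightarrow> 0 \<le> \<rho> \<Longrightarrow> \<rho> < 1 \<Longrightarrow> 1 / (1 - \<rho>) \<le> real (n + 1) \<Longrightarrow> P \<rho> - P 0 \<le> c * \<kappa> n"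
    and b: "0 < b"
    and evu: "\<forall>\<^sub>F n in sequentially. \<forall>z\<in>unit_disc.
      real (n + 1) powr \<alpha> * (weight \<beta> z * norm (u z * \<phi> z ^ n)) \<le> b"
    and evw: "\<forall>\<^sub>F n in sequentially. \<forall>z\<in>unit_disc.
      \<kappa> n * (weight \<beta> z * norm (w z * \<phi> z ^ n)) \<le> b"
  shows "essential_norm \<alpha> \<beta> T \<le> ennreal ((3 + 2 * c) * exp 2 * b)"
proof -
  obtain N1 where N1: "2 \<le> N1" "\<And>n z. N1 \<le> n \<Longrightarrow> norm z < 1 \<Longrightarrow>
      real (n + 1) powr \<alpha> * (weight \<beta> z * norm (u z * \<phi> z ^ n)) \<le> b"
    using eventually_on_disc_obtain[OF evu] by blast
  obtain N2 where N2: "2 \<le> N2" "\<And>n z. N2 \<le> n \<Longrightarrow> norm z < 1 \<Longrightarrow>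
      \<kappa> n * (weight \<beta> z * norm (w z * \<phi> z ^ n)) \<le> b"
    using eventually_on_disc_obtain[OF evw] by blast
  define N where "N = max N1 N2"
  have N: "2 \<le> N" and bu: "\<And>n z. n \<ge> N \<Longrightarrow> norm z < 1 \<Longrightarrow>
      real (n + 1) powr \<alpha> * (weight \<beta> z * norm (u z * \<phi> z ^ n)) \<le> b"
    and bw: "\<And>n z. n \<ge> N \<Longrightarrow> norm z < 1 \<Longrightarrow> \<kappa> n * (weight \<beta> z * norm (w z * \<phi> z ^ n)) \<le> b"
    unfolding N_def using N1(1) by (simp, intro N1(2), simp_all only: max.bounded_iff)
      (intro N2(2), simp_all only: max.bounded_iff)
  obtain U W where UW: "0 \<le> U" "0 \<le> W" "\<And>z. norm z < 1 \<Longrightarrow> weight \<beta> z * norm (u z) \<le> U"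
    "\<And>z. norm z < 1 \<Longrightarrow> weight \<beta> z * norm (w z) \<le> W"
    using symbols_bounded by metis
  define s where "s = 1 - 1 / real N"
  have s: "0 \<le> s" "s < 1"
    using N by (auto simp: s_def)
  define \<epsilon> where "\<epsilon> = min \<kappa>\<^sub>0 (b / (U + W + 1))"
  have "\<epsilon> \<le> b / (U + W + 1)"
    by (simp add: \<epsilon>_def)
  then have "\<epsilon> * (U + W + 1) \<le> b"
    using UW by (simp add: pos_le_divide_eq)
  moreover have "0 < \<epsilon>" "\<epsilon> \<le> \<kappa>\<^sub>0"
    using \<kappa>0 b UW by (simp_all add: \<epsilon>_def)
  ultimately have \<epsilon>: "0 < \<epsilon>" "\<epsilon> \<le> \<kappa>\<^sub>0" "U * \<epsilon> + W * \<epsilon> + \<epsilon> \<le> b"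
    by (simp_all add: algebra_simps)
  show ?thesis
  proof (rule essential_norm_le[OF s \<epsilon>(1)])
    fix G and z :: complex assume G: "G \<in> residual \<alpha> s \<epsilon>" and z: "norm z < 1"
    have \<phi>z: "norm (\<phi> z) < 1"
      by (rule norm_phi[OF z])
    have GZ: "G \<in> zygmund_space \<alpha>"
      and small: "\<And>\<xi>. norm \<xi> \<le> s \<Longrightarrow> norm (deriv G \<xi>) \<le> \<epsilon> \<and> norm (deriv (deriv G) \<xi>) \<le> \<epsilon>"
      and growth: "\<And>\<xi>. norm \<xi> < 1 \<Longrightarrow> norm (deriv (deriv G) \<xi>) \<le> 2 * (1 - norm \<xi>) powr (- \<alpha>)"
      using G by (auto simp: residual_def)
    have e2: "1 \<le> exp (2::real)"
      by simp
    show "weight \<beta> z * norm (u z * deriv (deriv G) (\<phi> z) + w z * deriv G (\<phi> z)) \<le> (3 + 2 * c) * exp 2 * b"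
    proof (cases "norm (\<phi> z) \<le> s")
      case True
      have "weight \<beta> z * norm (u z * deriv (deriv G) (\<phi> z) + w z * deriv G (\<phi> z)) \<le> U * \<epsilon> + W * \<epsilon>"
        by (rule order_trans[OF residual_term_split])
          (intro add_mono weighted_mult_le UW(3,4)[OF z]; use small[OF True] in simp)
      also have "\<dots> \<le> 1 * b"
        using \<epsilon> by simp
      also have "\<dots> \<le> (3 + 2 * c) * exp 2 * b"
        using b c e2 mult_mono[of 1 "3 + 2 * c" 1 "exp 2"] by (intro mult_right_mono) auto
      finally show ?thesis .
    next
      case False
      then have far: "1 - 1 / real N \<le> norm (\<phi> z)"
        by (simp add: s_def)
      have 1: "weight \<beta> z * (norm (u z) * norm (deriv (deriv G) (\<phi> z))) \<le> 2 * exp 2 * b"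
        by (rule first_term_bound[OF N z far bu[OF _ z] growth[OF \<phi>z]])
      obtain \<eta> where \<eta>: "norm \<eta> = 0" "norm (deriv G (\<phi> z) - deriv G \<eta>) \<le> 2 * (P (norm (\<phi> z)) - P 0)"
        using radial_growth[OF GZ growth P order_refl norm_ge_zero \<phi>z] by blast
      then have G1: "norm (deriv G (\<phi> z)) \<le> \<epsilon> + 2 * (P (norm (\<phi> z)) - P 0)"
        using small[of 0] s norm_triangle_ineq2[of "deriv G (\<phi> z)" "deriv G 0"] by auto
      have "weight \<beta> z * (norm (w z) * (norm (deriv G (\<phi> z)) / (1 + 2 * c))) \<le> exp 2 * b"
      proof (rule symbol_bound_from_powers[OF N z far, of \<kappa> w b, OF bw[OF _ z]])
        fix n assume n: "N \<le> n" "1 / (1 - norm (\<phi> z)) \<le> real (n + 1)"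
        have "P (norm (\<phi> z)) - P 0 \<le> c * \<kappa> n" "\<kappa>\<^sub>0 \<le> \<kappa> n"
          using P\<kappa>[OF _ norm_ge_zero \<phi>z n(2)] \<kappa>0(2)[of n] N n(1) by auto
        then have "norm (deriv G (\<phi> z)) \<le> (1 + 2 * c) * \<kappa> n"
          using G1 \<epsilon>(2) by (simp add: algebra_simps)
        then show "0 \<le> norm (deriv G (\<phi> z)) / (1 + 2 * c) \<and> norm (deriv G (\<phi> z)) / (1 + 2 * c) \<le> \<kappa> n"
          using c by (simp add: pos_divide_le_eq mult.commute)
      qed
      then have "weight \<beta> z * (norm (w z) * norm (deriv G (\<phi> z))) \<le> (1 + 2 * c) * (exp 2 * b)"
        using c by (simp add: pos_divide_le_eq mult_ac)
      then show ?thesis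
        using 1 residual_term_split[of z G] by (simp add: algebra_simps)
    qed
  qed (use b c in simp)
qed

text \<open>
  For \<open>\<alpha> < 1\<close> the weight is integrable up to the boundary, so the first derivative of a
  residual is uniformly small and the second symbol contributes nothing in the limit.
\<close>
lemma essential_norm_le_from_powers_less_1:
  assumes \<alpha>1: "\<alpha> < 1" and b: "0 < b"
    and evu: "\<forall>\<^sub>F n in sequentially. \<forall>z\<in>unit_disc.
      real (n + 1) powr \<alpha> * (weight \<beta> z * norm (u z * \<phi> z ^ n)) \<le> b"
  shows "essential_norm \<alpha> \<beta> T \<le> ennreal (4 * exp 2 * b)"
proof -
  obtain N where N: "2 \<le> N" and bu: "\<And>n z. N \<le> n \<Longrightarrow> norm z < 1 \<Longrightarrow>
      real (n + 1) powr \<alpha> * (weight \<beta> z * norm (u z * \<phi> z ^ n)) \<le> b"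
    using eventually_on_disc_obtain[OF evu] by blast
  obtain U W where UW: "0 \<le> U" "0 \<le> W" "\<And>z. norm z < 1 \<Longrightarrow> weight \<beta> z * norm (u z) \<le> U"
    "\<And>z. norm z < 1 \<Longrightarrow> weight \<beta> z * norm (w z) \<le> W"
    using symbols_bounded by metis
  let ?P = "\<lambda>t::real. (1 - t) powr (1 - \<alpha>) / (\<alpha> - 1)"
  define x where "x = b * (1 - \<alpha>) / (2 * (W + 1))"
  define \<tau> where "\<tau> = min (1 / real N) (x powr (1 / (1 - \<alpha>)))"
  have x: "0 < x"
    using b \<alpha>1 UW by (simp add: x_def)
  have \<tau>: "0 < \<tau>" "\<tau> \<le> 1 / real N" "\<tau> powr (1 - \<alpha>) \<le> x"
  proof -
    show \<tau>0: "0 < \<tau>"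
      using N x by (simp add: \<tau>_def)
    have "\<tau> powr (1 - \<alpha>) \<le> (x powr (1 / (1 - \<alpha>))) powr (1 - \<alpha>)"
      using \<tau>0 \<alpha>1 by (intro powr_mono2) (auto simp: \<tau>_def)
    then show "\<tau> powr (1 - \<alpha>) \<le> x"
      using x \<alpha>1 by (simp add: powr_powr)
  qed (simp add: \<tau>_def)
  define s where "s = 1 - \<tau>"
  have "1 / real N \<le> 1"
    using N by simp
  then have s: "0 \<le> s" "s < 1" "1 - 1 / real N \<le> s"
    using \<tau> by (auto simp: s_def)
  define \<epsilon> where "\<epsilon> = b / (U + W + 1)"
  have "\<epsilon> * (U + W + 1) \<le> b"
    using UW by (simp add: \<epsilon>_def)
  moreover have "0 < \<epsilon>"
    using b UW by (simp add: \<epsilon>_def)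
  ultimately have \<epsilon>: "0 < \<epsilon>" "U * \<epsilon> + W * \<epsilon> + \<epsilon> \<le> b"
    by (simp_all add: algebra_simps)
  then have \<epsilon>W: "W * \<epsilon> \<le> b"
    using mult_nonneg_nonneg[of U \<epsilon>] UW by linarith
  show ?thesis
  proof (rule essential_norm_le[OF s(1,2) \<epsilon>(1)])
    fix G and z :: complex assume G: "G \<in> residual \<alpha> s \<epsilon>" and z: "norm z < 1"
    have \<phi>z: "norm (\<phi> z) < 1"
      by (rule norm_phi[OF z])
    have GZ: "G \<in> zygmund_space \<alpha>"
      and small: "\<And>\<xi>. norm \<xi> \<le> s \<Longrightarrow> norm (deriv G \<xi>) \<le> \<epsilon> \<and> norm (deriv (deriv G) \<xi>) \<le> \<epsilon>"
      and growth: "\<And>\<xi>. norm \<xi> < 1 \<Longrightarrow> norm (deriv (deriv G) \<xi>) \<le> 2 * (1 - norm \<xi>) powr (- \<alpha>)"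
      using G by (auto simp: residual_def)
    have eb: "b \<le> exp 2 * b"
      using b by simp
    show "weight \<beta> z * norm (u z * deriv (deriv G) (\<phi> z) + w z * deriv G (\<phi> z)) \<le> 4 * exp 2 * b"
    proof (cases "norm (\<phi> z) \<le> s")
      case True
      have "weight \<beta> z * norm (u z * deriv (deriv G) (\<phi> z) + w z * deriv G (\<phi> z)) \<le> U * \<epsilon> + W * \<epsilon>"
        by (rule order_trans[OF residual_term_split])
          (intro add_mono weighted_mult_le UW(3,4)[OF z]; use small[OF True] in simp)
      then show ?thesis
        using \<epsilon> eb b by linarith
    next
      case False
      have 1: "weight \<beta> z * (norm (u z) * norm (deriv (deriv G) (\<phi> z))) \<le> 2 * exp 2 * b"
        using False s(3) by (intro first_term_bound[OF N z _ bu[OF _ z] growth[OF \<phi>z]]) auto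
      obtain \<eta> where \<eta>: "norm \<eta> = s" "norm (deriv G (\<phi> z) - deriv G \<eta>) \<le> 2 * (?P (norm (\<phi> z)) - ?P s)"
        using radial_growth[OF GZ growth power_primitive s(1) _ \<phi>z] False \<alpha>1 by (metis less_imp_le less_irrefl not_le)
      have "?P (norm (\<phi> z)) \<le> 0"
        using \<alpha>1 by (simp add: divide_le_0_iff)
      moreover have "- ?P s = \<tau> powr (1 - \<alpha>) / (1 - \<alpha>)"
        using \<alpha>1 by (simp add: s_def field_simps)
      moreover have "\<tau> powr (1 - \<alpha>) / (1 - \<alpha>) \<le> x / (1 - \<alpha>)"
        using \<tau>(3) \<alpha>1 by (intro divide_right_mono) auto
      moreover have "norm (deriv G \<eta>) \<le> \<epsilon>"
        using small[of \<eta>] \<eta>(1) by simp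
      moreover have "x / (1 - \<alpha>) = b / (2 * (W + 1))"
        using \<alpha>1 by (simp add: x_def)
      ultimately have "norm (deriv G (\<phi> z)) \<le> \<epsilon> + 2 * (b / (2 * (W + 1)))"
        using \<eta>(2) norm_triangle_ineq2[of "deriv G (\<phi> z)" "deriv G \<eta>"]
        unfolding right_diff_distrib by linarith
      moreover have "2 * (b / (2 * (W + 1))) = b / (W + 1)"
        using UW(2) by (simp add: field_simps)
      ultimately have "norm (deriv G (\<phi> z)) \<le> \<epsilon> + b / (W + 1)"
        by metis
      then have "weight \<beta> z * (norm (w z) * norm (deriv G (\<phi> z))) \<le> W * (\<epsilon> + b / (W + 1))"
        by (intro weighted_mult_le UW(4)[OF z]) auto
      also have "\<dots> \<le> b + b"
      proof -
        have "W * (b / (W + 1)) \<le> b"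
          using b UW(2) by (simp add: pos_divide_le_eq algebra_simps)
        then show ?thesis
          using \<epsilon>W by (simp only: distrib_left add_mono)
      qed
      finally show ?thesis
        using 1 residual_term_split[of z G] eb by linarith
    qed
  qed (use b in simp)
qed

end

section \<open>Compact operators and test sequences\<close>

text \<open>
  Locally the second derivatives tend to 0, and since each of them is bounded its weighted modulus
  vanishes at the boundary. So the functions live on humps that move outwards, and a subsequence
  with almost disjoint humps has bounded partial sums.
\<close>
definition test_sequence :: "real \<Rightarrow> real \<Rightarrow> (nat \<Rightarrow> complex \<Rightarrow> complex) \<Rightarrow> bool"
  where "test_sequence \<alpha> M f \<longleftrightarrow>
    (\<forall>n. f n \<in> zygmund_space \<alpha> \<and> f n 0 = 0 \<and> deriv (f n) 0 = 0 \<and>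
      (\<forall>z. norm z < 1 \<longrightarrow> weight \<alpha> z * norm (deriv (deriv (f n)) z) \<le> M) \<and>
      (\<exists>C. \<forall>z. norm z < 1 \<longrightarrow> norm (deriv (deriv (f n)) z) \<le> C)) \<and>
    (\<forall>s \<epsilon>. 0 \<le> s \<longrightarrow> s < 1 \<longrightarrow> 0 < \<epsilon> \<longrightarrow>
      (\<forall>\<^sub>F n in sequentially. \<forall>z. norm z \<le> s \<longrightarrow> norm (deriv (deriv (f n)) z) \<le> \<epsilon>))"

lemma test_sequenceD:
  assumes "test_sequence \<alpha> M f"
  shows "f n \<in> zygmund_space \<alpha>" "f n 0 = 0" "deriv (f n) 0 = 0"
    "norm z < 1 \<Longrightarrow> weight \<alpha> z * norm (deriv (deriv (f n)) z) \<le> M"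
    "\<exists>C. \<forall>z. norm z < 1 \<longrightarrow> norm (deriv (deriv (f n)) z) \<le> C"
    "0 \<le> s \<Longrightarrow> s < 1 \<Longrightarrow> 0 < \<epsilon> \<Longrightarrow>
      \<forall>\<^sub>F n in sequentially. \<forall>z. norm z \<le> s \<longrightarrow> norm (deriv (deriv (f n)) z) \<le> \<epsilon>"
  using assms unfolding test_sequence_def by blast+

lemma test_sequence_subseq:
  assumes f: "test_sequence \<alpha> M f" and k: "strict_mono (k :: nat \<Rightarrow> nat)"
  shows "test_sequence \<alpha> M (\<lambda>n. f (k n))"
  unfolding test_sequence_def
  using test_sequenceD(1-5)[OF f] eventually_subseq[OF k test_sequenceD(6)[OF f]] by blast

lemma test_sequence_norm:
  assumes "test_sequence \<alpha> M f"
  shows "zygmund_norm \<alpha> (f n) \<le> M"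
  using zygmund_norm_le[OF test_sequenceD(1)[OF assms], of n 0 0 M] test_sequenceD[OF assms] by simp

text \<open>
  The choice of the next index: on the compact set where the partial sum \<open>S\<close> exceeds 1 the next
  term can be made as small as desired.
\<close>
lemma next_hump:
  assumes f: "test_sequence \<alpha> M f" and \<alpha>: "0 < \<alpha>" and \<epsilon>: "0 < \<epsilon>"
    and S: "\<And>z. norm z < 1 \<Longrightarrow> S z \<le> C * weight \<alpha> z"
  obtains n where "m < n"
    "\<And>z. norm z < 1 \<Longrightarrow> weight \<alpha> z * norm (deriv (deriv (f n)) z) \<le> \<epsilon> \<or> S z \<le> 1"
proof -
  define c where "c = 1 / (\<bar>C\<bar> + 1)"
  have c: "0 < c" "c \<le> 1"
    by (auto simp: c_def field_simps)
  define s where "s = sqrt (1 - c powr (1 / \<alpha>))"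
  have cp: "0 < c powr (1 / \<alpha>)" "c powr (1 / \<alpha>) \<le> 1"
    using c \<alpha> by (auto intro: powr_le1)
  have s: "0 \<le> s" "s < 1" "1 - s\<^sup>2 = c powr (1 / \<alpha>)"
    using cp by (auto simp: s_def)
  obtain N where N: "\<And>n z. n \<ge> N \<Longrightarrow> norm z \<le> s \<Longrightarrow> norm (deriv (deriv (f n)) z) \<le> \<epsilon>"
    using test_sequenceD(6)[OF f s(1,2) \<epsilon>] unfolding eventually_sequentially by blast
  show ?thesis
  proof (rule that[of "max N (Suc m)"])
    fix z :: complex assume z: "norm z < 1"
    let ?d = "norm (deriv (deriv (f (max N (Suc m)))) z)"
    show "weight \<alpha> z * ?d \<le> \<epsilon> \<or> S z \<le> 1"
    proof (cases "norm z \<le> s")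
      case True
      have "weight \<alpha> z * ?d \<le> 1 * \<epsilon>"
        using N[OF max.cobounded1 True] weight_le_1[OF less_imp_le[OF \<alpha>] z] by (intro mult_mono) auto
      then show ?thesis by simp
    next
      case False
      then have "s\<^sup>2 \<le> (norm z)\<^sup>2"
        using s(1) by (intro power_mono) auto
      then have "weight \<alpha> z \<le> (c powr (1 / \<alpha>)) powr \<alpha>"
        using s(3) one_minus_norm_sq_pos[OF z] \<alpha> by (intro powr_mono2) auto
      then have wc: "weight \<alpha> z \<le> c"
        using \<alpha> c by (simp add: powr_powr)
      have "C * weight \<alpha> z \<le> \<bar>C\<bar> * c"
        using wc by (intro mult_mono) auto
      also have "\<dots> \<le> 1"
        by (simp add: c_def field_simps)
      finally show ?thesis
        using S[OF z] by linarith
    qed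
  qed simp
qed

text \<open>
  At each point and step either the new term is at most \<open>(1/2)\<^sup>i\<close>, or the sum so far is at most 1
  and the new term at most \<open>M\<close>. Hence the bound \<open>M + 1 + 2\<close>.
\<close>
lemma sliding_hump:
  assumes f: "test_sequence \<alpha> M f" and \<alpha>: "0 < \<alpha>" and M: "0 \<le> M"
  obtains k :: "nat \<Rightarrow> nat" where "strict_mono k"
    "\<And>N z. norm z < 1 \<Longrightarrow> (\<Sum>i<N. weight \<alpha> z * norm (deriv (deriv (f (k i))) z)) \<le> M + 3"
proof -
  let ?a = "\<lambda>n z. weight \<alpha> z * norm (deriv (deriv (f n)) z)"
  \<comment> \<open>A state consists of the current index and the sum over the earlier indices.\<close>
  let ?P = "\<lambda>i (x :: nat \<times> (complex \<Rightarrow> real)).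
    (\<exists>C. \<forall>z. norm z < 1 \<longrightarrow> snd x z \<le> C * weight \<alpha> z) \<and>
    (\<forall>z. norm z < 1 \<longrightarrow> ?a (fst x) z \<le> (1/2) ^ i \<or> snd x z \<le> 1) \<and> (i = 0 \<longrightarrow> snd x = (\<lambda>z. 0))"
  let ?Q = "\<lambda>(i::nat) x y. fst x < fst y \<and> snd y = (\<lambda>z. snd x z + ?a (fst x) z)"
  have "\<exists>p. \<forall>i. ?P i (p i) \<and> ?Q i (p i) (p (Suc i))"
  proof (rule dependent_nat_choice)
    show "\<exists>x. ?P 0 x"
      by (rule exI[of _ "(0, \<lambda>z. 0)"]) (auto intro: exI[of _ 0])
    fix x :: "nat \<times> (complex \<Rightarrow> real)" and i assume x: "?P i x"
    then obtain C where C: "\<And>z. norm z < 1 \<Longrightarrow> snd x z \<le> C * weight \<alpha> z"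
      by blast
    obtain D where D: "\<And>z. norm z < 1 \<Longrightarrow> norm (deriv (deriv (f (fst x))) z) \<le> D"
      using test_sequenceD(5)[OF f] by blast
    let ?S = "\<lambda>z. snd x z + ?a (fst x) z"
    have S: "?S z \<le> (C + D) * weight \<alpha> z" if "norm z < 1" for z
      using C[OF that] mult_left_mono[OF D[OF that] weight_nonneg[of z \<alpha>]] by (simp add: algebra_simps)
    obtain n where n: "fst x < n" "\<And>z. norm z < 1 \<Longrightarrow> ?a n z \<le> (1/2) ^ Suc i \<or> ?S z \<le> 1"
      using next_hump[OF f \<alpha> _ S, of "(1/2) ^ Suc i" "fst x"] by auto
    show "\<exists>y. ?P (Suc i) y \<and> ?Q i x y"
      by (rule exI[of _ "(n, ?S)"]) (use n S in auto)
  qed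
  then obtain p where p: "\<And>i. ?P i (p i)" "\<And>i. ?Q i (p i) (p (Suc i))"
    by blast
  let ?k = "\<lambda>i. fst (p i)"
  have S: "snd (p N) z = (\<Sum>i<N. ?a (?k i) z)" for N z
    by (induction N) (use p in auto)
  have "snd (p N) z \<le> M + 1 + (\<Sum>i<N. (1/2) ^ i)" if z: "norm z < 1" for N z
  proof (induction N)
    case 0
    then show ?case using M p(1)[of 0] by simp
  next
    case (Suc N)
    have geo: "0 \<le> (\<Sum>i<Suc N. (1/2::real) ^ i)"
      by (intro sum_nonneg) auto
    have "?a (?k N) z \<le> (1/2) ^ N \<or> snd (p N) z \<le> 1" "?a (?k N) z \<le> M"
      using p(1)[of N] z test_sequenceD(4)[OF f z] by blast+
    moreover have "snd (p (Suc N)) z = snd (p N) z + ?a (?k N) z"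
      using p(2)[of N] by simp
    ultimately show ?case
      using Suc geo by auto
  qed
  moreover have "(\<Sum>i<N. (1/2::real) ^ i) \<le> 2" for N
    by (simp add: sum_gp_strict)
  ultimately have "(\<Sum>i<N. ?a (?k i) z) \<le> M + 3" if "norm z < 1" for N z
    using that S[where N=N and z=z] by (smt (verit))
  moreover have "strict_mono ?k"
    using p(2) by (auto simp: strict_mono_Suc_iff)
  ultimately show ?thesis
    using that by blast
qed

lemma zygmund_sum:
  fixes f :: "nat \<Rightarrow> complex \<Rightarrow> complex"
  assumes "\<And>i. f i \<in> zygmund_space \<gamma>"
  shows "(\<lambda>z. \<Sum>i<N. f i z) \<in> zygmund_space \<gamma> \<and>
    (\<forall>z. norm z < 1 \<longrightarrow> deriv (\<lambda>z. \<Sum>i<N. f i z) z = (\<Sum>i<N. deriv (f i) z) \<and>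
      deriv (deriv (\<lambda>z. \<Sum>i<N. f i z)) z = (\<Sum>i<N. deriv (deriv (f i)) z))"
proof (induction N)
  case 0
  have "deriv (deriv (\<lambda>z. 0)) z = (0::complex)" for z :: complex
    by simp
  then show ?case by (simp add: zygmund_zero)
next
  case (Suc N)
  note L = zygmund_lincomb[OF conjunct1[OF Suc] assms[of N], where a = 1 and b = 1, unfolded mult_1]
  show ?case
    using L(1) Suc by (auto simp: L(3,4))
qed

text \<open>
  If the images stayed away from 0, a subsequence of them would converge to some \<open>h \<noteq> 0\<close>, and the
  images of the partial sums of a sliding hump would grow like \<open>N h\<close>. They are bounded.
\<close>
lemma compact_operator_test_sequence:
  assumes K: "compact_operator \<alpha> \<beta> K" and f: "test_sequence \<alpha> M f" and \<alpha>: "0 < \<alpha>"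
  shows "(\<lambda>n. zygmund_norm \<beta> (K (f n))) \<longlonglongrightarrow> 0"
proof (rule ccontr)
  assume "\<not> ?thesis"
  then obtain \<epsilon> where \<epsilon>: "0 < \<epsilon>" "\<And>N. \<exists>n\<ge>N. \<epsilon> \<le> zygmund_norm \<beta> (K (f n))"
    unfolding LIMSEQ_iff by (auto simp: zygmund_norm_nonneg not_less)
  have "infinite {n. \<epsilon> \<le> zygmund_norm \<beta> (K (f n))}"
    using \<epsilon>(2) by (auto simp: infinite_nat_iff_unbounded_le)
  then obtain k :: "nat \<Rightarrow> nat" where k: "strict_mono k" "\<And>n. \<epsilon> \<le> zygmund_norm \<beta> (K (f (k n)))"
    using infinite_enumerate[of "{n. \<epsilon> \<le> zygmund_norm \<beta> (K (f n))}"] by auto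
  have Kb: "bounded_operator \<alpha> \<beta> K"
    using K by (simp add: compact_operator_def)
  have M: "0 \<le> M"
    using test_sequenceD(4)[OF f, of 0 0] by (smt (verit) mult_nonneg_nonneg norm_ge_zero norm_zero weight_nonneg)
  obtain r h where r: "strict_mono (r :: nat \<Rightarrow> nat)" and h: "h \<in> zygmund_space \<beta>"
    and lim: "(\<lambda>n. zygmund_norm \<beta> (\<lambda>z. K (f (k (r n))) z - h z)) \<longlonglongrightarrow> 0"
  proof -
    have "(\<forall>n. f (k n) \<in> zygmund_space \<alpha>) \<and> (\<exists>M. \<forall>n. zygmund_norm \<alpha> (f (k n)) \<le> M)"
      using test_sequenceD(1)[OF f] test_sequence_norm[OF f] by blast
    from conjunct2[OF K[unfolded compact_operator_def], THEN spec, THEN mp, OF this] that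
    show ?thesis
      by blast
  qed
  have "\<epsilon> / 4 > 0"
    using \<epsilon> by simp
  from LIMSEQ_D[OF lim this] obtain N0 where
    N0: "\<And>n. n \<ge> N0 \<Longrightarrow> zygmund_norm \<beta> (\<lambda>z. K (f (k (r n))) z - h z) \<le> \<epsilon> / 4"
    by (force simp: zygmund_norm_nonneg)
  define q where "q n = f (k (r (n + N0)))" for n
  have "strict_mono (\<lambda>n. k (r (n + N0)))"
    using k(1) r by (simp add: strict_mono_def)
  from test_sequence_subseq[OF f this] have q: "test_sequence \<alpha> M q"
    by (simp add: q_def[abs_def])
  have qh: "zygmund_norm \<beta> (\<lambda>z. K (q n) z - h z) \<le> \<epsilon> / 4" and Kq: "K (q n) \<in> zygmund_space \<beta>" for n
    using N0[of "n + N0"] bounded_operatorD(1)[OF Kb test_sequenceD(1)[OF q]] by (auto simp: q_def)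
  have "\<epsilon> \<le> zygmund_norm \<beta> (\<lambda>z. (K (q 0) z - h z) + h z)"
    using k(2)[of "r (0 + N0)"] by (simp add: q_def)
  also have "\<dots> \<le> \<epsilon> / 4 + zygmund_norm \<beta> h"
    using zygmund_add(2)[OF zygmund_diff(1)[OF Kq[of 0] h] h] qh[of 0] by linarith
  finally have hn: "3 * \<epsilon> / 4 \<le> zygmund_norm \<beta> h"
    by simp
  obtain j :: "nat \<Rightarrow> nat" where j: "strict_mono j"
    "\<And>N z. norm z < 1 \<Longrightarrow> (\<Sum>i<N. weight \<alpha> z * norm (deriv (deriv (q (j i))) z)) \<le> M + 3"
    using sliding_hump[OF q \<alpha> M] by blast
  define F where "F N = (\<lambda>z. \<Sum>i<N. q (j i) z)" for N
  have qj: "q (j i) \<in> zygmund_space \<alpha>" for i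
    by (rule test_sequenceD(1)[OF q])
  have F: "F N \<in> zygmund_space \<alpha>" for N
    using zygmund_sum[of "\<lambda>i. q (j i)", OF qj] by (simp add: F_def)
  have Fn: "zygmund_norm \<alpha> (F N) \<le> 0 + 0 + (M + 3)" for N
  proof (rule zygmund_norm_le[OF F])
    note zs = zygmund_sum[of "\<lambda>i. q (j i)", OF qj]
    show "norm (F N 0) \<le> 0" "norm (deriv (F N) 0) \<le> 0"
      using zs[of N] test_sequenceD(2,3)[OF q] by (simp_all add: F_def)
    fix z :: complex assume z: "norm z < 1"
    have "weight \<alpha> z * norm (deriv (deriv (F N)) z) \<le> weight \<alpha> z * (\<Sum>i<N. norm (deriv (deriv (q (j i))) z))"
      using zs[of N] z by (simp add: F_def norm_sum mult_left_mono)
    also have "\<dots> \<le> M + 3"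
      using j(2)[OF z] by (simp add: sum_distrib_left)
    finally show "weight \<alpha> z * norm (deriv (deriv (F N)) z) \<le> M + 3" .
  qed
  obtain C where C: "0 < C" "\<And>f. f \<in> zygmund_space \<alpha> \<Longrightarrow> zygmund_norm \<beta> (K f) \<le> C * zygmund_norm \<alpha> f"
    using bounded_operator_bound[OF Kb] by blast
  have KF: "zygmund_norm \<beta> (K (F N)) \<le> C * (M + 3)" for N
    using C(2)[OF F[of N]] mult_left_mono[OF Fn[of N] less_imp_le[OF C(1)]] by simp
  have close: "(\<lambda>z. of_nat N * h z - K (F N) z) \<in> zygmund_space \<beta> \<and>
      zygmund_norm \<beta> (\<lambda>z. of_nat N * h z - K (F N) z) \<le> real N * (\<epsilon> / 4)" for N
  proof (induction N)
    case 0
    then show ?case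
      using bounded_operator_zero[OF Kb] by (simp add: F_def zygmund_zero zygmund_norm_zero)
  next
    case (Suc N)
    have "F (Suc N) = (\<lambda>z. F N z + q (j N) z)"
      by (simp add: F_def)
    then have eq: "(\<lambda>z. of_nat (Suc N) * h z - K (F (Suc N)) z) =
        (\<lambda>z. (of_nat N * h z - K (F N) z) - (K (q (j N)) z - h z))"
      using bounded_operatorD(2)[OF Kb F qj] by (simp add: algebra_simps)
    note d = zygmund_diff[OF conjunct1[OF Suc] zygmund_diff(1)[OF Kq[of "j N"] h]]
    show ?case
      unfolding eq using d Suc qh[of "j N"] by (simp add: algebra_simps)
  qed
  have "real N * (\<epsilon> / 2) \<le> C * (M + 3)" for N
  proof -
    have "real N * zygmund_norm \<beta> h = zygmund_norm \<beta> (\<lambda>z. (of_nat N * h z - K (F N) z) + K (F N) z)"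
      using zygmund_scale(2)[OF h, of "of_nat N"] by simp
    also have "\<dots> \<le> real N * (\<epsilon> / 4) + C * (M + 3)"
      using zygmund_add(2)[OF conjunct1[OF close[of N]] bounded_operatorD(1)[OF Kb F[of N]]]
        close[of N] KF[of N] by linarith
    finally have "real N * zygmund_norm \<beta> h \<le> real N * (\<epsilon> / 4) + C * (M + 3)" .
    moreover have "real N * (3 * \<epsilon> / 4) \<le> real N * zygmund_norm \<beta> h"
      using hn by (intro mult_left_mono) auto
    moreover have "real N * (3 * \<epsilon> / 4) = real N * (\<epsilon> / 4) + real N * (\<epsilon> / 2)"
      by (simp add: field_simps)
    ultimately show ?thesis by linarith
  qed
  moreover obtain N where "C * (M + 3) < real N * (\<epsilon> / 2)"
    using reals_Archimedean3[of "\<epsilon> / 2"] \<epsilon>(1) by auto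
  ultimately show False
    by (meson not_le)
qed

text \<open>
  A compact perturbation of nearly optimal norm does not affect the sequence in the limit, so \<open>T\<close>
  itself obeys the bound there; the strict inequality leaves room for the error.
\<close>
lemma (in bounded_comp_volterra) essential_norm_test:
  assumes e: "0 < e" "essential_norm \<alpha> \<beta> T < ennreal e"
    and f: "test_sequence \<alpha> M f" and M: "0 < M"
  shows "\<forall>\<^sub>F n in sequentially. \<forall>z\<in>unit_disc.
    weight \<beta> z * norm (u z * deriv (deriv (f n)) (\<phi> z) + w z * deriv (f n) (\<phi> z)) \<le> e * M"
proof -
  obtain K where K: "compact_operator \<alpha> \<beta> K" "operator_norm \<alpha> \<beta> (\<lambda>f z. T f z + K f z) < ennreal e"
    using e(2) by (auto simp: essential_norm_def INF_less_iff)
  define d where "d = enn2real (operator_norm \<alpha> \<beta> (\<lambda>f z. T f z + K f z))"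
  have d: "0 \<le> d" "operator_norm \<alpha> \<beta> (\<lambda>f z. T f z + K f z) = ennreal d"
    using K(2) ennreal_enn2real[OF less_trans[OF K(2) ennreal_less_top]] by (simp_all add: d_def)
  then have de: "d < e"
    using K(2) by (simp add: ennreal_less_iff)
  have Kb: "bounded_operator \<alpha> \<beta> K"
    using K(1) by (simp add: compact_operator_def)
  have "0 < (e - d) * M"
    using de M by simp
  from LIMSEQ_D[OF compact_operator_test_sequence[OF K(1) f \<alpha>] this]
  obtain N where N: "\<And>n. n \<ge> N \<Longrightarrow> zygmund_norm \<beta> (K (f n)) \<le> (e - d) * M"
    by (force simp: zygmund_norm_nonneg)
  have "zygmund_norm \<beta> (T (f n)) \<le> e * M" if "n \<ge> N" for n
  proof -
    note fn = test_sequenceD(1)[OF f, of n]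
    have "zygmund_norm \<beta> (T (f n)) = zygmund_norm \<beta> (\<lambda>z. (T (f n) z + K (f n) z) - K (f n) z)"
      by simp
    also have "\<dots> \<le> zygmund_norm \<beta> (\<lambda>z. T (f n) z + K (f n) z) + zygmund_norm \<beta> (K (f n))"
      by (intro zygmund_diff(2) zygmund_add(1) bounded_operatorD(1)[OF bounded] bounded_operatorD(1)[OF Kb] fn)
    also have "\<dots> \<le> d * M + (e - d) * M"
      using operator_norm_le_imp[OF bounded_operator_add[OF bounded Kb] d(1) _ fn test_sequence_norm[OF f] M]
        d(2) N[OF that] by simp
    finally show ?thesis
      by (simp add: algebra_simps)
  qed
  then show ?thesis
    unfolding eventually_sequentially
    using T_second_deriv_bound[OF test_sequenceD(1)[OF f]] order_trans by (intro exI[of _ N]) fastforce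
qed

section \<open>Monomials and blocks of the logarithmic series\<close>

text \<open>
  With \<open>x = (n + 1) (1 - \<rho>)\<close> the left-hand side is at most a multiple of \<open>x powr \<alpha>\<close> times
  \<open>exp (- x)\<close>, which is bounded.
\<close>
lemma power_weight_bound:
  fixes \<rho> :: real
  assumes \<alpha>: "0 < \<alpha>" and \<rho>: "0 \<le> \<rho>" "\<rho> < 1"
  shows "real (n + 1) powr \<alpha> * ((1 - \<rho>\<^sup>2) powr \<alpha> * \<rho> ^ n) \<le> (2 * \<alpha>) powr \<alpha> * exp 1"
proof -
  define x where "x = real (n + 1) * (1 - \<rho>)"
  have x: "0 \<le> x"
    using \<rho> by (simp add: x_def)
  have "\<rho> \<le> exp (- (1 - \<rho>))"
    using exp_ge_add_one_self[of "- (1 - \<rho>)"] by simp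
  then have "\<rho> ^ n \<le> exp (- (1 - \<rho>)) ^ n"
    using \<rho> by (intro power_mono)
  also have "\<dots> = exp (1 - \<rho> - x)"
    by (simp add: exp_of_nat_mult[symmetric] x_def algebra_simps)
  also have "\<dots> \<le> exp (1 - x)"
    using \<rho> by simp
  finally have 1: "\<rho> ^ n \<le> exp (1 - x)" .
  have "x / \<alpha> \<le> exp (x / \<alpha>)"
    using exp_ge_add_one_self[of "x / \<alpha>"] by linarith
  then have "x \<le> \<alpha> * exp (x / \<alpha>)"
    using \<alpha> by (simp add: field_simps)
  then have "(2 * x) powr \<alpha> \<le> (2 * \<alpha> * exp (x / \<alpha>)) powr \<alpha>"
    using x \<alpha> by (intro powr_mono2) auto
  also have "\<dots> = (2 * \<alpha>) powr \<alpha> * exp x"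
    using \<alpha> by (subst powr_mult) (auto simp: exp_powr_real)
  finally have 2: "(2 * x) powr \<alpha> \<le> (2 * \<alpha>) powr \<alpha> * exp x" .
  have "\<rho>\<^sup>2 \<le> 1"
    using \<rho> by (simp add: power_le_one)
  moreover have "0 \<le> (1 - \<rho>)\<^sup>2"
    by simp
  ultimately have q: "0 \<le> 1 - \<rho>\<^sup>2" "1 - \<rho>\<^sup>2 \<le> 2 * (1 - \<rho>)"
    by (auto simp: power2_eq_square algebra_simps)
  have "real (n + 1) * (1 - \<rho>\<^sup>2) \<le> real (n + 1) * (2 * (1 - \<rho>))"
    using q by (intro mult_left_mono) auto
  then have "real (n + 1) * (1 - \<rho>\<^sup>2) \<le> 2 * x"
    by (simp only: x_def mult.left_commute)
  then have "(real (n + 1) * (1 - \<rho>\<^sup>2)) powr \<alpha> \<le> (2 * x) powr \<alpha>"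
    using q(1) \<alpha> by (intro powr_mono2) auto
  also note 2
  finally have "(real (n + 1) * (1 - \<rho>\<^sup>2)) powr \<alpha> * \<rho> ^ n \<le> (2 * \<alpha>) powr \<alpha> * exp x * exp (1 - x)"
    using 1 \<rho> by (intro mult_mono) auto
  also have "\<dots> = (2 * \<alpha>) powr \<alpha> * exp 1"
    by (simp add: exp_add[symmetric] mult.assoc)
  finally show ?thesis
    using q by (simp add: powr_mult mult.assoc)
qed

lemma powr_times_power_small:
  fixes s :: real
  assumes \<alpha>: "0 < \<alpha>" and s: "0 \<le> s" "s < 1" and \<epsilon>: "0 < \<epsilon>"
  shows "\<forall>\<^sub>F n in sequentially. real (n + 1) powr \<alpha> * s ^ n \<le> \<epsilon>"
proof -
  \<comment> \<open>The bound at the larger radius \<open>t\<close> leaves the geometric factor \<open>(s / t)\<^sup>n\<close>.\<close>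
  define t where "t = (1 + s) / 2"
  have t: "0 < t" "t < 1" "s < t"
    using s by (auto simp: t_def)
  define A where "A = (2 * \<alpha>) powr \<alpha> * exp 1 / (1 - t\<^sup>2) powr \<alpha>"
  have t2: "0 < (1 - t\<^sup>2) powr \<alpha>"
  proof -
    have "t\<^sup>2 < 1"
      using t by (simp add: abs_square_less_1)
    then show ?thesis by simp
  qed
  have A: "0 < A"
    using \<alpha> t2 by (simp add: A_def)
  have le: "real (n + 1) powr \<alpha> * s ^ n \<le> A * (s / t) ^ n" for n
  proof -
    have "real (n + 1) powr \<alpha> * t ^ n \<le> A"
      using power_weight_bound[OF \<alpha>, of t n] t t2 by (simp add: A_def field_simps)
    then have "real (n + 1) powr \<alpha> * t ^ n * (s / t) ^ n \<le> A * (s / t) ^ n"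
      using s t by (intro mult_right_mono) auto
    then show ?thesis
      using t by (simp add: power_divide)
  qed
  have "(\<lambda>n. (s / t) ^ n) \<longlonglongrightarrow> 0"
    using s t by (intro LIMSEQ_power_zero) auto
  then have "\<forall>\<^sub>F n in sequentially. (s / t) ^ n < \<epsilon> / A"
    by (rule order_tendstoD) (use A \<epsilon> in auto)
  then show ?thesis
  proof eventually_elim
    case (elim n)
    then show ?case
      using le[of n] A by (simp add: field_simps)
  qed
qed

lemma power_DERIV:
  "m = k + 1 \<Longrightarrow> ((\<lambda>z::complex. z ^ m) has_field_derivative of_nat m * z ^ k) (at z)"
  using DERIV_power_Suc[OF DERIV_ident[of "at z"], of k] by simp

definition monomial_test :: "real \<Rightarrow> nat \<Rightarrow> complex \<Rightarrow> complex"
  where "monomial_test \<alpha> n =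
    extend_by_zero (\<lambda>z. of_real (real (n + 1) powr (\<alpha> - 1) / real (n + 2)) * z ^ (n + 2))"

lemma
  assumes \<alpha>: "0 < \<alpha>"
  shows monomial_test_sequence: "test_sequence \<alpha> ((2 * \<alpha>) powr \<alpha> * exp 1) (monomial_test \<alpha>)"
    and monomial_test_deriv: "norm z < 1 \<Longrightarrow>
      deriv (monomial_test \<alpha> n) z = of_real (real (n + 1) powr (\<alpha> - 1)) * z ^ (n + 1)"
    and monomial_test_deriv2: "norm z < 1 \<Longrightarrow>
      deriv (deriv (monomial_test \<alpha> n)) z = of_real (real (n + 1) powr \<alpha>) * z ^ n"
proof -
  let ?M = "(2 * \<alpha>) powr \<alpha> * exp 1"
  have 1: "(monomial_test \<alpha> n has_field_derivative of_real (real (n + 1) powr (\<alpha> - 1)) * z ^ (n + 1)) (at z)"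
    if "norm z < 1" for n z
  proof -
    have "((\<lambda>z. of_real (real (n + 1) powr (\<alpha> - 1) / real (n + 2)) * z ^ (n + 2)) has_field_derivative
        of_real (real (n + 1) powr (\<alpha> - 1) / real (n + 2)) * (of_nat (n + 2) * z ^ (n + 1))) (at z)"
      by (rule DERIV_cmult[OF power_DERIV]) simp
    moreover have "of_real (real (n + 1) powr (\<alpha> - 1) / real (n + 2)) * (of_nat (n + 2) * z ^ (n + 1))
        = of_real (real (n + 1) powr (\<alpha> - 1)) * z ^ (n + 1)"
    proof -
      have "of_real (real (n + 1) powr (\<alpha> - 1) / real (n + 2)) * of_nat (n + 2)
          = (of_real (real (n + 1) powr (\<alpha> - 1) / real (n + 2) * real (n + 2)) :: complex)"
        by (simp only: of_real_mult of_real_of_nat_eq)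
      also have "real (n + 1) powr (\<alpha> - 1) / real (n + 2) * real (n + 2) = real (n + 1) powr (\<alpha> - 1)"
        by simp
      finally show ?thesis
        by (metis mult.assoc)
    qed
    ultimately show ?thesis
      unfolding monomial_test_def by (intro extend_by_zero_DERIV[OF that]) simp
  qed
  have 2: "((\<lambda>z. of_real (real (n + 1) powr (\<alpha> - 1)) * z ^ (n + 1)) has_field_derivative
      of_real (real (n + 1) powr \<alpha>) * z ^ n) (at z)" for n and z :: complex
  proof -
    have "((\<lambda>z. of_real (real (n + 1) powr (\<alpha> - 1)) * z ^ (n + 1)) has_field_derivative
        of_real (real (n + 1) powr (\<alpha> - 1)) * (of_nat (n + 1) * z ^ n)) (at z)"
      by (rule DERIV_cmult[OF power_DERIV]) simp
    moreover have "of_real (real (n + 1) powr (\<alpha> - 1)) * of_nat (n + 1)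
        = (of_real (real (n + 1) powr \<alpha>) :: complex)"
    proof -
      have "real (n + 1) powr \<alpha> = real (n + 1) powr (\<alpha> - 1) * real (n + 1)"
        by (simp add: powr_diff)
      then show ?thesis
        by (simp only: of_real_mult of_real_of_nat_eq)
    qed
    ultimately show ?thesis
      by (metis mult.assoc)
  qed
  have o: "monomial_test \<alpha> n z = 0" if "norm z \<ge> 1" for n z
    using that by (simp add: monomial_test_def extend_by_zero_def)
  have nrm: "norm (of_real (real (n + 1) powr \<alpha>) * z ^ n) = real (n + 1) powr \<alpha> * norm z ^ n"
    for n and z :: complex
    by (simp add: norm_mult norm_power)
  have bd: "weight \<alpha> z * norm (of_real (real (n + 1) powr \<alpha>) * z ^ n) \<le> ?M" if "norm z < 1" for n z
    using power_weight_bound[OF \<alpha> norm_ge_zero that, of n] unfolding nrm by (simp only: mult.left_commute)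
  note I = zygmundI[OF 1 2 o bd]
  from I(3) show d1: "deriv (monomial_test \<alpha> n) z = of_real (real (n + 1) powr (\<alpha> - 1)) * z ^ (n + 1)"
    if "norm z < 1" for n z
    using that by blast
  from I(4) show d2: "deriv (deriv (monomial_test \<alpha> n)) z = of_real (real (n + 1) powr \<alpha>) * z ^ n"
    if "norm z < 1" for n z
    using that by blast
  show "test_sequence \<alpha> ?M (monomial_test \<alpha>)"
    unfolding test_sequence_def
  proof (intro conjI allI impI)
    fix n
    show "monomial_test \<alpha> n \<in> zygmund_space \<alpha>"
      using I(1) by blast
    show "monomial_test \<alpha> n 0 = 0"
      by (simp add: monomial_test_def extend_by_zero_def)
    show "deriv (monomial_test \<alpha> n) 0 = 0"
      using d1[of 0 n] by simp
    show "weight \<alpha> z * norm (deriv (deriv (monomial_test \<alpha> n)) z) \<le> ?M" if "norm z < 1" for z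
      using bd[OF that] d2[OF that] by simp
    show "\<exists>C. \<forall>z. norm z < 1 \<longrightarrow> norm (deriv (deriv (monomial_test \<alpha> n)) z) \<le> C"
    proof (intro exI allI impI)
      fix z :: complex assume z: "norm z < 1"
      have "norm z ^ n \<le> 1"
        using z by (simp add: power_le_one)
      then show "norm (deriv (deriv (monomial_test \<alpha> n)) z) \<le> real (n + 1) powr \<alpha> * 1"
        unfolding d2[OF z] nrm by (intro mult_left_mono) auto
    qed
  next
    fix s \<epsilon> :: real assume s: "0 \<le> s" "s < 1" and \<epsilon>: "0 < \<epsilon>"
    from powr_times_power_small[OF \<alpha> s \<epsilon>]
    show "\<forall>\<^sub>F n in sequentially. \<forall>z. norm z \<le> s \<longrightarrow> norm (deriv (deriv (monomial_test \<alpha> n)) z) \<le> \<epsilon>"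
    proof eventually_elim
      case (elim n)
      show ?case
      proof (intro allI impI)
        fix z :: complex assume z: "norm z \<le> s"
        then have "real (n + 1) powr \<alpha> * norm z ^ n \<le> real (n + 1) powr \<alpha> * s ^ n"
          by (intro mult_left_mono power_mono) auto
        with elim show "norm (deriv (deriv (monomial_test \<alpha> n)) z) \<le> \<epsilon>"
          using z s by (subst d2) (auto simp only: nrm)
      qed
    qed
  qed
qed

text \<open>
  For \<open>\<alpha> = 1\<close> a block of the series of \<open>- log (1 - l z)\<close> with indices between \<open>n\<close> and \<open>n (n + 2)\<close>
  is the first derivative of the test function. The block is long enough to sum to about
  \<open>log n\<close> at the point \<open>z = 1 / l\<close>, but its derivative is a block of a geometric series, bounded
  by \<open>1 / (1 - |z|)\<close> independently of its length.
\<close>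
definition log_block_test :: "nat \<Rightarrow> complex \<Rightarrow> complex \<Rightarrow> complex"
  where "log_block_test n l = extend_by_zero
    (\<lambda>z. \<Sum>k = n..<n * (n + 2). l ^ (k + 1) / of_nat ((k + 1) * (k + 2)) * z ^ (k + 2))"

lemma geometric_block_le:
  fixes \<rho> :: real
  assumes "0 \<le> \<rho>" "\<rho> < 1"
  shows "(\<Sum>k = n..<m. \<rho> ^ k) \<le> \<rho> ^ n / (1 - \<rho>)"
proof -
  have "(1 - \<rho>) * (\<Sum>k = n..<m. \<rho> ^ k) \<le> \<rho> ^ n"
  proof (cases "n \<le> m")
    case True
    have "(\<Sum>k = n..<m. \<rho> ^ k) = (\<Sum>k<m. \<rho> ^ k) - (\<Sum>k<n. \<rho> ^ k)"
      using True sum_diff_nat_ivl[of 0 n m "\<lambda>k. \<rho> ^ k"] by (simp add: atLeast0LessThan)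
    then have "(1 - \<rho>) * (\<Sum>k = n..<m. \<rho> ^ k) = \<rho> ^ n - \<rho> ^ m"
      using one_diff_power_eq[of \<rho> n] one_diff_power_eq[of \<rho> m] by (simp add: right_diff_distrib)
    then show ?thesis
      using assms by simp
  qed (use assms in simp)
  then show ?thesis
    using assms by (simp add: field_simps)
qed

lemma
  assumes l: "norm l = 1"
  shows log_block_zygmund: "log_block_test n l \<in> zygmund_space 1"
    and log_block_weight: "norm z < 1 \<Longrightarrow> weight 1 z * norm (deriv (deriv (log_block_test n l)) z) \<le> 2"
    and log_block_deriv: "norm z < 1 \<Longrightarrow> deriv (log_block_test n l) z =
      (\<Sum>k = n..<n * (n + 2). (l * z) ^ (k + 1) / of_nat (k + 1))"
    and log_block_deriv2: "norm z < 1 \<Longrightarrow> deriv (deriv (log_block_test n l)) z =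
      (\<Sum>k = n..<n * (n + 2). l ^ (k + 1) * z ^ k)"
    and log_block_deriv2_bound: "norm z < 1 \<Longrightarrow>
      norm (deriv (deriv (log_block_test n l)) z) \<le> (\<Sum>k = n..<n * (n + 2). norm z ^ k)"
proof -
  let ?I = "{n..<n * (n + 2)}"
  have 1: "(log_block_test n l has_field_derivative (\<Sum>k\<in>?I. l ^ (k + 1) / of_nat (k + 1) * z ^ (k + 1))) (at z)"
    if "norm z < 1" for z
  proof -
    have "((\<lambda>z. \<Sum>k\<in>?I. l ^ (k + 1) / of_nat ((k + 1) * (k + 2)) * z ^ (k + 2)) has_field_derivative
        (\<Sum>k\<in>?I. l ^ (k + 1) / of_nat ((k + 1) * (k + 2)) * (of_nat (k + 2) * z ^ (k + 1)))) (at z)"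
      by (intro DERIV_sum DERIV_cmult power_DERIV) simp
    moreover have "l ^ (k + 1) / of_nat ((k + 1) * (k + 2)) * (of_nat (k + 2) * z ^ (k + 1))
        = l ^ (k + 1) / of_nat (k + 1) * z ^ (k + 1)" for k
      unfolding of_nat_mult by (simp add: field_simps del: of_nat_add of_nat_Suc)
    ultimately show ?thesis
      unfolding log_block_test_def by (intro extend_by_zero_DERIV[OF that]) simp
  qed
  have 2: "((\<lambda>z. \<Sum>k\<in>?I. l ^ (k + 1) / of_nat (k + 1) * z ^ (k + 1)) has_field_derivative
      (\<Sum>k\<in>?I. l ^ (k + 1) * z ^ k)) (at z)" for z :: complex
  proof -
    have "((\<lambda>z. \<Sum>k\<in>?I. l ^ (k + 1) / of_nat (k + 1) * z ^ (k + 1)) has_field_derivative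
        (\<Sum>k\<in>?I. l ^ (k + 1) / of_nat (k + 1) * (of_nat (k + 1) * z ^ k))) (at z)"
      by (intro DERIV_sum DERIV_cmult power_DERIV) simp
    moreover have "l ^ (k + 1) / of_nat (k + 1) * (of_nat (k + 1) * z ^ k) = l ^ (k + 1) * z ^ k" for k
      by (simp del: of_nat_add of_nat_Suc)
    ultimately show ?thesis
      by simp
  qed
  have o: "log_block_test n l z = 0" if "norm z \<ge> 1" for z
    using that by (simp add: log_block_test_def extend_by_zero_def)
  have nb: "norm (\<Sum>k\<in>?I. l ^ (k + 1) * z ^ k) \<le> (\<Sum>k\<in>?I. norm z ^ k)" for z
    by (rule sum_norm_le) (simp add: norm_mult norm_power l)
  have bd: "weight 1 z * norm (\<Sum>k\<in>?I. l ^ (k + 1) * z ^ k) \<le> 2" if z: "norm z < 1" for z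
  proof -
    have "norm (\<Sum>k\<in>?I. l ^ (k + 1) * z ^ k) \<le> norm z ^ n / (1 - norm z)"
      using nb geometric_block_le[OF norm_ge_zero z] order_trans by blast
    also have "\<dots> \<le> 1 / (1 - norm z)"
      using z by (intro divide_right_mono) (auto simp: power_le_one)
    finally have "weight 1 z * norm (\<Sum>k\<in>?I. l ^ (k + 1) * z ^ k) \<le> weight 1 z * (1 / (1 - norm z))"
      by (intro mult_left_mono) auto
    also have "weight 1 z * (1 / (1 - norm z)) = 1 + norm z"
    proof -
      have "weight 1 z = (1 + norm z) * (1 - norm z)"
        using one_minus_norm_sq_pos[OF z] by (simp add: power2_eq_square algebra_simps)
      then show ?thesis
        using z by simp
    qed
    finally show ?thesis
      using z by linarith
  qed
  note I = zygmundI[OF 1 2 o bd]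
  show "log_block_test n l \<in> zygmund_space 1"
    by (rule I(1))
  show d1: "deriv (log_block_test n l) z = (\<Sum>k\<in>?I. (l * z) ^ (k + 1) / of_nat (k + 1))" if "norm z < 1" for z
  proof -
    have "deriv (log_block_test n l) z = (\<Sum>k\<in>?I. l ^ (k + 1) / of_nat (k + 1) * z ^ (k + 1))"
      using I(3) that by blast
    then show ?thesis
      by (simp add: power_mult_distrib mult_ac)
  qed
  show d2: "deriv (deriv (log_block_test n l)) z = (\<Sum>k\<in>?I. l ^ (k + 1) * z ^ k)" if "norm z < 1" for z
    using I(4) that by blast
  show "weight 1 z * norm (deriv (deriv (log_block_test n l)) z) \<le> 2" if "norm z < 1" for z
    using bd d2 that by simp
  show "norm (deriv (deriv (log_block_test n l)) z) \<le> (\<Sum>k\<in>?I. norm z ^ k)" if "norm z < 1" for z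
    using nb d2 that by simp
qed

lemma log_block_test_sequence:
  assumes l: "\<And>n. norm (l n) = 1"
  shows "test_sequence 1 2 (\<lambda>n. log_block_test n (l n))"
  unfolding test_sequence_def
proof (intro conjI allI impI)
  fix n
  show "log_block_test n (l n) \<in> zygmund_space 1"
    by (rule log_block_zygmund[OF l])
  show "log_block_test n (l n) 0 = 0"
    by (simp add: log_block_test_def extend_by_zero_def)
  show "deriv (log_block_test n (l n)) 0 = 0"
    using log_block_deriv[OF l, of 0 n n] by simp
  show "weight 1 z * norm (deriv (deriv (log_block_test n (l n))) z) \<le> 2" if "norm z < 1" for z
    by (rule log_block_weight[OF l that])
  show "\<exists>C. \<forall>z. norm z < 1 \<longrightarrow> norm (deriv (deriv (log_block_test n (l n))) z) \<le> C"
  proof (intro exI allI impI)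
    fix z :: complex assume z: "norm z < 1"
    have "(\<Sum>k = n..<n * (n + 2). norm z ^ k) \<le> (\<Sum>k = n..<n * (n + 2). 1)"
      using z by (intro sum_mono) (simp add: power_le_one)
    then show "norm (deriv (deriv (log_block_test n (l n))) z) \<le> (\<Sum>k = n..<n * (n + 2). 1)"
      using log_block_deriv2_bound[OF l z, of n n] by linarith
  qed
next
  fix s \<epsilon> :: real assume s: "0 \<le> s" "s < 1" and \<epsilon>: "0 < \<epsilon>"
  have "(\<lambda>n. s ^ n) \<longlonglongrightarrow> 0"
    using s by (intro LIMSEQ_power_zero) auto
  then have "\<forall>\<^sub>F n in sequentially. s ^ n < \<epsilon> * (1 - s)"
    by (rule order_tendstoD) (use s \<epsilon> in auto)
  then show "\<forall>\<^sub>F n in sequentially. \<forall>z. norm z \<le> s \<longrightarrow> norm (deriv (deriv (log_block_test n (l n))) z) \<le> \<epsilon>"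
  proof eventually_elim
    case (elim n)
    show ?case
    proof (intro allI impI)
      fix z :: complex assume z: "norm z \<le> s"
      have "norm (deriv (deriv (log_block_test n (l n))) z) \<le> (\<Sum>k = n..<n * (n + 2). norm z ^ k)"
        using z s by (intro log_block_deriv2_bound[OF l]) auto
      also have "\<dots> \<le> (\<Sum>k = n..<n * (n + 2). s ^ k)"
        using z by (intro sum_mono power_mono) auto
      also have "\<dots> \<le> s ^ n / (1 - s)"
        by (rule geometric_block_le[OF s])
      also have "\<dots> \<le> \<epsilon>"
        using elim s by (simp add: field_simps)
      finally show "norm (deriv (deriv (log_block_test n (l n))) z) \<le> \<epsilon>" .
    qed
  qed
qed

lemma harmonic_block_ge: "n \<le> m \<Longrightarrow> ln (real (m + 1)) - ln (real (n + 1)) \<le> (\<Sum>k = n..<m. 1 / real (k + 1))"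
proof (induction m rule: dec_induct)
  case base
  then show ?case by simp
next
  case (step m)
  have "ln (real (Suc m + 1)) - ln (real (m + 1)) = ln (1 + 1 / real (m + 1))"
  proof -
    have "1 + 1 / real (m + 1) = real (Suc m + 1) / real (m + 1)"
      by (simp add: field_simps)
    then show ?thesis
      by (simp only: ln_div) (simp add: ln_div)
  qed
  also have "\<dots> \<le> 1 / real (m + 1)"
    by (rule ln_add_one_self_le_self) simp
  finally show ?case
    using step by (simp add: sum.atLeastLessThan_Suc)
qed

lemma log_block_value:
  assumes \<rho>: "0 \<le> \<rho>" "\<rho> \<le> (1::real)"
  shows "\<rho> ^ (n * (n + 2)) * ln (real (n + 1)) \<le> (\<Sum>k = n..<n * (n + 2). \<rho> ^ (k + 1) / real (k + 1))"
proof -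
  let ?N = "n * (n + 2)"
  have "real (?N + 1) = real (n + 1) * real (n + 1)"
    by (simp add: algebra_simps)
  then have "ln (real (?N + 1)) = ln (real (n + 1)) + ln (real (n + 1))"
    by (simp only:) (simp add: ln_mult)
  then have "ln (real (n + 1)) \<le> (\<Sum>k = n..<?N. 1 / real (k + 1))"
    using harmonic_block_ge[of n ?N] by simp
  then have "\<rho> ^ ?N * ln (real (n + 1)) \<le> \<rho> ^ ?N * (\<Sum>k = n..<?N. 1 / real (k + 1))"
    using \<rho> by (intro mult_left_mono) auto
  also have "\<dots> = (\<Sum>k = n..<?N. \<rho> ^ ?N / real (k + 1))"
    by (simp add: sum_distrib_left)
  also have "\<dots> \<le> (\<Sum>k = n..<?N. \<rho> ^ (k + 1) / real (k + 1))"
    using \<rho> by (intro sum_mono divide_right_mono power_decreasing) auto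
  finally show ?thesis .
qed

section \<open>Lower estimates\<close>

context bounded_comp_volterra
begin

lemma phi_power_le:
  assumes "norm z < 1" "m \<le> n"
  shows "norm (q * \<phi> z ^ n) \<le> norm (q * \<phi> z ^ m)"
  unfolding norm_mult norm_power using norm_phi[OF assms(1)] assms(2)
  by (intro mult_left_mono power_decreasing) auto

abbreviation (input) monomial_norm :: real where "monomial_norm \<equiv> (2 * \<alpha>) powr \<alpha> * exp 1"

lemma monomial_norm_pos: "0 < monomial_norm"
  using \<alpha> by simp

lemma essential_norm_monomials:
  assumes e: "0 < e" "essential_norm \<alpha> \<beta> T < ennreal e"
  shows "\<forall>\<^sub>F n in sequentially. \<forall>z\<in>unit_disc. real (n + 1) powr (\<alpha> - 1) *
    (weight \<beta> z * norm (of_nat (n + 1) * (u z * \<phi> z ^ n) + w z * \<phi> z ^ (n + 1))) \<le> e * monomial_norm"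
  using essential_norm_test[OF e monomial_test_sequence[OF \<alpha>] monomial_norm_pos]
proof eventually_elim
  case (elim n)
  show ?case
  proof
    fix z assume z: "z \<in> unit_disc"
    then have \<phi>z: "norm (\<phi> z) < 1"
      using norm_phi by simp
    let ?c = "real (n + 1) powr (\<alpha> - 1)"
    let ?D = "of_nat (n + 1) * (u z * \<phi> z ^ n) + w z * \<phi> z ^ (n + 1)"
    have "real (n + 1) powr \<alpha> = ?c * real (n + 1)"
      by (simp add: powr_diff)
    then have "u z * deriv (deriv (monomial_test \<alpha> n)) (\<phi> z) + w z * deriv (monomial_test \<alpha> n) (\<phi> z)
        = of_real ?c * ?D"
      unfolding monomial_test_deriv[OF \<alpha> \<phi>z] monomial_test_deriv2[OF \<alpha> \<phi>z]
      by (simp only: of_real_mult of_real_of_nat_eq) (simp add: algebra_simps)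
    then have "norm (u z * deriv (deriv (monomial_test \<alpha> n)) (\<phi> z) + w z * deriv (monomial_test \<alpha> n) (\<phi> z))
        = ?c * norm ?D"
      by (simp only: norm_mult norm_of_real) simp
    then show "?c * (weight \<beta> z * norm ?D) \<le> e * monomial_norm"
      using bspec[OF elim z] by (simp only: mult.left_commute)
  qed
qed

text \<open>
  For \<open>\<alpha> < 1\<close> the second symbol enters with the factor \<open>(n + 1) powr (\<alpha> - 1)\<close>, which tends to 0.
\<close>
lemma lower_first_less_1:
  assumes \<alpha>1: "\<alpha> < 1" and e: "0 < e" "essential_norm \<alpha> \<beta> T < ennreal e"
  shows "\<forall>\<^sub>F n in sequentially. \<forall>z\<in>unit_disc.
    real (n + 1) powr \<alpha> * (weight \<beta> z * norm (u z * \<phi> z ^ n)) \<le> 2 * monomial_norm * e"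
proof -
  obtain W where W: "0 \<le> W" "\<And>z. norm z < 1 \<Longrightarrow> weight \<beta> z * norm (w z) \<le> W"
    using symbols_bounded by metis
  have "(\<lambda>n. W * real (n + 1) powr (\<alpha> - 1)) \<longlonglongrightarrow> W * 0"
    using \<alpha>1 filterlim_compose[OF filterlim_real_sequentially filterlim_add_const_nat_at_top[of 1]]
    by (intro tendsto_mult_left tendsto_neg_powr) auto
  then have "\<forall>\<^sub>F n in sequentially. W * real (n + 1) powr (\<alpha> - 1) < e * monomial_norm"
    by (rule order_tendstoD) (use e monomial_norm_pos in simp)
  with essential_norm_monomials[OF e] show ?thesis
  proof eventually_elim
    case (elim n)
    show ?case
    proof
      fix z assume z: "z \<in> unit_disc"
      let ?c = "real (n + 1) powr (\<alpha> - 1)"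
      let ?A = "of_nat (n + 1) * (u z * \<phi> z ^ n)" and ?B = "w z * \<phi> z ^ (n + 1)"
      have "weight \<beta> z * norm ?B \<le> weight \<beta> z * norm (w z)"
        using phi_power_le[of z 0 "n + 1" "w z"] z by (intro mult_left_mono) auto
      also have "\<dots> \<le> W"
        using W(2)[of z] z by simp
      finally have "?c * (weight \<beta> z * norm ?B) \<le> ?c * W"
        by (rule mult_left_mono) simp
      then have B: "?c * (weight \<beta> z * norm ?B) \<le> e * monomial_norm"
        using elim(2) by (simp only: mult.commute[of W])
      have "norm ?A \<le> norm (?A + ?B) + norm ?B"
        by (metis add_diff_cancel_right' norm_triangle_ineq4)
      then have "?c * (weight \<beta> z * norm ?A) \<le> ?c * (weight \<beta> z * (norm (?A + ?B) + norm ?B))"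
        by (intro mult_left_mono) auto
      also have "\<dots> = ?c * (weight \<beta> z * norm (?A + ?B)) + ?c * (weight \<beta> z * norm ?B)"
        by (simp only: distrib_left)
      also have "\<dots> \<le> e * monomial_norm + e * monomial_norm"
        using bspec[OF elim(1) z] B by (rule add_mono)
      finally have "?c * (weight \<beta> z * norm ?A) \<le> 2 * monomial_norm * e"
        by (simp add: mult_ac)
      moreover have "?c * (weight \<beta> z * norm ?A) = real (n + 1) powr \<alpha> * (weight \<beta> z * norm (u z * \<phi> z ^ n))"
      proof -
        have "real (n + 1) powr \<alpha> = ?c * real (n + 1)"
          by (simp add: powr_diff)
        moreover have "norm ?A = real (n + 1) * norm (u z * \<phi> z ^ n)"
          by (simp only: norm_mult[of "of_nat (n + 1)"] norm_of_nat)
        ultimately show ?thesis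
          by (simp only: mult_ac)
      qed
      ultimately show "real (n + 1) powr \<alpha> * (weight \<beta> z * norm (u z * \<phi> z ^ n)) \<le> 2 * monomial_norm * e"
        by (simp only:)
    qed
  qed
qed

text \<open>
  Let \<open>D\<^sub>n = (n + 1) u \<phi>\<^sup>n + w \<phi>\<^sup>n\<^sup>+\<^sup>1\<close>. The second symbol cancels in \<open>D\<^sub>2\<^sub>n - \<phi>\<^sup>n D\<^sub>n = n u \<phi>\<^sup>2\<^sup>n\<close>, so the
  monomials alone separate the two symbols.
\<close>
lemma lower_first_ge_1:
  assumes \<alpha>1: "1 \<le> \<alpha>" and e: "0 < e" "essential_norm \<alpha> \<beta> T < ennreal e"
  shows "\<forall>\<^sub>F n in sequentially. \<forall>z\<in>unit_disc.
    real (n + 1) powr \<alpha> * (weight \<beta> z * norm (u z * \<phi> z ^ n)) \<le> 2 powr \<alpha> * 4 * monomial_norm * e"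
proof -
  let ?D = "\<lambda>n z. of_nat (n + 1) * (u z * \<phi> z ^ n) + w z * \<phi> z ^ (n + 1)"
  let ?b = "e * monomial_norm"
  obtain N where N: "2 \<le> N" "\<And>n z. N \<le> n \<Longrightarrow> norm z < 1 \<Longrightarrow>
      real (n + 1) powr (\<alpha> - 1) * (weight \<beta> z * norm (?D n z)) \<le> ?b"
    using eventually_on_disc_obtain[OF essential_norm_monomials[OF e]] by metis
  have even_case: "real (n + 1) powr \<alpha> * (weight \<beta> z * norm (u z * \<phi> z ^ (2 * n))) \<le> 4 * ?b"
    if n: "N \<le> n" and z: "norm z < 1" for n z
  proof -
    let ?c = "real (n + 1) powr (\<alpha> - 1)"
    let ?U = "weight \<beta> z * norm (u z * \<phi> z ^ (2 * n))"
    have "of_nat n * (u z * \<phi> z ^ (2 * n)) = ?D (2 * n) z - \<phi> z ^ n * ?D n z"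
    proof -
      have "of_nat n * (a * (p * p)) = of_nat (2 * n + 1) * (a * (p * p)) + b * (p * p * f)
          - p * (of_nat (n + 1) * (a * p) + b * (p * f))" for a b p f :: complex
        by (simp add: algebra_simps)
      from this[of "u z" "\<phi> z ^ n" "w z" "\<phi> z"] show ?thesis
        by (simp only: mult_2 power_add power_one_right)
    qed
    then have "real n * norm (u z * \<phi> z ^ (2 * n)) = norm (?D (2 * n) z - \<phi> z ^ n * ?D n z)"
      by (metis norm_mult norm_of_nat)
    also have "\<dots> \<le> norm (?D (2 * n) z) + norm (\<phi> z ^ n * ?D n z)"
      by (rule norm_triangle_ineq4)
    also have "norm (\<phi> z ^ n * ?D n z) \<le> norm (?D n z)"
      using phi_power_le[OF z, of 0 n "?D n z"] by (simp add: mult.commute)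
    finally have "?c * (weight \<beta> z * (real n * norm (u z * \<phi> z ^ (2 * n))))
        \<le> ?c * (weight \<beta> z * (norm (?D (2 * n) z) + norm (?D n z)))"
      by (intro mult_left_mono) auto
    also have "\<dots> = ?c * (weight \<beta> z * norm (?D (2 * n) z)) + ?c * (weight \<beta> z * norm (?D n z))"
      by (simp only: distrib_left)
    also have "?c * (weight \<beta> z * norm (?D (2 * n) z))
        \<le> real (2 * n + 1) powr (\<alpha> - 1) * (weight \<beta> z * norm (?D (2 * n) z))"
      using \<alpha>1 by (intro mult_right_mono powr_mono2) auto
    finally have 1: "real n * (?c * ?U) \<le> 2 * ?b"
      using N(2)[OF n z] N(2)[of "2 * n" z] n z by (simp add: mult_ac)
    have "real (n + 1) powr \<alpha> * ?U = real (n + 1) * (?c * ?U)"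
      by (simp add: powr_diff)
    also have "\<dots> \<le> (2 * real n) * (?c * ?U)"
      using n N(1) by (intro mult_right_mono) auto
    finally show ?thesis
      using 1 by linarith
  qed
  have "real (m + 1) powr \<alpha> * (weight \<beta> z * norm (u z * \<phi> z ^ m)) \<le> 2 powr \<alpha> * 4 * monomial_norm * e"
    if m: "2 * N \<le> m" and z: "norm z < 1" for m z
  proof -
    define n where "n = m div 2"
    have n: "N \<le> n" "2 * n \<le> m" "m + 1 \<le> 2 * (n + 1)"
      using m by (auto simp: n_def)
    have "real (m + 1) powr \<alpha> \<le> (2 * real (n + 1)) powr \<alpha>"
      using n(3) \<alpha> by (intro powr_mono2) auto
    also have "\<dots> = 2 powr \<alpha> * real (n + 1) powr \<alpha>"
      by (rule powr_mult)
    finally have "real (m + 1) powr \<alpha> * (weight \<beta> z * norm (u z * \<phi> z ^ m))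
        \<le> (2 powr \<alpha> * real (n + 1) powr \<alpha>) * (weight \<beta> z * norm (u z * \<phi> z ^ (2 * n)))"
      using phi_power_le[OF z n(2)] by (intro mult_mono) auto
    also have "\<dots> = 2 powr \<alpha> * (real (n + 1) powr \<alpha> * (weight \<beta> z * norm (u z * \<phi> z ^ (2 * n))))"
      by (simp only: mult.assoc)
    also have "\<dots> \<le> 2 powr \<alpha> * (4 * ?b)"
      using even_case[OF n(1) z] by (rule mult_left_mono) simp
    finally show ?thesis
      by (simp add: mult_ac)
  qed
  then show ?thesis
    unfolding eventually_sequentially by (intro exI[of _ "2 * N"]) auto
qed

lemma lower_second_greater_1:
  assumes \<alpha>1: "1 < \<alpha>" and e: "0 < e" "essential_norm \<alpha> \<beta> T < ennreal e"
  shows "\<forall>\<^sub>F n in sequentially. \<forall>z\<in>unit_disc. real (n + 1) powr (\<alpha> - 1) *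
    (weight \<beta> z * norm (w z * \<phi> z ^ n)) \<le> 2 powr (\<alpha> - 1) * (1 + 2 powr \<alpha> * 4) * monomial_norm * e"
proof -
  let ?A = "\<lambda>n z. of_nat (n + 1) * (u z * \<phi> z ^ n)" and ?B = "\<lambda>n z. w z * \<phi> z ^ (n + 1)"
  let ?b = "2 powr \<alpha> * 4 * monomial_norm * e"
  obtain N1 where N1: "2 \<le> N1" "\<And>n z. N1 \<le> n \<Longrightarrow> norm z < 1 \<Longrightarrow>
      real (n + 1) powr (\<alpha> - 1) * (weight \<beta> z * norm (?A n z + ?B n z)) \<le> e * monomial_norm"
    using eventually_on_disc_obtain[OF essential_norm_monomials[OF e]] by blast
  obtain N2 where N2: "2 \<le> N2" "\<And>n z. N2 \<le> n \<Longrightarrow> norm z < 1 \<Longrightarrow>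
      real (n + 1) powr \<alpha> * (weight \<beta> z * norm (u z * \<phi> z ^ n)) \<le> ?b"
    using eventually_on_disc_obtain[OF lower_first_ge_1[OF less_imp_le[OF \<alpha>1] e]] by blast
  have "real (m + 1) powr (\<alpha> - 1) * (weight \<beta> z * norm (w z * \<phi> z ^ m))
      \<le> 2 powr (\<alpha> - 1) * (1 + 2 powr \<alpha> * 4) * monomial_norm * e"
    if m: "N1 + N2 + 1 \<le> m" and z: "norm z < 1" for m z
  proof -
    define n where "n = m - 1"
    have n: "N1 \<le> n" "N2 \<le> n" "m = n + 1"
      using m by (auto simp: n_def)
    let ?c = "real (n + 1) powr (\<alpha> - 1)"
    have "norm (?B n z) \<le> norm (?A n z + ?B n z) + norm (?A n z)"
      by (metis add_diff_cancel_left' norm_triangle_ineq4)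
    then have "?c * (weight \<beta> z * norm (?B n z)) \<le> ?c * (weight \<beta> z * (norm (?A n z + ?B n z) + norm (?A n z)))"
      by (intro mult_left_mono) auto
    also have "\<dots> = ?c * (weight \<beta> z * norm (?A n z + ?B n z)) + ?c * (weight \<beta> z * norm (?A n z))"
      by (simp only: distrib_left)
    also have "?c * (weight \<beta> z * norm (?A n z)) = real (n + 1) powr \<alpha> * (weight \<beta> z * norm (u z * \<phi> z ^ n))"
    proof -
      have "real (n + 1) powr \<alpha> = ?c * real (n + 1)"
        by (simp add: powr_diff)
      moreover have "norm (?A n z) = real (n + 1) * norm (u z * \<phi> z ^ n)"
        by (simp only: norm_mult[of "of_nat (n + 1)"] norm_of_nat)
      ultimately show ?thesis
        by (simp only: mult_ac)
    qed
    finally have 1: "?c * (weight \<beta> z * norm (?B n z)) \<le> e * monomial_norm + ?b"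
      using N1(2)[OF n(1) z] N2(2)[OF n(2) z] by linarith
    have "real (m + 1) powr (\<alpha> - 1) \<le> (2 * real (n + 1)) powr (\<alpha> - 1)"
      using n(3) \<alpha>1 by (intro powr_mono2) auto
    also have "\<dots> = 2 powr (\<alpha> - 1) * ?c"
      by (rule powr_mult)
    finally have "real (m + 1) powr (\<alpha> - 1) * (weight \<beta> z * norm (w z * \<phi> z ^ m))
        \<le> (2 powr (\<alpha> - 1) * ?c) * (weight \<beta> z * norm (?B n z))"
      unfolding n(3) by (intro mult_right_mono) auto
    also have "\<dots> = 2 powr (\<alpha> - 1) * (?c * (weight \<beta> z * norm (?B n z)))"
      by (simp only: mult.assoc)
    also have "\<dots> \<le> 2 powr (\<alpha> - 1) * (e * monomial_norm + ?b)"
      using 1 by (rule mult_left_mono) simp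
    finally show ?thesis
      by (simp add: algebra_simps)
  qed
  then show ?thesis
    unfolding eventually_sequentially by (intro exI[of _ "N1 + N2 + 1"]) auto
qed

text \<open>
  The rotation \<open>l\<close> of a block may depend on the point: if the estimate failed for infinitely many
  \<open>n\<close>, the rotations at which it fails would form a test sequence that contradicts it.
\<close>
lemma essential_norm_log_blocks:
  assumes \<alpha>1: "\<alpha> = 1" and e: "0 < e" "essential_norm \<alpha> \<beta> T < ennreal e"
  shows "\<forall>\<^sub>F n in sequentially. \<forall>z\<in>unit_disc. \<forall>l. norm l = 1 \<longrightarrow>
    weight \<beta> z * norm (u z * deriv (deriv (log_block_test n l)) (\<phi> z)
      + w z * deriv (log_block_test n l) (\<phi> z)) \<le> e * 2"
proof -
  let ?ok = "\<lambda>n l. \<forall>z\<in>unit_disc. weight \<beta> z * norm (u z * deriv (deriv (log_block_test n l)) (\<phi> z)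
      + w z * deriv (log_block_test n l) (\<phi> z)) \<le> e * 2"
  have "\<forall>n. \<exists>l. norm l = 1 \<and> (?ok n l \<longrightarrow> (\<forall>l. norm l = 1 \<longrightarrow> ?ok n l))"
    by (metis norm_one)
  then obtain l where l: "\<And>n. norm (l n) = 1" "\<And>n. ?ok n (l n) \<Longrightarrow> (\<forall>l. norm l = 1 \<longrightarrow> ?ok n l)"
    by metis
  have "\<forall>\<^sub>F n in sequentially. ?ok n (l n)"
    using log_block_test_sequence[of l, OF l(1)] by (intro essential_norm_test[OF e]) (auto simp: \<alpha>1)
  then show ?thesis
    by (rule eventually_mono) (use l(2) in blast)
qed

text \<open>
  Put \<open>N = n (n + 2)\<close>. Multiplying the estimate for a block by \<open>|\<phi>|\<^sup>N\<close> brings all its terms to a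
  common power: the first symbol then contributes at most \<open>N |u| |\<phi>|\<^sup>N\<close>, which the monomials
  control, and the second at least \<open>ln (n + 1) |w| |\<phi>|\<^sup>2\<^sup>N\<close>. Every exponent \<open>m\<close> lies between two
  consecutive values of \<open>2 N\<close>, and there \<open>ln m \<le> 4 ln (n + 1)\<close>.
\<close>
lemma lower_second_eq_1:
  assumes \<alpha>1: "\<alpha> = 1" and e: "0 < e" "essential_norm \<alpha> \<beta> T < ennreal e"
  shows "\<forall>\<^sub>F n in sequentially. \<forall>z\<in>unit_disc.
    ln (real n) * (weight \<beta> z * norm (w z * \<phi> z ^ n)) \<le> 4 * (2 + 2 powr \<alpha> * 4 * monomial_norm) * e"
proof -
  let ?b = "2 powr \<alpha> * 4 * monomial_norm * e"
  obtain N1 where N1: "2 \<le> N1" "\<And>n z. N1 \<le> n \<Longrightarrow> norm z < 1 \<Longrightarrow> \<forall>l. norm l = 1 \<longrightarrow>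
      weight \<beta> z * norm (u z * deriv (deriv (log_block_test n l)) (\<phi> z)
      + w z * deriv (log_block_test n l) (\<phi> z)) \<le> e * 2"
    using eventually_on_disc_obtain[OF essential_norm_log_blocks[OF \<alpha>1 e]] by blast
  obtain N2 where N2: "2 \<le> N2" "\<And>n z. N2 \<le> n \<Longrightarrow> norm z < 1 \<Longrightarrow>
      real (n + 1) powr \<alpha> * (weight \<beta> z * norm (u z * \<phi> z ^ n)) \<le> ?b"
    using eventually_on_disc_obtain[OF lower_first_ge_1[OF eq_refl[OF \<alpha>1[symmetric]] e]] by blast
  have block: "ln (real (n + 1)) * (weight \<beta> z * norm (w z * \<phi> z ^ (2 * (n * (n + 2))))) \<le> e * 2 + ?b"
    if n: "N1 + N2 \<le> n" and z: "norm z < 1" for n z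
  proof -
    let ?N = "n * (n + 2)"
    define \<rho> where "\<rho> = norm (\<phi> z)"
    have \<rho>: "0 \<le> \<rho>" "\<rho> < 1"
      using norm_phi[OF z] by (auto simp: \<rho>_def)
    have \<phi>z: "norm (\<phi> z) < 1"
      using \<rho> by (simp add: \<rho>_def)
    \<comment> \<open>This rotation makes all terms of the block nonnegative at \<open>\<phi> z\<close>.\<close>
    define l where "l = (if \<phi> z = 0 then 1 else of_real \<rho> / \<phi> z)"
    have l: "norm l = 1" "l * \<phi> z = of_real \<rho>"
      by (auto simp: l_def \<rho>_def norm_divide)
    let ?F1 = "deriv (log_block_test n l) (\<phi> z)" and ?F2 = "deriv (deriv (log_block_test n l)) (\<phi> z)"
    have "?F1 = of_real (\<Sum>k = n..<?N. \<rho> ^ (k + 1) / real (k + 1))"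
      unfolding log_block_deriv[OF l(1) \<phi>z] l(2) by simp
    then have F1: "\<rho> ^ ?N * ln (real (n + 1)) \<le> norm ?F1"
      using order_trans[OF log_block_value[OF \<rho>(1) less_imp_le[OF \<rho>(2)], of n] abs_ge_self]
      by (simp only: norm_of_real)
    have "norm ?F2 \<le> (\<Sum>k = n..<?N. \<rho> ^ k)"
      unfolding \<rho>_def by (rule log_block_deriv2_bound[OF l(1) \<phi>z])
    also have "\<dots> \<le> (\<Sum>k = n..<?N. 1)"
      using \<rho> by (intro sum_mono) (simp add: power_le_one)
    also have "\<dots> \<le> real (?N + 1)"
      by simp
    finally have F2: "norm ?F2 \<le> real (?N + 1)" .
    have "weight \<beta> z * (norm (u z) * norm ?F2) * \<rho> ^ ?N \<le> weight \<beta> z * (norm (u z) * real (?N + 1)) * \<rho> ^ ?N"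
      using F2 \<rho> by (intro mult_right_mono mult_left_mono) auto
    also have "\<dots> = real (?N + 1) powr \<alpha> * (weight \<beta> z * norm (u z * \<phi> z ^ ?N))"
      by (simp add: \<alpha>1 norm_mult norm_power \<rho>_def mult_ac)
    also have "\<dots> \<le> ?b"
      using n N2(1) by (intro N2(2) z) (auto intro: order_trans[of _ n])
    finally have u: "weight \<beta> z * (norm (u z) * norm ?F2) * \<rho> ^ ?N \<le> ?b" .
    have "norm (w z) * norm ?F1 \<le> norm (u z * ?F2 + w z * ?F1) + norm (u z) * norm ?F2"
      using norm_triangle_ineq4[of "u z * ?F2 + w z * ?F1" "u z * ?F2"] by (simp add: norm_mult)
    then have "weight \<beta> z * (norm (w z) * norm ?F1) * \<rho> ^ ?N
        \<le> weight \<beta> z * (norm (u z * ?F2 + w z * ?F1) + norm (u z) * norm ?F2) * \<rho> ^ ?N"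
      using \<rho> by (intro mult_right_mono mult_left_mono) auto
    also have "\<dots> = weight \<beta> z * norm (u z * ?F2 + w z * ?F1) * \<rho> ^ ?N
        + weight \<beta> z * (norm (u z) * norm ?F2) * \<rho> ^ ?N"
      by (simp only: distrib_left distrib_right)
    also have "weight \<beta> z * norm (u z * ?F2 + w z * ?F1) * \<rho> ^ ?N
        \<le> weight \<beta> z * norm (u z * ?F2 + w z * ?F1) * 1"
      using \<rho> by (intro mult_left_mono) (auto simp: power_le_one)
    also have "\<dots> \<le> e * 2"
      using N1(2)[of n z] n z l(1) by simp
    finally have 1: "weight \<beta> z * (norm (w z) * norm ?F1) * \<rho> ^ ?N \<le> e * 2 + ?b"
      using u by linarith
    have "ln (real (n + 1)) * (weight \<beta> z * norm (w z * \<phi> z ^ (2 * ?N)))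
        = weight \<beta> z * (norm (w z) * (\<rho> ^ ?N * ln (real (n + 1)))) * \<rho> ^ ?N"
    proof -
      have "norm (w z * \<phi> z ^ (2 * ?N)) = norm (w z) * (\<rho> ^ ?N * \<rho> ^ ?N)"
        by (simp only: norm_mult norm_power \<rho>_def mult_2 power_add)
      then show ?thesis
        by (simp only: mult_ac)
    qed
    also have "\<dots> \<le> weight \<beta> z * (norm (w z) * norm ?F1) * \<rho> ^ ?N"
      using F1 \<rho> by (intro mult_right_mono mult_left_mono) auto
    finally show ?thesis
      using 1 by linarith
  qed
  define n0 where "n0 = N1 + N2"
  have "ln (real m) * (weight \<beta> z * norm (w z * \<phi> z ^ m)) \<le> 4 * (2 + 2 powr \<alpha> * 4 * monomial_norm) * e"
    if m: "2 * (n0 * (n0 + 2)) \<le> m" and z: "norm z < 1" for m z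
  proof -
    define n where "n = (LEAST n. m < 2 * ((n + 1) * (n + 3)))"
    have "m < 2 * ((m + 1) * (m + 3))"
      by simp
    then have up: "m < 2 * ((n + 1) * (n + 3))"
      unfolding n_def by (rule LeastI)
    have n0n: "n0 \<le> n"
    proof (rule ccontr)
      assume "\<not> n0 \<le> n"
      then have "(n + 1) * (n + 3) \<le> n0 * (n0 + 2)"
        by (intro mult_mono) auto
      with up m show False by linarith
    qed
    have n1: "4 \<le> n"
      using n0n N1(1) N2(1) by (simp add: n0_def)
    then obtain p where p: "n = Suc p"
      by (cases n) auto
    have "\<not> m < 2 * ((p + 1) * (p + 3))"
      using not_less_Least[of p "\<lambda>n. m < 2 * ((n + 1) * (n + 3))"] p by (simp add: n_def)
    then have lo: "2 * (n * (n + 2)) \<le> m"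
      using p by (simp add: numeral_3_eq_3)
    have "2 * ((n + 1) * (n + 3)) \<le> (n + 1) ^ 4"
    proof -
      have "2 * (n + 3) \<le> (n + 1) * (n + 1)"
        using mult_le_mono[OF n1 n1] by (simp add: algebra_simps)
      also have "\<dots> \<le> (n + 1) * (n + 1) * (n + 1)"
        by simp
      finally have "(n + 1) * (2 * (n + 3)) \<le> (n + 1) * ((n + 1) * (n + 1) * (n + 1))"
        by (rule mult_le_mono2)
      then show ?thesis
        by (simp only: power4_eq_xxxx mult_ac)
    qed
    with up have "m \<le> (n + 1) ^ 4"
      by linarith
    moreover have m0: "0 < m"
      using lo n1 by (cases m) auto
    ultimately have "ln (real m) \<le> ln (real (n + 1) ^ 4)"
      by (subst ln_le_cancel_iff) (auto simp flip: of_nat_power simp del: of_nat_add of_nat_Suc)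
    also have "\<dots> = 4 * ln (real (n + 1))"
      by (subst ln_realpow) auto
    finally have "ln (real m) * (weight \<beta> z * norm (w z * \<phi> z ^ m))
        \<le> (4 * ln (real (n + 1))) * (weight \<beta> z * norm (w z * \<phi> z ^ (2 * (n * (n + 2)))))"
      using phi_power_le[OF z lo] m0 by (intro mult_mono) auto
    also have "\<dots> = 4 * (ln (real (n + 1)) * (weight \<beta> z * norm (w z * \<phi> z ^ (2 * (n * (n + 2))))))"
      by (simp only: mult.assoc)
    also have "\<dots> \<le> 4 * (e * 2 + ?b)"
      using block[OF n0n[unfolded n0_def] z] by (rule mult_left_mono) simp
    finally show ?thesis
      by (simp add: algebra_simps)
  qed
  then show ?thesis
    unfolding eventually_sequentially by (intro exI[of _ "2 * (n0 * (n0 + 2))"]) auto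
qed

end

section \<open>The essential norm\<close>

lemma ennreal_le_multI:
  assumes C: "0 < C" and le: "\<And>e. 0 < e \<Longrightarrow> A < ennreal e \<Longrightarrow> B \<le> ennreal (C * e)"
  shows "B \<le> ennreal C * A"
proof (cases A)
  case (real a)
  show ?thesis
  proof (rule ennreal_le_epsilon)
    fix \<delta> :: real assume \<delta>: "0 < \<delta>"
    have "B \<le> ennreal (C * (a + \<delta> / C))"
      using real \<delta> C by (intro le) (auto simp: add_nonneg_pos ennreal_less_iff)
    also have "C * (a + \<delta> / C) = C * a + \<delta>"
      using C by (simp add: field_simps)
    finally show "B \<le> ennreal C * A + ennreal \<delta>"
      using real \<delta> C by (simp add: ennreal_mult ennreal_plus)
  qed
next
  case top
  then show ?thesis
    using C by (simp add: ennreal_mult_top)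
qed

text \<open>
  Both estimates are needed for strict real majorants only; this removes infinite values and
  leaves room for the errors in the limits on both sides.
\<close>
lemma comparable_on_bounded_symbolsI:
  assumes \<alpha>\<beta>: "0 < \<alpha>" "0 < \<beta>" and C: "0 < C" "0 < D"
    and up: "\<And>\<phi> g b. bounded_comp_volterra \<alpha> \<beta> \<phi> g \<Longrightarrow> 0 < b \<Longrightarrow> B \<phi> g < ennreal b \<Longrightarrow>
      essential_norm \<alpha> \<beta> (comp_volterra \<phi> g) \<le> ennreal (C * b)"
    and lo: "\<And>\<phi> g e. bounded_comp_volterra \<alpha> \<beta> \<phi> g \<Longrightarrow> 0 < e \<Longrightarrow>
      essential_norm \<alpha> \<beta> (comp_volterra \<phi> g) < ennreal e \<Longrightarrow> B \<phi> g \<le> ennreal (D * e)"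
  shows "comparable_on_bounded_symbols \<alpha> \<beta> (\<lambda>\<phi> g. essential_norm \<alpha> \<beta> (comp_volterra \<phi> g)) B"
  unfolding comparable_on_bounded_symbols_def
proof (rule exI[of _ "1 / C"], intro conjI, use C in simp, rule exI[of _ D], intro conjI allI impI)
  fix \<phi> g :: "complex \<Rightarrow> complex"
  let ?A = "essential_norm \<alpha> \<beta> (comp_volterra \<phi> g)"
  assume "\<phi> holomorphic_on unit_disc" "\<phi> ` unit_disc \<subseteq> unit_disc" "g holomorphic_on unit_disc"
    "bounded_operator \<alpha> \<beta> (comp_volterra \<phi> g)"
  then have V: "bounded_comp_volterra \<alpha> \<beta> \<phi> g"
    using \<alpha>\<beta> by unfold_locales
  have "?A \<le> ennreal C * B \<phi> g"
    by (rule ennreal_le_multI[OF C(1) up[OF V]])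
  then have "ennreal (1 / C) * ?A \<le> ennreal (1 / C) * (ennreal C * B \<phi> g)"
    by (rule mult_left_mono) simp
  also have "\<dots> = B \<phi> g"
    using C by (simp add: mult.assoc[symmetric] ennreal_mult[symmetric])
  finally show "ennreal (1 / C) * ?A \<le> B \<phi> g" .
  show "B \<phi> g \<le> ennreal D * ?A"
    by (rule ennreal_le_multI[OF C(2) lo[OF V]])
qed (use C in simp)

lemma essential_norm_comparable_less_1:
  assumes "0 < \<alpha>" "\<alpha> < 1" "0 < \<beta>"
  shows "comparable_on_bounded_symbols \<alpha> \<beta>
    (\<lambda>\<phi> g. essential_norm \<alpha> \<beta> (comp_volterra \<phi> g))
    (\<lambda>\<phi> g. limsup (\<lambda>n. ennreal (real (n + 1) powr \<alpha>) *
      weighted_norm \<beta> (\<lambda>z. symbol1 \<phi> g z * \<phi> z ^ n)))"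
proof (rule comparable_on_bounded_symbolsI[OF assms(1,3), of "4 * exp 2" "2 * ((2 * \<alpha>) powr \<alpha> * exp 1)"])
  fix \<phi> g :: "complex \<Rightarrow> complex" and b :: real
  assume "bounded_comp_volterra \<alpha> \<beta> \<phi> g" and b: "0 < b"
  then interpret bounded_comp_volterra \<alpha> \<beta> \<phi> g
    by simp
  show "essential_norm \<alpha> \<beta> T \<le> ennreal (4 * exp 2 * b)"
    if "limsup (\<lambda>n. ennreal (real (n + 1) powr \<alpha>) * weighted_norm \<beta> (\<lambda>z. u z * \<phi> z ^ n)) < ennreal b"
    by (rule essential_norm_le_from_powers_less_1[OF assms(2) b])
      (rule limsup_less_imp_eventually[OF _ less_imp_le[OF b] that], simp)
  show "limsup (\<lambda>n. ennreal (real (n + 1) powr \<alpha>) * weighted_norm \<beta> (\<lambda>z. u z * \<phi> z ^ n))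
      \<le> ennreal (2 * ((2 * \<alpha>) powr \<alpha> * exp 1) * b)" if "essential_norm \<alpha> \<beta> T < ennreal b"
    by (rule eventually_imp_limsup_le[OF _ _ lower_first_less_1[OF assms(2) b that]])
      (use b in auto)
qed (use assms in auto)

lemma essential_norm_comparable_eq_1:
  assumes "0 < \<beta>"
  shows "comparable_on_bounded_symbols 1 \<beta>
    (\<lambda>\<phi> g. essential_norm 1 \<beta> (comp_volterra \<phi> g))
    (\<lambda>\<phi> g. max
      (limsup (\<lambda>n. ennreal (real (n + 1)) * weighted_norm \<beta> (\<lambda>z. symbol1 \<phi> g z * \<phi> z ^ n)))
      (limsup (\<lambda>n. ennreal (ln (real n)) * weighted_norm \<beta> (\<lambda>z. symbol2 \<phi> g z * \<phi> z ^ n))))"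
proof -
  define M :: real where "M = (2 * 1) powr 1 * exp 1"
  define D1 :: real where "D1 = 2 powr 1 * 4 * M"
  define D2 :: real where "D2 = 4 * (2 + 2 powr 1 * 4 * M)"
  have M: "0 < M"
    by (simp add: M_def)
  show ?thesis
  proof (rule comparable_on_bounded_symbolsI[OF zero_less_one assms, of "(3 + 2 * 2) * exp 2" "max D1 D2"])
    fix \<phi> g :: "complex \<Rightarrow> complex" and b :: real
    assume "bounded_comp_volterra 1 \<beta> \<phi> g" and b: "0 < b"
    then interpret bounded_comp_volterra 1 \<beta> \<phi> g
      by simp
    let ?L1 = "limsup (\<lambda>n. ennreal (real (n + 1)) * weighted_norm \<beta> (\<lambda>z. u z * \<phi> z ^ n))"
    let ?L2 = "limsup (\<lambda>n. ennreal (ln (real n)) * weighted_norm \<beta> (\<lambda>z. w z * \<phi> z ^ n))"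
    show "essential_norm 1 \<beta> T \<le> ennreal ((3 + 2 * 2) * exp 2 * b)" if "max ?L1 ?L2 < ennreal b"
    proof (rule essential_norm_le_from_powers_ge_1[OF log_primitive, where \<kappa> = "\<lambda>n. ln (real n)" and \<kappa>\<^sub>0 = "ln 2"])
      have L: "?L1 < ennreal b" "?L2 < ennreal b"
        using that by auto
      show "\<forall>\<^sub>F n in sequentially. \<forall>z\<in>unit_disc. real (n + 1) powr 1 * (weight \<beta> z * norm (u z * \<phi> z ^ n)) \<le> b"
        using limsup_less_imp_eventually[OF _ less_imp_le[OF b] L(1)] by simp
      show "\<forall>\<^sub>F n in sequentially. \<forall>z\<in>unit_disc. ln (real n) * (weight \<beta> z * norm (w z * \<phi> z ^ n)) \<le> b"
        by (rule limsup_less_imp_eventually[OF _ less_imp_le[OF b] L(2)]) simp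
      fix n :: nat and \<rho> :: real
      assume n: "2 \<le> n" and \<rho>: "0 \<le> \<rho>" "\<rho> < 1" "1 / (1 - \<rho>) \<le> real (n + 1)"
      have "- ln (1 - \<rho>) = ln (1 / (1 - \<rho>))"
        using \<rho> by (simp add: ln_div)
      also have "\<dots> \<le> ln (real n * real n)"
      proof (subst ln_le_cancel_iff)
        have "n + 1 \<le> n * n"
          using n mult_le_mono1[OF n, of n] by linarith
        then have "real (n + 1) \<le> real n * real n"
          by (metis of_nat_le_iff of_nat_mult)
        then show "1 / (1 - \<rho>) \<le> real n * real n"
          using \<rho>(3) by linarith
      qed (use n \<rho> in auto)
      also have "\<dots> = 2 * ln (real n)"
        using n by (subst ln_mult) auto
      finally show "- ln (1 - \<rho>) - - ln (1 - 0) \<le> 2 * ln (real n)"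
        by simp
    qed (use b in auto)
    show "max ?L1 ?L2 \<le> ennreal (max D1 D2 * b)" if e: "essential_norm 1 \<beta> T < ennreal b"
    proof (rule max.boundedI)
      have "?L1 \<le> ennreal (D1 * b)"
        unfolding D1_def M_def
        by (rule eventually_imp_limsup_le[where c = "\<lambda>n. real (n + 1)"])
          (use lower_first_ge_1[OF order_refl b e] b in auto)
      also have "\<dots> \<le> ennreal (max D1 D2 * b)"
        using b by (intro ennreal_leI mult_right_mono) auto
      finally show "?L1 \<le> ennreal (max D1 D2 * b)" .
      have "?L2 \<le> ennreal (D2 * b)"
        unfolding D2_def M_def
        by (rule eventually_imp_limsup_le[OF _ _ lower_second_eq_1[OF refl b e]]) (use b in auto)
      also have "\<dots> \<le> ennreal (max D1 D2 * b)"
        using b by (intro ennreal_leI mult_right_mono) auto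
      finally show "?L2 \<le> ennreal (max D1 D2 * b)" .
    qed
  qed (use M in \<open>auto simp: D1_def less_max_iff_disj\<close>)
qed

lemma essential_norm_comparable_greater_1:
  assumes \<alpha>1: "1 < \<alpha>" and \<beta>: "0 < \<beta>"
  shows "comparable_on_bounded_symbols \<alpha> \<beta>
    (\<lambda>\<phi> g. essential_norm \<alpha> \<beta> (comp_volterra \<phi> g))
    (\<lambda>\<phi> g. max
      (limsup (\<lambda>n. ennreal (real (n + 1) powr \<alpha>) * weighted_norm \<beta> (\<lambda>z. symbol1 \<phi> g z * \<phi> z ^ n)))
      (limsup (\<lambda>n. ennreal (real (n + 1) powr (\<alpha> - 1)) *
        weighted_norm \<beta> (\<lambda>z. symbol2 \<phi> g z * \<phi> z ^ n))))"
proof -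
  define M :: real where "M = (2 * \<alpha>) powr \<alpha> * exp 1"
  define D1 :: real where "D1 = 2 powr \<alpha> * 4 * M"
  define D2 :: real where "D2 = 2 powr (\<alpha> - 1) * (1 + 2 powr \<alpha> * 4) * M"
  have M: "0 < M"
    using \<alpha>1 by (simp add: M_def)
  have \<alpha>0: "0 < \<alpha>"
    using \<alpha>1 by simp
  define c where "c = 1 / (\<alpha> - 1)"
  have c: "0 < c"
    using \<alpha>1 by (simp add: c_def)
  show ?thesis
  proof (rule comparable_on_bounded_symbolsI[OF \<alpha>0 \<beta>, of "(3 + 2 * c) * exp 2" "max D1 D2"])
    fix \<phi> g :: "complex \<Rightarrow> complex" and b :: real
    assume "bounded_comp_volterra \<alpha> \<beta> \<phi> g" and b: "0 < b"
    then interpret bounded_comp_volterra \<alpha> \<beta> \<phi> g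
      by simp
    let ?L1 = "limsup (\<lambda>n. ennreal (real (n + 1) powr \<alpha>) * weighted_norm \<beta> (\<lambda>z. u z * \<phi> z ^ n))"
    let ?L2 = "limsup (\<lambda>n. ennreal (real (n + 1) powr (\<alpha> - 1)) * weighted_norm \<beta> (\<lambda>z. w z * \<phi> z ^ n))"
    show "essential_norm \<alpha> \<beta> T \<le> ennreal ((3 + 2 * c) * exp 2 * b)" if "max ?L1 ?L2 < ennreal b"
    proof (rule essential_norm_le_from_powers_ge_1[where \<kappa> = "\<lambda>n. real (n + 1) powr (\<alpha> - 1)" and \<kappa>\<^sub>0 = 1])
      show "((\<lambda>t. (1 - t) powr (1 - \<alpha>) / (\<alpha> - 1)) has_real_derivative (1 - t) powr (- \<alpha>)) (at t)"
        if "t < 1" for t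
        using \<alpha>1 that by (intro power_primitive) auto
      have L: "?L1 < ennreal b" "?L2 < ennreal b"
        using that by auto
      show "\<forall>\<^sub>F n in sequentially. \<forall>z\<in>unit_disc. real (n + 1) powr \<alpha> * (weight \<beta> z * norm (u z * \<phi> z ^ n)) \<le> b"
        by (rule limsup_less_imp_eventually[OF _ less_imp_le[OF b] L(1)]) simp
      show "\<forall>\<^sub>F n in sequentially. \<forall>z\<in>unit_disc.
          real (n + 1) powr (\<alpha> - 1) * (weight \<beta> z * norm (w z * \<phi> z ^ n)) \<le> b"
        by (rule limsup_less_imp_eventually[OF _ less_imp_le[OF b] L(2)]) simp
      show "1 \<le> real (n + 1) powr (\<alpha> - 1)" for n
        using \<alpha>1 by (intro ge_one_powr_ge_zero) auto
      fix n :: nat and \<rho> :: real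
      assume n: "2 \<le> n" and \<rho>: "0 \<le> \<rho>" "\<rho> < 1" "1 / (1 - \<rho>) \<le> real (n + 1)"
      have "(1 - \<rho>) powr (1 - \<alpha>) = (1 / (1 - \<rho>)) powr (\<alpha> - 1)"
        using \<rho> by (simp add: powr_divide powr_diff)
      also have "\<dots> \<le> real (n + 1) powr (\<alpha> - 1)"
        using \<rho> \<alpha>1 by (intro powr_mono2) auto
      finally have le: "(1 - \<rho>) powr (1 - \<alpha>) / (\<alpha> - 1) \<le> real (n + 1) powr (\<alpha> - 1) / (\<alpha> - 1)"
        using \<alpha>1 by (intro divide_right_mono) auto
      show "(1 - \<rho>) powr (1 - \<alpha>) / (\<alpha> - 1) - (1 - 0) powr (1 - \<alpha>) / (\<alpha> - 1)
          \<le> c * real (n + 1) powr (\<alpha> - 1)"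
      proof -
        have "(1 - 0) powr (1 - \<alpha>) / (\<alpha> - 1) = c"
          by (simp add: c_def)
        moreover have "real (n + 1) powr (\<alpha> - 1) / (\<alpha> - 1) = c * real (n + 1) powr (\<alpha> - 1)"
          by (simp add: c_def)
        ultimately show "?thesis"
          using c le by linarith
      qed
    qed (use b c in auto)
    show "max ?L1 ?L2 \<le> ennreal (max D1 D2 * b)" if e: "essential_norm \<alpha> \<beta> T < ennreal b"
    proof (rule max.boundedI)
      have "?L1 \<le> ennreal (D1 * b)"
        unfolding D1_def M_def
        by (rule eventually_imp_limsup_le[OF _ _ lower_first_ge_1[OF less_imp_le[OF \<alpha>1] b e]]) (use b in auto)
      also have "\<dots> \<le> ennreal (max D1 D2 * b)"
        using b by (intro ennreal_leI mult_right_mono) auto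
      finally show "?L1 \<le> ennreal (max D1 D2 * b)" .
      have "?L2 \<le> ennreal (D2 * b)"
        unfolding D2_def M_def
        by (rule eventually_imp_limsup_le[OF _ _ lower_second_greater_1[OF \<alpha>1 b e]]) (use b in auto)
      also have "\<dots> \<le> ennreal (max D1 D2 * b)"
        using b by (intro ennreal_leI mult_right_mono) auto
      finally show "?L2 \<le> ennreal (max D1 D2 * b)" .
    qed
  qed (use M c in \<open>auto simp: D1_def less_max_iff_disj\<close>)
qed

theorem theorem3p3:
  fixes \<alpha> \<beta> :: real
  assumes "0 < \<alpha>" and "0 < \<beta>"
  shows
    "(\<alpha> < 1 \<longrightarrow> comparable_on_bounded_symbols \<alpha> \<beta>
        (\<lambda>\<phi> g. essential_norm \<alpha> \<beta> (comp_volterra \<phi> g))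
        (\<lambda>\<phi> g. limsup (\<lambda>n. ennreal (real (n + 1) powr \<alpha>) *
                   weighted_norm \<beta> (\<lambda>z. symbol1 \<phi> g z * \<phi> z ^ n)))) \<and>
     (\<alpha> = 1 \<longrightarrow> comparable_on_bounded_symbols \<alpha> \<beta>
        (\<lambda>\<phi> g. essential_norm \<alpha> \<beta> (comp_volterra \<phi> g))
        (\<lambda>\<phi> g. max
           (limsup (\<lambda>n. ennreal (real (n + 1)) *
                   weighted_norm \<beta> (\<lambda>z. symbol1 \<phi> g z * \<phi> z ^ n)))
           (limsup (\<lambda>n. ennreal (ln (real n)) *
                   weighted_norm \<beta> (\<lambda>z. symbol2 \<phi> g z * \<phi> z ^ n))))) \<and>
     (\<alpha> > 1 \<longrightarrow> comparable_on_bounded_symbols \<alpha> \<beta>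
        (\<lambda>\<phi> g. essential_norm \<alpha> \<beta> (comp_volterra \<phi> g))
        (\<lambda>\<phi> g. max
           (limsup (\<lambda>n. ennreal (real (n + 1) powr \<alpha>) *
                   weighted_norm \<beta> (\<lambda>z. symbol1 \<phi> g z * \<phi> z ^ n)))
           (limsup (\<lambda>n. ennreal (real (n + 1) powr (\<alpha> - 1)) *
                   weighted_norm \<beta> (\<lambda>z. symbol2 \<phi> g z * \<phi> z ^ n)))))"
  using assms essential_norm_comparable_less_1[of \<alpha> \<beta>] essential_norm_comparable_eq_1[of \<beta>]
    essential_norm_comparable_greater_1[of \<alpha> \<beta>]
  by auto

end
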